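(* Let $K$ be a finite extension of $\mathbf{Q}_p$ with $e(K/\mathbf{Q}_p) \leq p-1$, and let $f(X) \in X \cdot \mathcal{O}_K[[X]]$ be a noninvertible stable series such that the roots of $f$ and of all of its iterates in $\mathfrak{m}_{\mathbf{C}_p}$ are simple, $f \not\equiv 0 \bmod \mathfrak{m}_K$, and there is a subfield $F$ of $K$ with $f'(0) \in \mathfrak{m}_F$ such that $\mathrm{U}_f'(0) \cap \mathcal{O}_F^\times$ is an open subgroup of $\mathcal{O}_F^\times$. Let $\mathrm{L}(X) \in X + X^2 K[[X]]$ be the unique power series with $\mathrm{L} \circ f = f'(0)\cdot \mathrm{L}$ (equivalently $\mathrm{L}(X) = \lim_{n\to\infty} f^{\circ n}(X)/f'(0)^n$ in the Fréchet space of holomorphic functions on the open unit disk), let $S(X,Y) = \mathrm{L}^{\circ -1}(\mathrm{L}(X) + \mathrm{L}(Y)) \in K[[X,Y]]$ and write $S(X,Y) = \sum_{j \ge 0} s_j(X) Y^j$ with $s_j(X) \in K[[X]]$. Then $s_j(X) \in \mathcal{O}_K[[X]]$ for all $j \geq 0$.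
   Context: For $g(X) \in X\cdot\mathcal{O}_K[[X]]$: $g$ is invertible if $g'(0) \in \mathcal{O}_K^\times$, noninvertible if $g'(0) \in \mathfrak{m}_K$, and stable if $g'(0)$ is neither $0$ nor a root of unity. $\mathrm{U}_f$ is the set of invertible $u \in X\cdot\mathcal{O}_K[[X]]$ with $f\circ u = u \circ f$, and $\mathrm{U}_f'(0) = \{u'(0) : u \in \mathrm{U}_f\}$. $\mathrm{L}^{\circ -1}$ denotes the compositional inverse of $\mathrm{L}$. *)

theory Defs
  imports
    "HOL-Analysis.Abstract_Metric_Spaces"
    "HOL-Computational_Algebra.Computational_Algebra"
begin

section \<open>The field of p-adic complex numbers\<close>

definition nonarch_abs :: "('c::field \<Rightarrow> real) \<Rightarrow> bool" where
  "nonarch_abs N \<longleftrightarrow>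
     (\<forall>x. 0 \<le> N x) \<and> (\<forall>x. N x = 0 \<longleftrightarrow> x = 0) \<and>
     (\<forall>x y. N (x * y) = N x * N y) \<and> (\<forall>x y. N (x + y) \<le> max (N x) (N y))"

definition abs_topology :: "('c::field \<Rightarrow> real) \<Rightarrow> 'c topology" where
  "abs_topology N = Metric_space.mtopology UNIV (\<lambda>x y. N (x - y))"

definition algebraic_over :: "'c::field set \<Rightarrow> 'c \<Rightarrow> bool" where
  "algebraic_over E x \<longleftrightarrow> (\<exists>P. P \<noteq> 0 \<and> (\<forall>i. coeff P i \<in> E) \<and> poly P x = 0)"

text \<open>In a complete field the completion of \<open>\<rat>\<close> is realised as the closure of \<open>\<rat>\<close>.\<close>

definition Qp :: "('c::field_char_0 \<Rightarrow> real) \<Rightarrow> 'c set" where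
  "Qp N = abs_topology N closure_of \<rat>"

definition Qp_bar :: "('c::field_char_0 \<Rightarrow> real) \<Rightarrow> 'c set" where
  "Qp_bar N = {x. algebraic_over (Qp N) x}"

text \<open>
  The field \<open>\<complex>\<^sub>p\<close>, as the completion of an algebraic closure of the completion of \<open>\<rat>\<close>
  at \<open>p\<close>, described up to isometric isomorphism: the whole type is the complete field.
  The normalisation \<open>N p = 1/p\<close> forces \<open>N\<close> to restrict to the \<open>p\<close>-adic absolute value
  on \<open>\<rat>\<close>.
\<close>

definition is_Cp :: "nat \<Rightarrow> ('c::field_char_0 \<Rightarrow> real) \<Rightarrow> bool" where
  "is_Cp p N \<longleftrightarrow>
     prime p \<and> nonarch_abs N \<and> N (of_nat p) = 1 / real p \<and>
     Metric_space.mcomplete UNIV (\<lambda>x y. N (x - y)) \<and>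
     (\<forall>P. (\<forall>i. coeff P i \<in> Qp_bar N) \<and> degree P > 0 \<longrightarrow> (\<exists>x\<in>Qp_bar N. poly P x = 0)) \<and>
     abs_topology N closure_of Qp_bar N = UNIV"


section \<open>Subfields, rings of integers, ramification\<close>

definition is_subfield :: "'c::field set \<Rightarrow> bool" where
  "is_subfield E \<longleftrightarrow>
     0 \<in> E \<and> 1 \<in> E \<and> (\<forall>x\<in>E. \<forall>y\<in>E. x - y \<in> E \<and> x * y \<in> E) \<and> (\<forall>x\<in>E. inverse x \<in> E)"

definition finite_extension :: "'c::field set \<Rightarrow> 'c set \<Rightarrow> bool" where
  "finite_extension E K \<longleftrightarrow>
     is_subfield E \<and> is_subfield K \<and> E \<subseteq> K \<and>
     (\<exists>B. finite B \<and> B \<subseteq> K \<and>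
        (\<forall>x\<in>K. \<exists>c. (\<forall>b\<in>B. c b \<in> E) \<and> x = (\<Sum>b\<in>B. c b * b)))"

definition ring_of_integers :: "('c::field \<Rightarrow> real) \<Rightarrow> 'c set \<Rightarrow> 'c set" where
  "ring_of_integers N K = {x \<in> K. N x \<le> 1}"

definition max_ideal :: "('c::field \<Rightarrow> real) \<Rightarrow> 'c set \<Rightarrow> 'c set" where
  "max_ideal N K = {x \<in> K. N x < 1}"

definition integer_units :: "('c::field \<Rightarrow> real) \<Rightarrow> 'c set \<Rightarrow> 'c set" where
  "integer_units N K =
     {x \<in> ring_of_integers N K. \<exists>y\<in>ring_of_integers N K. x * y = 1}"

text \<open>
  The index of the value group of \<open>E\<close> in that of \<open>K\<close>, obtained by counting the cosets
  \<open>|x| |E\<^sup>\<times>|\<close> for \<open>x\<close> in \<open>K\<^sup>\<times>\<close>.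
\<close>

definition ramification_index :: "('c::field \<Rightarrow> real) \<Rightarrow> 'c set \<Rightarrow> 'c set \<Rightarrow> nat" where
  "ramification_index N E K =
     card ((\<lambda>x. (\<lambda>y. N x * N y) ` (E - {0})) ` (K - {0}))"

definition open_subgroup_of_units :: "('c::field \<Rightarrow> real) \<Rightarrow> 'c set \<Rightarrow> 'c set \<Rightarrow> bool" where
  "open_subgroup_of_units N F W \<longleftrightarrow>
     W \<subseteq> integer_units N F \<and>
     1 \<in> W \<and> (\<forall>x\<in>W. \<forall>y\<in>W. x * y \<in> W) \<and> (\<forall>x\<in>W. inverse x \<in> W) \<and>
     openin (subtopology (abs_topology N) (integer_units N F)) W"


section \<open>Power series over the ring of integers\<close>

text \<open>For \<open>g\<close> without constant term, \<open>g'(0)\<close> is the coefficient \<open>fps_nth g 1\<close>.\<close>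

definition X_int_series :: "('c::field \<Rightarrow> real) \<Rightarrow> 'c set \<Rightarrow> 'c fps set" where
  "X_int_series N K = {g. fps_nth g 0 = 0 \<and> (\<forall>n. fps_nth g n \<in> ring_of_integers N K)}"

definition invertible_series :: "('c::field \<Rightarrow> real) \<Rightarrow> 'c set \<Rightarrow> 'c fps \<Rightarrow> bool" where
  "invertible_series N K g \<longleftrightarrow> g \<in> X_int_series N K \<and> fps_nth g 1 \<in> integer_units N K"

definition noninvertible_series :: "('c::field \<Rightarrow> real) \<Rightarrow> 'c set \<Rightarrow> 'c fps \<Rightarrow> bool" where
  "noninvertible_series N K g \<longleftrightarrow> g \<in> X_int_series N K \<and> fps_nth g 1 \<in> max_ideal N K"

definition stable_series :: "'c::field fps \<Rightarrow> bool" where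
  "stable_series g \<longleftrightarrow> fps_nth g 1 \<noteq> 0 \<and> \<not> (\<exists>n>0. fps_nth g 1 ^ n = 1)"

definition commuting_units :: "('c::field \<Rightarrow> real) \<Rightarrow> 'c set \<Rightarrow> 'c fps \<Rightarrow> 'c fps set" where
  "commuting_units N K f = {u. invertible_series N K u \<and> fps_compose f u = fps_compose u f}"

definition commuting_multipliers :: "('c::field \<Rightarrow> real) \<Rightarrow> 'c set \<Rightarrow> 'c fps \<Rightarrow> 'c set" where
  "commuting_multipliers N K f = (\<lambda>u. fps_nth u 1) ` commuting_units N K f"

definition fps_iterate :: "'c::field fps \<Rightarrow> nat \<Rightarrow> 'c fps" where
  "fps_iterate f n = ((\<lambda>g. fps_compose f g) ^^ n) fps_X"

definition has_value_at :: "('c::field \<Rightarrow> real) \<Rightarrow> 'c fps \<Rightarrow> 'c \<Rightarrow> 'c \<Rightarrow> bool" where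
  "has_value_at N g z y \<longleftrightarrow>
     limitin (abs_topology N) (\<lambda>n. \<Sum>k<n. fps_nth g k * z ^ k) y sequentially"

definition simple_roots_in_disk :: "('c::field \<Rightarrow> real) \<Rightarrow> 'c fps \<Rightarrow> bool" where
  "simple_roots_in_disk N g \<longleftrightarrow>
     (\<forall>z\<in>max_ideal N UNIV. has_value_at N g z 0 \<longrightarrow> \<not> has_value_at N (fps_deriv g) z 0)"


section \<open>Power series in two variables\<close>

text \<open>
  \<open>K[[X,Y]]\<close> is represented as \<open>(K[[X]])[[Y]]\<close>: the coefficient of \<open>Y\<^sup>j\<close> in \<open>G\<close> is the
  series \<open>fps_nth G j\<close> in \<open>X\<close>.
\<close>

definition series_in_X :: "'c::field fps \<Rightarrow> 'c fps fps" where
  "series_in_X g = fps_const g"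

definition series_in_Y :: "'c::field fps \<Rightarrow> 'c fps fps" where
  "series_in_Y g = Abs_fps (\<lambda>j. fps_const (fps_nth g j))"

text \<open>
  The substitution \<open>c(G) = \<Sum>\<^sub>k c\<^sub>k G\<^sup>k\<close> for \<open>G\<close> without constant term.  The library composition
  on \<open>'c fps fps\<close> does not apply, since it requires the coefficient of \<open>Y\<^sup>0\<close> (here a series
  in \<open>X\<close>) to vanish.  By the lemma below, the powers with \<open>k > i + j\<close> do not
  contribute to the coefficient of \<open>X\<^sup>i Y\<^sup>j\<close>.
\<close>

definition fps_subst2 :: "'c::field fps \<Rightarrow> 'c fps fps \<Rightarrow> 'c fps fps" where
  "fps_subst2 c G =
     Abs_fps (\<lambda>j. Abs_fps (\<lambda>i. \<Sum>k\<le>i + j. fps_nth c k * fps_nth (fps_nth (G ^ k) j) i))"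

lemma fps_fps_power_nth_eq_0:
  fixes G :: "'c::field fps fps"
  assumes "fps_nth (fps_nth G 0) 0 = 0" and "i + j < k"
  shows "fps_nth (fps_nth (G ^ k) j) i = 0"
  using assms(2)
proof (induction k arbitrary: i j)
  case 0
  then show ?case by simp
next
  case (Suc k)
  have "fps_nth (fps_nth G a) b * fps_nth (fps_nth (G ^ k) (j - a)) (i - b) = 0"
    if "a \<le> j" "b \<le> i" for a b
  proof (cases "a = 0 \<and> b = 0")
    case True
    then show ?thesis using assms(1) by simp
  next
    case False
    then have "(i - b) + (j - a) < k" using that Suc.prems by linarith
    then show ?thesis using Suc.IH by simp
  qed
  then show ?case
    unfolding power_Suc fps_mult_nth fps_sum_nth by (intro sum.neutral ballI) simp
qed

definition formal_sum_law :: "'c::field_char_0 fps \<Rightarrow> 'c fps fps" where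
  "formal_sum_law L = fps_subst2 (fps_inv L) (series_in_X L + series_in_Y L)"

end

theory Submission
  imports Defs
begin

text \<open>
  Since the roots of the iterates of \<open>f\<close> are simple, \<open>f\<close> has no critical points in the open unit
  disk, so \<open>f'\<close> is \<open>f'(0)\<close> times a unit and \<open>L'\<close> is a unit of the ring of integral series.  The
  equation \<open>L'(X) \<partial>S/\<partial>Y = L'(Y) \<partial>S/\<partial>X\<close> then makes \<open>j! s\<^sub>j\<close> integral.  As \<open>e \<le> p - 1\<close>, the number
  \<open>\<varpi> = p powr (-1 / (p - 1))\<close> bounds the absolute value on the maximal ideal of \<open>K\<close>, and
  \<open>|s\<^sub>j| \<le> (1 / \<varpi>) ^ (j - 1)\<close> by Legendre's estimate for \<open>|j!|\<close>.

  For large \<open>n\<close>, \<open>S(X, f\<^sup>n(X)) = \<Sum>\<^sub>j s\<^sub>j(X) f\<^sup>n(X)\<^sup>j\<close> is the unit with multiplier \<open>1 + f'(0)\<^sup>n\<close>, so it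
  is integral.  The series converges where \<open>|f\<^sup>n| < \<varpi>\<close>; as \<open>f\<^sup>n\<close> is a unit times a power of \<open>X\<close>
  modulo the maximal ideal, this is a disk around \<open>0\<close>, and it contains all the roots of \<open>f\<^sup>n\<close>.
  This permits division by powers of \<open>f\<^sup>n\<close> within the integral series.  Peeling off the \<open>s\<^sub>j\<close> one at
  a time and letting \<open>n\<close> tend to infinity gives the theorem.
\<close>

section \<open>Non-archimedean absolute values\<close>

text \<open>The openness hypothesis acts twice, through commuting units whose multiplier is
  prescribed near 1: \<open>1 + p ^ n\<close>, which is never a root of unity, in the study of
  critical points, and \<open>1 + f'(0) ^ n\<close> in the integrality of S(X, f^n(X)). The second
  choice works because \<open>L\<close> linearises every commuting unit. The step from critical
  points to \<open>f'\<close> rests on the Newton polygon: if the constant term of \<open>f'\<close>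
  were not its largest coefficient, \<open>f'\<close> would vanish somewhere in the disk. As
  \<open>is_Cp\<close> states algebraic closedness for \<open>Qp_bar N\<close> and not for its
  completion, such a zero is made as a limit of roots of truncations, whose coefficients lie in
  \<open>K\<close>. The constants just meet: s_j may grow like varpi^(-(j-1)), and f^n is controlled
  by \<open>varpi\<close> on the disk of radius varpi^(1/D), where D is the order of f^n modulo the
  maximal ideal. Its roots lie strictly inside because f^n has no constant term: the nonzero ones
  satisfy |z|^(D-1) \<le> varpi. This leaves room for the equality e = p - 1.\<close>

locale nonarch_valued =
  fixes N :: "'c::field_char_0 \<Rightarrow> real"
  assumes nonarch: "nonarch_abs N"
begin

lemma N_nonneg [simp]: "0 \<le> N x"
  and N_eq_0_iff [simp]: "N x = 0 \<longleftrightarrow> x = 0"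
  and N_mult: "N (x * y) = N x * N y"
  and N_add_le_max: "N (x + y) \<le> max (N x) (N y)"
  using nonarch unfolding nonarch_abs_def by auto

lemma N_0 [simp]: "N 0 = 0"
  by simp

lemma N_pos_iff [simp]: "0 < N x \<longleftrightarrow> x \<noteq> 0"
  using N_nonneg[of x] N_eq_0_iff[of x] by linarith

lemma N_1 [simp]: "N 1 = 1"
proof -
  have "N 1 * N 1 = N 1 * 1" using N_mult[of 1 1] by simp
  then show ?thesis by (subst (asm) mult_cancel_left) simp
qed

lemma N_power: "N (x ^ n) = N x ^ n"
  by (induction n) (simp_all add: N_mult)

lemma N_minus [simp]: "N (- x) = N x"
proof -
  have "N (-1) ^ 2 = 1" using N_mult[of "-1" "-1"] by (simp add: power2_eq_square)
  then have "N (-1) = 1" using N_nonneg[of "-1"] by (smt (verit) power2_eq_1_iff)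
  then show ?thesis using N_mult[of "-1" x] by simp
qed

lemma N_minus_commute: "N (x - y) = N (y - x)"
  using N_minus[of "x - y"] by simp

lemma N_inverse: "N (inverse x) = inverse (N x)"
proof (cases "x = 0")
  case False
  then have "N x * N (inverse x) = 1" by (simp flip: N_mult)
  then show ?thesis by (simp add: inverse_unique)
qed simp

lemma N_divide: "N (x / y) = N x / N y"
  by (simp add: divide_inverse N_mult N_inverse)

lemma N_add_le: "N x \<le> B \<Longrightarrow> N y \<le> B \<Longrightarrow> N (x + y) \<le> B"
  using N_add_le_max[of x y] by linarith

lemma N_diff_le: "N x \<le> B \<Longrightarrow> N y \<le> B \<Longrightarrow> N (x - y) \<le> B"
  using N_add_le[of x B "- y"] by simp

lemma N_add_eq: "N y < N x \<Longrightarrow> N (x + y) = N x"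
  using N_add_le_max[of x y] N_add_le_max[of "x + y" "- y"] by (simp add: max_def split: if_splits)

lemma N_diff_eq: "N y < N x \<Longrightarrow> N (x - y) = N x"
  using N_add_eq[of "- y" x] by simp

lemma N_sum_le: "(\<And>i. i \<in> A \<Longrightarrow> N (g i) \<le> B) \<Longrightarrow> 0 \<le> B \<Longrightarrow> N (\<Sum>i\<in>A. g i) \<le> B"
  by (induction A rule: infinite_finite_induct) (auto intro: N_add_le)

lemma N_of_nat_le_1: "N (of_nat n) \<le> 1"
  by (induction n) (auto intro: N_add_le)

lemma N_of_int_le_1: "N (of_int n) \<le> 1"
  by (cases n) (auto simp: N_of_nat_le_1 simp del: of_nat_Suc)

text \<open>The largest summand dominates, so the sum inherits the absolute value of one of its
  terms. This turns different cosets of the value group into linear independence.\<close>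

lemma sum_nonzero_of_inj_N:
  assumes "finite I" "I \<noteq> {}" "inj_on (\<lambda>i. N (v i)) I" "\<And>i. i \<in> I \<Longrightarrow> v i \<noteq> 0"
  shows "(\<Sum>i\<in>I. v i) \<noteq> 0"
proof -
  have "\<exists>i\<in>I. N (\<Sum>i\<in>I. v i) = N (v i)"
    using assms(1-3)
  proof (induction I rule: finite_ne_induct)
    case (insert x I)
    then obtain i where i: "i \<in> I" "N (\<Sum>i\<in>I. v i) = N (v i)" by (auto simp: inj_on_insert)
    with insert have "N (v x) \<noteq> N (v i)" by (auto simp: inj_on_def)
    then consider "N (v x) < N (v i)" | "N (v i) < N (v x)" by linarith
    then show ?case
    proof cases
      case 1
      then have "N (v x + (\<Sum>i\<in>I. v i)) = N (v i)"
        using N_add_eq[of "v x" "\<Sum>i\<in>I. v i"] i by (simp add: add.commute)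
      then show ?thesis using insert i by auto
    next
      case 2
      then have "N (v x + (\<Sum>i\<in>I. v i)) = N (v x)" using N_add_eq i by simp
      then show ?thesis using insert by auto
    qed
  qed simp
  then show ?thesis using assms(4) by fastforce
qed

lemma Metric_N: "Metric_space UNIV (\<lambda>x y. N (x - y))"
proof
  fix x y z
  show "N (x - z) \<le> N (x - y) + N (y - z)"
    using N_add_le_max[of "x - y" "y - z"] N_nonneg[of "x - y"] N_nonneg[of "y - z"]
    by (simp del: N_nonneg)
qed (auto simp: N_minus_commute)

end

section \<open>Linear dependence over a subfield\<close>

lemma subfield_closed:
  assumes "is_subfield E"
  shows "0 \<in> E" "1 \<in> E"
    and "x \<in> E \<Longrightarrow> y \<in> E \<Longrightarrow> x - y \<in> E"
    and "x \<in> E \<Longrightarrow> y \<in> E \<Longrightarrow> x + y \<in> E"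
    and "x \<in> E \<Longrightarrow> y \<in> E \<Longrightarrow> x * y \<in> E"
    and "x \<in> E \<Longrightarrow> y \<in> E \<Longrightarrow> x / y \<in> E"
    and "x \<in> E \<Longrightarrow> - x \<in> E"
    and "x \<in> E \<Longrightarrow> x ^ n \<in> E"
    and "of_nat n \<in> E"
proof -
  show 0: "0 \<in> E" "1 \<in> E" and d: "\<And>x y. x \<in> E \<Longrightarrow> y \<in> E \<Longrightarrow> x - y \<in> E"
    and m: "\<And>x y. x \<in> E \<Longrightarrow> y \<in> E \<Longrightarrow> x * y \<in> E"
    using assms unfolding is_subfield_def by auto
  show neg: "- x \<in> E" if "x \<in> E" for x using d[OF 0(1) that] by simp
  show add: "x + y \<in> E" if "x \<in> E" "y \<in> E" for x y using d[OF that(1) neg[OF that(2)]] by simp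
  show "x \<in> E \<Longrightarrow> y \<in> E \<Longrightarrow> x / y \<in> E"
    using assms m[of x "inverse y"] unfolding is_subfield_def by (simp add: divide_inverse)
  show "x \<in> E \<Longrightarrow> x ^ n \<in> E" by (induction n) (auto intro: m 0)
  show "of_nat n \<in> E" by (induction n) (auto intro: add 0)
qed

lemma subfield_sum:
  assumes "is_subfield E" "\<And>i. i \<in> A \<Longrightarrow> g i \<in> E"
  shows "(\<Sum>i\<in>A. g i) \<in> E"
  using assms(2)
  by (induction A rule: infinite_finite_induct)
    (simp_all add: subfield_closed(1)[OF assms(1)] subfield_closed(4)[OF assms(1)])

definition span_over :: "'c::field set \<Rightarrow> 'c set \<Rightarrow> 'c set" where
  "span_over E B = {\<Sum>b\<in>B. c b * b | c. \<forall>b\<in>B. c b \<in> E}"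

lemma span_over_zero: "is_subfield E \<Longrightarrow> 0 \<in> span_over E B"
  unfolding span_over_def by (auto intro!: exI[of _ "\<lambda>_. 0"] simp: subfield_closed(1))

lemma span_over_add:
  assumes "is_subfield E" "x \<in> span_over E B" "y \<in> span_over E B"
  shows "x + y \<in> span_over E B"
proof -
  from assms obtain c d where "\<forall>b\<in>B. c b \<in> E" "x = (\<Sum>b\<in>B. c b * b)"
    "\<forall>b\<in>B. d b \<in> E" "y = (\<Sum>b\<in>B. d b * b)" unfolding span_over_def by auto
  then show ?thesis unfolding span_over_def
    by (auto intro!: exI[of _ "\<lambda>b. c b + d b"] subfield_closed[OF assms(1)] simp: algebra_simps sum.distrib)
qed

lemma span_over_scale:
  assumes "is_subfield E" "a \<in> E" "x \<in> span_over E B"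
  shows "a * x \<in> span_over E B"
proof -
  from assms obtain c where "\<forall>b\<in>B. c b \<in> E" "x = (\<Sum>b\<in>B. c b * b)"
    unfolding span_over_def by auto
  then show ?thesis unfolding span_over_def
    by (auto intro!: exI[of _ "\<lambda>b. a * c b"] subfield_closed[OF assms(1)] assms(2)
        simp: sum_distrib_left mult.assoc)
qed

lemma span_over_sum:
  assumes "is_subfield E" "\<And>i. i \<in> A \<Longrightarrow> g i \<in> span_over E B"
  shows "(\<Sum>i\<in>A. g i) \<in> span_over E B"
  using assms(2)
  by (induction A rule: infinite_finite_induct) (auto intro: span_over_add span_over_zero assms(1))

lemma span_over_base:
  assumes "is_subfield E" "finite B" "b \<in> B"
  shows "b \<in> span_over E B"
proof -
  have "(\<Sum>x\<in>B. (if x = b then 1 else 0) * x) = (\<Sum>x\<in>B. if x = b then x else 0)"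
    by (rule sum.cong) auto
  then have "b = (\<Sum>x\<in>B. (if x = b then 1 else 0) * x)"
    using assms by simp
  then show ?thesis unfolding span_over_def
    by (auto intro!: exI[of _ "\<lambda>x. if x = b then 1 else 0"] subfield_closed[OF assms(1)])
qed

text \<open>Gaussian elimination of one generator at a time. The vectors form an indexed family, so
  that coinciding powers of an element also count as a dependence.\<close>

lemma linear_dependence:
  assumes E: "is_subfield E" and "finite B" and "finite I" and "card B < card I"
    and "\<And>i. i \<in> I \<Longrightarrow> v i \<in> span_over E B"
  shows "\<exists>c. (\<forall>i\<in>I. c i \<in> E) \<and> (\<exists>i\<in>I. c i \<noteq> 0) \<and> (\<Sum>i\<in>I. c i * v i) = 0"
  using assms(2-)
proof (induction B arbitrary: I v rule: finite_induct)
  case empty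
  then obtain i where "i \<in> I" by fastforce
  moreover have "v i = 0" if "i \<in> I" for i using empty.prems(3)[OF that] by (simp add: span_over_def)
  ultimately show ?case by (intro exI[of _ "\<lambda>_. 1"]) (auto intro: subfield_closed[OF E])
next
  case (insert b B)
  have "\<exists>a w. a \<in> E \<and> w \<in> span_over E B \<and> v i = a * b + w" if "i \<in> I" for i
  proof -
    from insert.prems(3)[OF that] obtain c where "\<forall>x\<in>insert b B. c x \<in> E"
      "v i = (\<Sum>x\<in>insert b B. c x * x)" unfolding span_over_def by auto
    then show ?thesis using insert.hyps
      by (intro exI[of _ "c b"] exI[of _ "\<Sum>x\<in>B. c x * x"]) (auto simp: span_over_def)
  qed
  then obtain a w where aw: "\<And>i. i \<in> I \<Longrightarrow> a i \<in> E \<and> w i \<in> span_over E B \<and> v i = a i * b + w i"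
    by metis
  show ?case
  proof (cases "\<forall>i\<in>I. a i = 0")
    case True
    then show ?thesis using insert.IH[of I v] insert.prems insert.hyps aw by auto
  next
    case False
    then obtain k where k: "k \<in> I" "a k \<noteq> 0" by auto
    define v' where "v' i = v i - a i / a k * v k" for i
    have "v' i \<in> span_over E B" if i: "i \<in> I" for i
    proof -
      have "v' i = w i + (- (a i / a k)) * w k"
        using aw[OF i] aw[OF k(1)] k(2) by (simp add: v'_def field_simps)
      moreover have "- (a i / a k) \<in> E"
        using aw[OF i] aw[OF k(1)] by (intro subfield_closed[OF E]) auto
      ultimately show ?thesis
        using aw[OF i] aw[OF k(1)] span_over_add[OF E] span_over_scale[OF E] by metis
    qed
    moreover have "card B < card (I - {k})"
      using insert.prems insert.hyps k by simp
    ultimately obtain c where c: "\<forall>i\<in>I - {k}. c i \<in> E" "\<exists>i\<in>I - {k}. c i \<noteq> 0"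
      "(\<Sum>i\<in>I - {k}. c i * v' i) = 0"
      using insert.IH[of "I - {k}" v'] insert.prems(1) by auto
    \<comment> \<open>The coefficient of the pivot collects the multiples of \<open>v k\<close> that
      were subtracted in \<open>v'\<close>.\<close>
    define s where "s = - (\<Sum>i\<in>I - {k}. c i * (a i / a k))"
    define c' where "c' = c(k := s)"
    have s: "s \<in> E"
      unfolding s_def using c(1) aw k by (auto intro!: subfield_closed[OF E] subfield_sum[OF E])
    have "(\<Sum>i\<in>I. c' i * v i) = c' k * v k + (\<Sum>i\<in>I - {k}. c' i * v i)"
      using insert.prems(1) k(1) by (simp add: sum.remove)
    also have "(\<Sum>i\<in>I - {k}. c' i * v i) = (\<Sum>i\<in>I - {k}. c i * v' i + c i * (a i / a k) * v k)"
      by (rule sum.cong) (auto simp: c'_def v'_def algebra_simps)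
    also have "\<dots> = - s * v k"
      by (simp only: sum.distrib c(3) flip: sum_distrib_right) (simp add: s_def)
    finally have "(\<Sum>i\<in>I. c' i * v i) = 0" by (simp add: c'_def)
    moreover have "\<forall>i\<in>I. c' i \<in> E" using c(1) s by (auto simp: c'_def)
    moreover have "\<exists>i\<in>I. c' i \<noteq> 0" using c(2) by (auto simp: c'_def)
    ultimately show ?thesis by blast
  qed
qed

section \<open>Algebraic elements through finite spans stable under multiplication\<close>

lemma algebraic_over_of_stable_span:
  assumes E: "is_subfield E" and B: "finite B" and one: "1 \<in> span_over E B"
    and stable: "\<And>b. b \<in> span_over E B \<Longrightarrow> x * b \<in> span_over E B"
  shows "algebraic_over E x"
proof -
  have "x ^ i \<in> span_over E B" for i
    by (induction i) (auto intro: one stable)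
  then obtain c where c: "\<forall>i\<in>{..card B}. c i \<in> E" "\<exists>i\<in>{..card B}. c i \<noteq> 0"
      "(\<Sum>i\<in>{..card B}. c i * x ^ i) = 0"
    using linear_dependence[OF E B, of "{..card B}" "\<lambda>i. x ^ i"] by auto
  define P where "P = (\<Sum>i\<le>card B. monom (c i) i)"
  have co: "coeff P i = (if i \<le> card B then c i else 0)" for i
    by (simp add: P_def coeff_sum)
  have "P \<noteq> 0" using c(2) co by (metis atMost_iff coeff_0)
  moreover have "poly P x = 0" using c(3) by (simp add: P_def poly_sum poly_monom)
  ultimately show ?thesis unfolding algebraic_over_def
    using c(1) subfield_closed(1)[OF E] co by (intro exI[of _ P]) auto
qed

lemma stable_span_of_algebraic_over:
  assumes E: "is_subfield E" and "algebraic_over E x"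
  obtains B where "finite B" "1 \<in> span_over E B" "\<And>b. b \<in> B \<Longrightarrow> x * b \<in> span_over E B"
proof -
  from assms(2) obtain P where P: "P \<noteq> 0" "\<And>i. coeff P i \<in> E" "poly P x = 0"
    unfolding algebraic_over_def by auto
  define B where "B = (\<lambda>i. x ^ i) ` {..<degree P}"
  have deg: "degree P > 0"
    using P by (metis bot_nat_0.not_eq_extremum degree_eq_zeroE pCons_0_0 poly_const_conv)
  have fin: "finite B" by (simp add: B_def)
  have pow: "x ^ i \<in> span_over E B" if "i < degree P" for i
    using that by (auto simp: B_def intro!: span_over_base[OF E])
  have "x ^ degree P = (\<Sum>i<degree P. (- (coeff P i / lead_coeff P)) * x ^ i)"
  proof -
    have "0 = (\<Sum>i<degree P. coeff P i * x ^ i) + lead_coeff P * x ^ degree P"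
      using P(3) by (simp add: poly_altdef lessThan_Suc_atMost[symmetric])
    then have "x ^ degree P = - (\<Sum>i<degree P. coeff P i * x ^ i) / lead_coeff P"
      using P(1) by (simp add: field_simps eq_neg_iff_add_eq_0 add.commute)
    also have "\<dots> = (\<Sum>i<degree P. (- (coeff P i / lead_coeff P)) * x ^ i)"
      by (simp add: sum_divide_distrib sum_negf)
    finally show ?thesis .
  qed
  moreover have "\<dots> \<in> span_over E B"
    by (intro span_over_sum[OF E] span_over_scale[OF E] pow subfield_closed[OF E] P(2)) simp
  ultimately have top: "x ^ degree P \<in> span_over E B" by metis
  have "x * b \<in> span_over E B" if "b \<in> B" for b
  proof -
    from that obtain i where i: "i < degree P" "b = x ^ i" by (auto simp: B_def)
    then have "x * b = x ^ Suc i" by simp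
    moreover have "Suc i < degree P \<or> Suc i = degree P" using i by linarith
    ultimately show ?thesis using pow top by metis
  qed
  moreover have "1 \<in> span_over E B" using pow[of 0] deg by simp
  ultimately show ?thesis using that fin by blast
qed

text \<open>The products of generators for \<open>x\<close> with generators for \<open>y\<close>
  span a space stable under both elements, hence under \<open>x + y\<close> and
  \<open>x * y\<close>.\<close>

lemma algebraic_over_pair:
  assumes E: "is_subfield E" and "algebraic_over E x" "algebraic_over E y"
  obtains B where "finite B" "1 \<in> span_over E B"
    "\<And>b. b \<in> span_over E B \<Longrightarrow> x * b \<in> span_over E B"
    "\<And>b. b \<in> span_over E B \<Longrightarrow> y * b \<in> span_over E B"
proof -
  obtain A where A: "finite A" "1 \<in> span_over E A" "\<And>b. b \<in> A \<Longrightarrow> x * b \<in> span_over E A"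
    using stable_span_of_algebraic_over[OF E assms(2)] by blast
  obtain C where C: "finite C" "1 \<in> span_over E C" "\<And>b. b \<in> C \<Longrightarrow> y * b \<in> span_over E C"
    using stable_span_of_algebraic_over[OF E assms(3)] by blast
  define B where "B = (\<lambda>(a, c). a * c) ` (A \<times> C)"
  have fin: "finite B" using A C by (simp add: B_def)
  have prod: "a * c \<in> span_over E B" if a: "a \<in> span_over E A" and c: "c \<in> span_over E C" for a c
  proof -
    from a obtain s where s: "\<forall>b\<in>A. s b \<in> E" "a = (\<Sum>b\<in>A. s b * b)" unfolding span_over_def by auto
    from c obtain t where t: "\<forall>b\<in>C. t b \<in> E" "c = (\<Sum>b\<in>C. t b * b)" unfolding span_over_def by auto
    have "a * c = (\<Sum>b\<in>A. \<Sum>d\<in>C. (s b * t d) * (b * d))"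
      unfolding s(2) t(2) sum_product by (simp add: mult_ac)
    moreover have "b * d \<in> span_over E B" if "b \<in> A" "d \<in> C" for b d
      using that by (auto simp: B_def intro!: span_over_base[OF E] A C)
    moreover have "s b * t d \<in> E" if "b \<in> A" "d \<in> C" for b d
      using that s t subfield_closed(5)[OF E] by blast
    ultimately show ?thesis
      by (metis (no_types, lifting) span_over_sum[OF E] span_over_scale[OF E])
  qed
  have lin: "z * b \<in> span_over E B"
    if z: "\<And>b. b \<in> B \<Longrightarrow> z * b \<in> span_over E B" and b: "b \<in> span_over E B" for z b
  proof -
    from b obtain s where s: "\<forall>b\<in>B. s b \<in> E" "b = (\<Sum>b\<in>B. s b * b)" unfolding span_over_def by auto
    have "z * b = (\<Sum>b\<in>B. s b * (z * b))"
      unfolding s(2) sum_distrib_left by (simp add: mult_ac)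
    then show ?thesis
      using s(1) z by (metis (no_types, lifting) span_over_sum[OF E] span_over_scale[OF E])
  qed
  have "x * b \<in> span_over E B" if "b \<in> B" for b
  proof -
    from that obtain a c where "a \<in> A" "c \<in> C" "b = a * c" by (auto simp: B_def)
    then show ?thesis
      using prod[OF A(3) span_over_base[OF E C(1)]] by (simp add: mult.assoc)
  qed
  moreover have "y * b \<in> span_over E B" if "b \<in> B" for b
  proof -
    from that obtain a c where "a \<in> A" "c \<in> C" "b = a * c" by (auto simp: B_def)
    then show ?thesis
      using prod[OF span_over_base[OF E A(1)] C(3)] by (simp add: mult.left_commute)
  qed
  moreover have "1 \<in> span_over E B" using prod[OF A(2) C(2)] by simp
  ultimately show ?thesis using that fin lin by blast
qed

lemma algebraic_over_add:
  assumes E: "is_subfield E" and "algebraic_over E x" "algebraic_over E y"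
  shows "algebraic_over E (x + y)"
proof -
  obtain B where B: "finite B" "1 \<in> span_over E B"
    "\<And>b. b \<in> span_over E B \<Longrightarrow> x * b \<in> span_over E B"
    "\<And>b. b \<in> span_over E B \<Longrightarrow> y * b \<in> span_over E B"
    using algebraic_over_pair[OF assms] by blast
  show ?thesis
    using B(3,4)
    by (intro algebraic_over_of_stable_span[OF E B(1,2)]) (auto simp: distrib_right intro: span_over_add[OF E])
qed

lemma algebraic_over_mult:
  assumes E: "is_subfield E" and "algebraic_over E x" "algebraic_over E y"
  shows "algebraic_over E (x * y)"
proof -
  obtain B where B: "finite B" "1 \<in> span_over E B"
    "\<And>b. b \<in> span_over E B \<Longrightarrow> x * b \<in> span_over E B"
    "\<And>b. b \<in> span_over E B \<Longrightarrow> y * b \<in> span_over E B"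
    using algebraic_over_pair[OF assms] by blast
  show ?thesis
    using B(3,4)
    by (intro algebraic_over_of_stable_span[OF E B(1,2)]) (auto simp: mult.assoc)
qed

lemma algebraic_over_zero: "is_subfield E \<Longrightarrow> algebraic_over E 0"
  unfolding algebraic_over_def
  by (rule exI[of _ "[:0, 1:]"]) (auto simp: coeff_pCons subfield_closed split: nat.split)

lemma algebraic_over_finite_extension:
  assumes "finite_extension E K" "x \<in> K"
  shows "algebraic_over E x"
proof -
  from assms obtain B where EK: "is_subfield E" "is_subfield K" "E \<subseteq> K" and B: "finite B" "B \<subseteq> K"
    and "\<forall>x\<in>K. \<exists>c. (\<forall>b\<in>B. c b \<in> E) \<and> x = (\<Sum>b\<in>B. c b * b)"
    unfolding finite_extension_def by auto
  then have "K \<subseteq> span_over E B" unfolding span_over_def by auto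
  moreover have "span_over E B \<subseteq> K"
    unfolding span_over_def using EK B
    by (auto intro!: subfield_sum[OF EK(2)] subfield_closed[OF EK(2)])
  ultimately have "span_over E B = K" by blast
  then show ?thesis
    using assms(2) subfield_closed[OF EK(2)]
    by (intro algebraic_over_of_stable_span[OF EK(1) B(1)]) auto
qed

text \<open>Synthetic division by \<open>[:- x, 1:]\<close> uses ring operations only, so the
  quotient keeps its coefficients in \<open>A\<close> and the next root can be split off.\<close>

lemma poly_splits:
  fixes A :: "'c::field set"
  assumes ring: "0 \<in> A" "\<And>x y. x \<in> A \<Longrightarrow> y \<in> A \<Longrightarrow> x + y \<in> A" "\<And>x y. x \<in> A \<Longrightarrow> y \<in> A \<Longrightarrow> x * y \<in> A"
    and closed: "\<And>P. (\<forall>i. coeff P i \<in> A) \<and> degree P > 0 \<Longrightarrow> \<exists>x\<in>A. poly P x = 0"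
    and P: "\<forall>i. coeff P i \<in> A"
  shows "\<exists>c ws. P = smult c (\<Prod>w\<leftarrow>ws. [:- w, 1:])"
  using P
proof (induction "degree P" arbitrary: P)
  case 0
  then obtain c where "P = [:c:]" by (metis degree_eq_zeroE)
  then show ?case by (intro exI[of _ c] exI[of _ "[]"]) (simp add: one_pCons)
next
  case (Suc n)
  then obtain x where x: "x \<in> A" "poly P x = 0" using closed[of P] by auto
  define Q where "Q = synthetic_div P x"
  have PQ: "P = [:- x, 1:] * Q"
    using synthetic_div_correct'[of x P] x by (simp add: Q_def)
  have deg: "n = degree Q" using Suc.hyps(2) by (simp add: Q_def degree_synthetic_div)
  have evA: "poly R x \<in> A" if "\<forall>i. coeff R i \<in> A" for R
    using that
  proof (induction R)
    case (pCons a R)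
    have "a \<in> A" "\<forall>i. coeff R i \<in> A"
      using pCons.prems by (metis coeff_pCons_0, metis coeff_pCons_Suc)
    then show ?case using pCons.IH ring x by simp
  qed (simp add: ring)
  have synA: "\<forall>i. coeff (synthetic_div R x) i \<in> A" if "\<forall>i. coeff R i \<in> A" for R
    using that
  proof (induction R)
    case (pCons a R)
    have "\<forall>i. coeff R i \<in> A"
      using pCons.prems by (metis coeff_pCons_Suc)
    then show ?case using pCons.IH evA by (simp add: coeff_pCons split: nat.split)
  qed (simp add: ring)
  have "\<forall>i. coeff Q i \<in> A" unfolding Q_def by (rule synA) (rule Suc.prems)
  with Suc.hyps(1)[OF deg] obtain c ws where "Q = smult c (\<Prod>w\<leftarrow>ws. [:- w, 1:])" by blast
  then show ?case
    using PQ by (intro exI[of _ c] exI[of _ "x # ws"]) simp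
qed

section \<open>Values of integral power series on the open unit disk\<close>

context nonarch_valued
begin

text \<open>For \<open>r > 0\<close> this bounds the Gauss norm of radius \<open>1 / r\<close> by
  \<open>C\<close>; with \<open>C = r = 1\<close> it says that the coefficients are
  integral.\<close>

definition fps_bound :: "real \<Rightarrow> real \<Rightarrow> 'c fps \<Rightarrow> bool" where
  "fps_bound C r g \<longleftrightarrow> (\<forall>i. N (fps_nth g i) \<le> C * r ^ i)"

abbreviation integral_fps :: "'c fps \<Rightarrow> bool" where
  "integral_fps \<equiv> fps_bound 1 1"

lemma integral_fps_iff: "integral_fps g \<longleftrightarrow> (\<forall>i. N (fps_nth g i) \<le> 1)"
  by (simp add: fps_bound_def)

lemma integral_fpsD: "integral_fps g \<Longrightarrow> N (fps_nth g i) \<le> 1"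
  by (simp add: integral_fps_iff)

lemma fps_bound_mult:
  assumes "fps_bound C r g" "fps_bound C' r h" "0 \<le> C" "0 \<le> C'" "0 \<le> r"
  shows "fps_bound (C * C') r (g * h)"
  unfolding fps_bound_def fps_mult_nth
proof (intro allI N_sum_le)
  fix n i :: nat assume "i \<in> {0..n}"
  then have "N (fps_nth g i * fps_nth h (n - i)) \<le> (C * r ^ i) * (C' * r ^ (n - i))"
    using assms unfolding fps_bound_def N_mult by (intro mult_mono) auto
  also have "\<dots> = C * C' * r ^ n"
    using \<open>i \<in> {0..n}\<close> by (simp flip: power_add)
  finally show "N (fps_nth g i * fps_nth h (n - i)) \<le> C * C' * r ^ n" .
qed (use assms in auto)

lemma fps_bound_diff: "fps_bound C r g \<Longrightarrow> fps_bound C r h \<Longrightarrow> fps_bound C r (g - h)"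
  by (auto simp: fps_bound_def intro: N_diff_le)

lemma fps_bound_sum:
  "(\<And>i. i \<in> A \<Longrightarrow> fps_bound C r (g i)) \<Longrightarrow> 0 \<le> C \<Longrightarrow> 0 \<le> r \<Longrightarrow> fps_bound C r (\<Sum>i\<in>A. g i)"
  unfolding fps_bound_def fps_sum_nth by (intro allI N_sum_le) auto

lemma fps_bound_mono:
  assumes "fps_bound C r g" "C \<le> C'" "r \<le> r'" "0 \<le> C" "0 \<le> r"
  shows "fps_bound C' r' g"
proof -
  have "C * r ^ i \<le> C' * r' ^ i" for i
    using assms by (intro mult_mono power_mono) auto
  then show ?thesis using assms(1) unfolding fps_bound_def by (meson order_trans)
qed

lemma fps_bound_one: "0 \<le> r \<Longrightarrow> fps_bound 1 r 1"
  by (simp add: fps_bound_def)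

lemma integral_fps_fps_const: "N c \<le> 1 \<Longrightarrow> integral_fps (fps_const c)"
  by (simp add: integral_fps_iff)

lemma fps_bound_power:
  assumes "fps_bound C r g" "0 \<le> C" "0 \<le> r"
  shows "fps_bound (C ^ k) r (g ^ k)"
  by (induction k) (use assms in \<open>auto intro: fps_bound_mult fps_bound_one\<close>)

lemma integral_fps_mult: "integral_fps g \<Longrightarrow> integral_fps h \<Longrightarrow> integral_fps (g * h)"
  using fps_bound_mult[of 1 1 g 1 h] by simp

lemma integral_fps_power: "integral_fps g \<Longrightarrow> integral_fps (g ^ k)"
  using fps_bound_power[of 1 1 g k] by simp

lemma integral_fps_compose: "integral_fps g \<Longrightarrow> integral_fps h \<Longrightarrow> integral_fps (g oo h)"
  unfolding integral_fps_iff[of "g oo h"] fps_compose_nth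
  by (intro allI N_sum_le)
    (auto simp: N_mult intro!: mult_le_one integral_fpsD integral_fps_power)

lemma integral_fps_deriv: "integral_fps g \<Longrightarrow> integral_fps (fps_deriv g)"
  unfolding integral_fps_iff
  by (auto simp: N_mult simp del: of_nat_Suc of_nat_add intro!: mult_le_one N_of_nat_le_1)

text \<open>Convergence with the rate that integral coefficients guarantee. The explicit error
  \<open>N z ^ n\<close> reduces products and compositions to finite sums, and for
  \<open>N z < 1\<close> it determines \<open>y\<close>.\<close>

definition disk_value :: "'c fps \<Rightarrow> 'c \<Rightarrow> 'c \<Rightarrow> bool" where
  "disk_value g z y \<longleftrightarrow> (\<forall>n. N (y - (\<Sum>k<n. fps_nth g k * z ^ k)) \<le> N z ^ n)"

lemma disk_value_unique:
  assumes "N z < 1" "disk_value g z y" "disk_value g z y'"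
  shows "y = y'"
proof (rule ccontr)
  assume "y \<noteq> y'"
  then have "0 < N (y - y')" by simp
  then obtain n where n: "N z ^ n < N (y - y')"
    using assms(1) real_arch_pow_inv by blast
  have "N (y - y') \<le> N z ^ n"
    using N_diff_le[of "y - (\<Sum>k<n. fps_nth g k * z ^ k)" "N z ^ n" "y' - (\<Sum>k<n. fps_nth g k * z ^ k)"]
      assms(2,3) by (simp add: disk_value_def)
  with n show False by simp
qed

lemma has_value_at_disk_value:
  assumes "N z < 1" "disk_value g z y"
  shows "has_value_at N g z y"
proof -
  interpret M: Metric_space UNIV "\<lambda>x y. N (x - y)" by (rule Metric_N)
  have "\<forall>\<^sub>F n in sequentially. N ((\<Sum>k<n. fps_nth g k * z ^ k) - y) < e" if "e > 0" for e
  proof -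
    have "(\<lambda>n. N z ^ n) \<longlonglongrightarrow> 0" using assms(1) by (intro LIMSEQ_power_zero) simp
    then have "\<forall>\<^sub>F n in sequentially. N z ^ n < e" using that by (rule order_tendstoD)
    then show ?thesis
    proof eventually_elim
      case (elim n)
      have "N (y - (\<Sum>k<n. fps_nth g k * z ^ k)) \<le> N z ^ n"
        using assms(2) unfolding disk_value_def by blast
      with elim show ?case by (simp add: N_minus_commute[of _ y])
    qed
  qed
  then show ?thesis unfolding has_value_at_def abs_topology_def M.limitin_metric by auto
qed

lemma disk_value_1: "disk_value 1 z 1"
  unfolding disk_value_def
proof
  fix n
  show "N (1 - (\<Sum>k<n. fps_nth 1 k * z ^ k)) \<le> N z ^ n"
  proof (cases n)
    case (Suc m)
    have "(\<Sum>k<n. fps_nth 1 k * z ^ k) = (1 :: 'c)"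
      unfolding Suc sum.lessThan_Suc_shift by simp
    then show ?thesis by simp
  qed simp
qed

lemma disk_value_0:
  assumes "integral_fps g"
  shows "disk_value g 0 (fps_nth g 0)"
  unfolding disk_value_def
proof
  fix n
  show "N (fps_nth g 0 - (\<Sum>k<n. fps_nth g k * 0 ^ k)) \<le> N 0 ^ n"
    using integral_fpsD[OF assms, of 0]
    by (cases n) (auto simp: sum.lessThan_Suc_shift simp del: sum.lessThan_Suc)
qed

lemma disk_value_first_order:
  "disk_value g z y \<Longrightarrow> N (y - fps_nth g 0) \<le> N z"
  unfolding disk_value_def by (drule spec[of _ 1]) simp

lemma disk_value_second_order:
  "disk_value g z y \<Longrightarrow> N (y - fps_nth g 0 - fps_nth g 1 * z) \<le> N z ^ 2"
  unfolding disk_value_def by (drule spec[of _ 2]) (simp add: numeral_2_eq_2 diff_diff_eq)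

lemma disk_value_le_1: "disk_value g z y \<Longrightarrow> N y \<le> 1"
  unfolding disk_value_def by (drule spec[of _ 0]) simp

lemma disk_value_mult:
  assumes g: "integral_fps g" and y: "disk_value g z y" and y': "disk_value h z y'"
  shows "disk_value (g * h) z (y * y')"
  unfolding disk_value_def
proof
  fix n
  define P where "P n = (\<Sum>k<n. fps_nth h k * z ^ k)" for n
  have "(\<Sum>k<n. fps_nth (g * h) k * z ^ k)
      = (\<Sum>k<n. \<Sum>i\<le>k. fps_nth g i * fps_nth h (k - i) * z ^ (i + (k - i)))"
    by (simp add: fps_mult_nth sum_distrib_right atLeast0AtMost)
  also have "\<dots> = (\<Sum>(i, j)\<in>{(i, j). i + j < n}. fps_nth g i * fps_nth h j * z ^ (i + j))"
    by (rule sum.triangle_reindex[symmetric])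
  also have "{(i, j). i + j < n} = Sigma {..<n} (\<lambda>i. {..<n - i})"
    by auto
  also have "(\<Sum>(i, j)\<in>Sigma {..<n} (\<lambda>i. {..<n - i}). fps_nth g i * fps_nth h j * z ^ (i + j))
      = (\<Sum>i<n. fps_nth g i * z ^ i * P (n - i))"
    by (subst sum.Sigma[symmetric]) (auto simp: P_def sum_distrib_left power_add mult_ac)
  \<comment> \<open>The error left for index \<open>i\<close> is the tail of \<open>h\<close> from
    degree \<open>n - i\<close>; together with \<open>z ^ i\<close> it has size at most
    \<open>N z ^ n\<close>.\<close>
  finally have eq: "y * y' - (\<Sum>k<n. fps_nth (g * h) k * z ^ k)
      = (y - (\<Sum>k<n. fps_nth g k * z ^ k)) * y' + (\<Sum>i<n. fps_nth g i * z ^ i * (y' - P (n - i)))"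
    by (simp add: algebra_simps sum_distrib_left sum_subtractf)
  have 1: "N ((y - (\<Sum>k<n. fps_nth g k * z ^ k)) * y') \<le> N z ^ n"
    using mult_mono[of "N (y - (\<Sum>k<n. fps_nth g k * z ^ k))" "N z ^ n" "N y'" 1]
      y disk_value_le_1[OF y'] by (simp add: N_mult disk_value_def)
  have 2: "N (fps_nth g i * z ^ i * (y' - P (n - i))) \<le> N z ^ n" if "i < n" for i
  proof -
    have "N (fps_nth g i * z ^ i) \<le> 1 * N z ^ i"
      unfolding N_mult N_power using integral_fpsD[OF g] by (intro mult_right_mono) auto
    moreover have "N (y' - P (n - i)) \<le> N z ^ (n - i)" using y' by (simp add: disk_value_def P_def)
    ultimately have "N (fps_nth g i * z ^ i) * N (y' - P (n - i)) \<le> N z ^ i * N z ^ (n - i)"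
      by (intro mult_mono) auto
    then show ?thesis using that by (simp add: N_mult flip: power_add)
  qed
  show "N (y * y' - (\<Sum>k<n. fps_nth (g * h) k * z ^ k)) \<le> N z ^ n"
    unfolding eq using 1 2 by (intro N_add_le N_sum_le) auto
qed

lemma disk_value_power:
  assumes "integral_fps g" "disk_value g z y"
  shows "disk_value (g ^ k) z (y ^ k)"
  by (induction k) (use assms in \<open>auto intro: disk_value_mult disk_value_1\<close>)

text \<open>As \<open>u\<close> has no constant term, \<open>u ^ k\<close> begins in degree
  \<open>k\<close>, so the first \<open>n\<close> coefficients of \<open>f oo u\<close> involve only
  \<open>k < n\<close>.\<close>

lemma disk_value_compose:
  assumes f: "integral_fps f" and u: "integral_fps u" and u0: "fps_nth u 0 = 0"
    and y: "disk_value u z y" and w: "disk_value f y w"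
  shows "disk_value (f oo u) z w"
  unfolding disk_value_def
proof
  fix n
  define P where "P k = (\<Sum>m<n. fps_nth (u ^ k) m * z ^ m)" for k
  have Ny: "N y \<le> N z" using disk_value_first_order[OF y] u0 by simp
  have coef: "fps_nth (f oo u) m = (\<Sum>k<n. fps_nth f k * fps_nth (u ^ k) m)" if "m < n" for m
    unfolding fps_compose_nth using that startsby_zero_power_prefix[OF u0]
    by (intro sum.mono_neutral_left) auto
  have "(\<Sum>m<n. fps_nth (f oo u) m * z ^ m) = (\<Sum>m<n. \<Sum>k<n. fps_nth f k * fps_nth (u ^ k) m * z ^ m)"
    by (simp add: coef sum_distrib_right)
  also have "\<dots> = (\<Sum>k<n. fps_nth f k * P k)"
    by (subst sum.swap) (simp add: P_def sum_distrib_left mult_ac)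
  finally have eq: "w - (\<Sum>m<n. fps_nth (f oo u) m * z ^ m)
      = (w - (\<Sum>k<n. fps_nth f k * y ^ k)) + (\<Sum>k<n. fps_nth f k * (y ^ k - P k))"
    by (simp add: algebra_simps sum_subtractf)
  have "N (w - (\<Sum>k<n. fps_nth f k * y ^ k)) \<le> N z ^ n"
    using w power_mono[OF Ny, of n] unfolding disk_value_def by (meson N_nonneg order_trans)
  moreover have "N (fps_nth f k * (y ^ k - P k)) \<le> N z ^ n" for k
  proof -
    have "N (fps_nth f k) * N (y ^ k - P k) \<le> 1 * N z ^ n"
      using disk_value_power[OF u y, of k] integral_fpsD[OF f]
      by (intro mult_mono) (auto simp: disk_value_def P_def)
    then show ?thesis by (simp add: N_mult)
  qed
  ultimately show "N (w - (\<Sum>m<n. fps_nth (f oo u) m * z ^ m)) \<le> N z ^ n"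
    unfolding eq by (intro N_add_le N_sum_le) auto
qed

end

locale complete_nonarch = nonarch_valued +
  assumes complete: "Metric_space.mcomplete UNIV (\<lambda>x y. N (x - y))"
begin

text \<open>In an ultrametric the increments do not add up: all later terms stay within
  \<open>q ^ n\<close> of \<open>s n\<close>, and the limit inherits the bound of a single
  step.\<close>

lemma geometric_Cauchy_limit:
  assumes q: "0 \<le> q" "q < 1" and step: "\<And>n. N (s (Suc n) - s n) \<le> q ^ n"
  shows "\<exists>x. \<forall>n. N (x - s n) \<le> q ^ n"
proof -
  interpret M: Metric_space UNIV "\<lambda>x y. N (x - y)" by (rule Metric_N)
  have diff: "N (s (n + k) - s n) \<le> q ^ n" for n k
  proof (induction k)
    case (Suc k)
    have "q ^ (n + k) \<le> q ^ n" using q by (intro power_decreasing) auto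
    then have "N ((s (Suc (n + k)) - s (n + k)) + (s (n + k) - s n)) \<le> q ^ n"
      using step[of "n + k"] Suc by (intro N_add_le) auto
    then show ?case by simp
  qed (use q in simp)
  have "M.MCauchy s"
    unfolding M.MCauchy_def
  proof (intro conjI allI impI)
    fix e :: real assume "0 < e"
    then obtain m where m: "q ^ m < e" using q real_arch_pow_inv by blast
    have "N (s n - s n') < e" if "m \<le> n" "m \<le> n'" for n n'
    proof -
      have "N (s n - s m) \<le> q ^ m" "N (s n' - s m) \<le> q ^ m"
        using diff[of m "n - m"] diff[of m "n' - m"] that by auto
      from N_diff_le[OF this] show ?thesis using m by simp
    qed
    then show "\<exists>m. \<forall>n n'. m \<le> n \<longrightarrow> m \<le> n' \<longrightarrow> N (s n - s n') < e" by blast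
  qed simp
  then obtain x where "limitin M.mtopology s x sequentially"
    using complete unfolding M.mcomplete_def by blast
  then have lim: "\<And>e. e > 0 \<Longrightarrow> \<forall>\<^sub>F n in sequentially. N (s n - x) < e"
    unfolding M.limitin_metric by auto
  have "N (x - s n) \<le> q ^ n" for n
  proof (rule ccontr)
    assume "\<not> N (x - s n) \<le> q ^ n"
    then have gt: "q ^ n < N (x - s n)" by simp
    then have "0 < N (x - s n)" using q zero_le_power[of q n] by linarith
    from lim[OF this] obtain m where m: "\<And>k. m \<le> k \<Longrightarrow> N (s k - x) < N (x - s n)"
      unfolding eventually_sequentially by blast
    have "N (s (n + m) - x) < N (x - s n)" using m by simp
    then have "N ((x - s n) + (s (n + m) - x)) = N (x - s n)" by (rule N_add_eq)
    then show False using diff[of n m] gt by simp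
  qed
  then show ?thesis by blast
qed

lemma disk_value_exists:
  assumes g: "integral_fps g" and z: "N z < 1"
  shows "\<exists>y. disk_value g z y"
  unfolding disk_value_def
proof (rule geometric_Cauchy_limit)
  show "N ((\<Sum>k<Suc n. fps_nth g k * z ^ k) - (\<Sum>k<n. fps_nth g k * z ^ k)) \<le> N z ^ n" for n
    using mult_right_mono[OF integral_fpsD[OF g, of n], of "N z ^ n"] by (simp add: N_mult N_power)
qed (use z in auto)

end

section \<open>Zeros of power series in the open unit disk\<close>

context nonarch_valued
begin

text \<open>A relation rather than a supremum, so that an index attaining the maximum is at
  hand.\<close>

definition gauss_norm :: "real \<Rightarrow> 'c poly \<Rightarrow> real \<Rightarrow> bool" where
  "gauss_norm r P G \<longleftrightarrow> (\<forall>i. N (coeff P i) * r ^ i \<le> G) \<and> (\<exists>i. N (coeff P i) * r ^ i = G)"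

lemma coeff_linear_mult:
  "coeff ([:- w, 1:] * Q) i = (case i of 0 \<Rightarrow> 0 | Suc j \<Rightarrow> coeff Q j) - w * coeff Q i" for w :: 'c
  by (simp add: coeff_pCons split: nat.split)

text \<open>The upper bound is the ultrametric inequality. For attainment one of the two products in
  a coefficient must strictly dominate, and the index is chosen according to whether
  \<open>w\<close> lies in the disk.\<close>

lemma gauss_norm_linear_mult:
  assumes r: "0 < r" and G: "0 < G" and Q: "gauss_norm r Q G"
  shows "gauss_norm r ([:- w, 1:] * Q) (max r (N w) * G)"
proof -
  let ?q = "\<lambda>i. N (coeff Q i) * r ^ i"
  have q: "?q i \<le> G" for i using Q by (simp add: gauss_norm_def)
  have shift: "N (case i of 0 \<Rightarrow> 0 | Suc j \<Rightarrow> coeff Q j) * r ^ i \<le> r * G" for i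
  proof (cases i)
    case (Suc j)
    then show ?thesis using mult_left_mono[OF q[of j], of r] r by (simp add: mult_ac)
  qed (use r G in simp)
  have "N (coeff ([:- w, 1:] * Q) i) * r ^ i \<le> max r (N w) * G" for i
  proof -
    have "N (coeff ([:- w, 1:] * Q) i) \<le> max r (N w) * G / r ^ i"
      unfolding coeff_linear_mult
    proof (rule N_diff_le)
      have "r * G \<le> max r (N w) * G" using G by (intro mult_right_mono) auto
      then show "N (case i of 0 \<Rightarrow> 0 | Suc j \<Rightarrow> coeff Q j) \<le> max r (N w) * G / r ^ i"
        using shift[of i] r by (simp add: pos_le_divide_eq)
      have "N w * ?q i \<le> max r (N w) * G"
        using q[of i] r by (intro mult_mono) auto
      then show "N (w * coeff Q i) \<le> max r (N w) * G / r ^ i"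
        using r by (simp add: pos_le_divide_eq N_mult mult_ac)
    qed
    then show ?thesis using r by (simp add: pos_le_divide_eq)
  qed
  moreover have "\<exists>i. N (coeff ([:- w, 1:] * Q) i) * r ^ i = max r (N w) * G"
  proof (cases "N w \<le> r")
    case True
    define I where "I = {i. ?q i = G}"
    have "I \<subseteq> {..degree Q}"
      unfolding I_def using G by (auto intro!: le_degree)
    then have fin: "finite I" by (rule finite_subset) simp
    moreover have "I \<noteq> {}" using Q by (auto simp: I_def gauss_norm_def)
    ultimately have "Max I \<in> I" by simp
    \<comment> \<open>The last index attaining the maximum: the next coefficient is strictly smaller
      in weight, so nothing cancels in position \<open>Suc m\<close>.\<close>
    define m where "m = Max I"
    have m: "?q m = G" using \<open>Max I \<in> I\<close> by (simp add: I_def m_def)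
    have "Suc m \<notin> I" using Max_ge[OF fin, of "Suc m"] unfolding m_def by auto
    then have lt: "?q (Suc m) < G" using q[of "Suc m"] by (simp add: I_def)
    have "N (w * coeff Q (Suc m)) * r ^ Suc m \<le> r * ?q (Suc m)"
      using mult_right_mono[OF True, of "?q (Suc m)"] r by (simp add: N_mult mult_ac)
    also have "\<dots> < r * G" using lt r by simp
    also have "\<dots> = N (coeff Q m) * r ^ Suc m" by (simp flip: m)
    finally have "N (w * coeff Q (Suc m)) < N (coeff Q m)" using r by simp
    then have "N (coeff ([:- w, 1:] * Q) (Suc m)) = N (coeff Q m)"
      unfolding coeff_linear_mult using N_diff_eq by simp
    then show ?thesis using True m by (intro exI[of _ "Suc m"]) (simp add: max_def mult_ac)
  next
    case False
    obtain m where m: "?q m = G" using Q by (auto simp: gauss_norm_def)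
    have "N (case m of 0 \<Rightarrow> 0 | Suc j \<Rightarrow> coeff Q j) * r ^ m \<le> r * G" by (rule shift)
    also have "\<dots> < N w * G" using False G by simp
    also have "\<dots> = N (w * coeff Q m) * r ^ m" by (simp add: N_mult flip: m)
    finally have "N (case m of 0 \<Rightarrow> 0 | Suc j \<Rightarrow> coeff Q j) < N (w * coeff Q m)" using r by simp
    then have "N (coeff ([:- w, 1:] * Q) m) = N (w * coeff Q m)"
      unfolding coeff_linear_mult using N_diff_eq N_minus_commute by metis
    then show ?thesis using False m by (intro exI[of _ m]) (simp add: max_def N_mult)
  qed
  ultimately show ?thesis by (simp add: gauss_norm_def)
qed

lemma gauss_norm_split:
  assumes r: "0 < r" and c: "c \<noteq> 0"
  shows "gauss_norm r (smult c (\<Prod>w\<leftarrow>ws. [:- w, 1:])) (N c * (\<Prod>w\<leftarrow>ws. max r (N w)))"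
proof (induction ws)
  case Nil
  have "N (coeff [:c:] i) * r ^ i \<le> N c" for i by (cases i) auto
  then show ?case by (auto simp: gauss_norm_def one_pCons intro!: exI[of _ 0])
next
  case (Cons w ws)
  have "0 < (\<Prod>w\<leftarrow>ws. max r (N w))" using r by (induction ws) (auto simp: less_max_iff_disj)
  then have "0 < N c * (\<Prod>w\<leftarrow>ws. max r (N w))" using c by simp
  from gauss_norm_linear_mult[OF r this Cons.IH, of w]
  show ?case by (simp only: list.map prod_list.Cons mult_smult_right mult.left_commute)
qed

text \<open>
  Comparing the Gauss norms for two radii bounds the number of roots of \<open>P\<close> in the smaller disk
  (Jensen), and the smallness of \<open>P x\<close> then forces one of these roots to be close to \<open>x\<close>.
\<close>

lemma roots_near:
  assumes split: "P = smult c (\<Prod>w\<leftarrow>ws. [:- w, 1:])"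
    and r: "0 < r" "r < r'" and upper: "\<And>i. N (coeff P i) * r' ^ i \<le> 1"
    and lower: "A \<le> N (coeff P k) * r ^ k" "0 < A" and M: "1 < A * (r' / r) ^ M"
  obtains W where "finite W" "card W \<le> M" "\<And>w. w \<in> W \<Longrightarrow> N w \<le> r \<and> poly P w = 0"
    "\<And>x t. N x \<le> r \<Longrightarrow> 0 < t \<Longrightarrow> t \<le> 1 \<Longrightarrow> N (poly P x) < A * t ^ M \<Longrightarrow> \<exists>w\<in>W. N (x - w) \<le> t * r"
proof -
  have c: "c \<noteq> 0" using lower split r by (cases "c = 0") (auto simp: mult_le_0_iff)
  define small where "small = filter (\<lambda>w. N w \<le> r) ws"
  define G where "G = N c * (\<Prod>w\<leftarrow>ws. max r (N w))"
  define G' where "G' = N c * (\<Prod>w\<leftarrow>ws. max r' (N w))"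
  have "A \<le> G"
    using gauss_norm_split[OF r(1) c, of ws] lower unfolding gauss_norm_def G_def split
    by (meson order_trans)
  have "0 < r'" using r by simp
  then obtain i where "N (coeff P i) * r' ^ i = G'"
    using gauss_norm_split[of r' c ws] c unfolding gauss_norm_def G'_def split by blast
  then have "G' \<le> 1" using upper[of i] by simp
  have prod_pos: "0 \<le> (\<Prod>w\<leftarrow>vs. max s (N w))" if "0 < s" for s vs
    using that by (induction vs) (auto simp: le_max_iff_disj)
  \<comment> \<open>Enlarging the radius from \<open>r\<close> to \<open>r'\<close> multiplies the
    factor of each root in the smaller disk by \<open>r' / r\<close> and shrinks no other
    factor.\<close>
  have "(\<Prod>w\<leftarrow>ws. max r (N w)) * (r' / r) ^ length small \<le> (\<Prod>w\<leftarrow>ws. max r' (N w))"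
    unfolding small_def
  proof (induction ws)
    case (Cons w ws)
    show ?case
    proof (cases "N w \<le> r")
      case True
      have "r' * ((\<Prod>w\<leftarrow>ws. max r (N w)) * (r' / r) ^ length (filter (\<lambda>w. N w \<le> r) ws))
          \<le> r' * (\<Prod>w\<leftarrow>ws. max r' (N w))"
        using Cons.IH r by (intro mult_left_mono) auto
      then show ?thesis using True r by (simp add: max_def mult_ac)
    next
      case False
      have "N w * ((\<Prod>w\<leftarrow>ws. max r (N w)) * (r' / r) ^ length (filter (\<lambda>w. N w \<le> r) ws))
          \<le> max r' (N w) * (\<Prod>w\<leftarrow>ws. max r' (N w))"
        using Cons.IH r prod_pos[of r' ws] prod_pos[of r ws] by (intro mult_mono) auto
      then show ?thesis using False r by (simp add: max_def[of r] mult_ac)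
    qed
  qed simp
  then have "G * (r' / r) ^ length small \<le> G'"
    unfolding G_def G'_def using mult_left_mono[of _ _ "N c"] by (simp add: mult.assoc)
  moreover have "A * (r' / r) ^ length small \<le> G * (r' / r) ^ length small"
    using \<open>A \<le> G\<close> r by (intro mult_right_mono) auto
  ultimately have "A * (r' / r) ^ length small \<le> 1" using \<open>G' \<le> 1\<close> by linarith
  have len: "length small \<le> M"
  proof (rule ccontr)
    assume "\<not> length small \<le> M"
    then have "(r' / r) ^ M \<le> (r' / r) ^ length small"
      using r by (intro power_increasing) auto
    then have "A * (r' / r) ^ M \<le> A * (r' / r) ^ length small"
      using lower by (intro mult_left_mono) auto
    then show False using M \<open>A * (r' / r) ^ length small \<le> 1\<close> by linarith
  qed
  have polyP: "N (poly P x) = N c * (\<Prod>w\<leftarrow>ws. N (x - w))" for x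
  proof -
    have "N (poly (\<Prod>w\<leftarrow>ws. [:- w, 1:]) x) = (\<Prod>w\<leftarrow>ws. N (x - w))"
    proof (induction ws)
      case (Cons a ws)
      have eq: "poly (\<Prod>w\<leftarrow>a # ws. [:- w, 1:]) x = (x - a) * poly (\<Prod>w\<leftarrow>ws. [:- w, 1:]) x"
        by (simp add: algebra_simps)
      show ?case unfolding eq N_mult Cons.IH by simp
    qed simp
    then show ?thesis by (simp add: split N_mult)
  qed
  show ?thesis
  proof (rule that[of "set small"])
    show "card (set small) \<le> M" using len card_length[of small] by linarith
    show "N w \<le> r \<and> poly P w = 0" if "w \<in> set small" for w
    proof -
      have "w \<in> set ws" "N w \<le> r" using that by (auto simp: small_def)
      moreover from this(1) have "(\<Prod>v\<leftarrow>ws. N (w - v)) = 0" by (induction ws) auto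
      ultimately show ?thesis using polyP[of w] by simp
    qed
    show "\<exists>w\<in>set small. N (x - w) \<le> t * r"
      if x: "N x \<le> r" and t: "0 < t" "t \<le> 1" and Px: "N (poly P x) < A * t ^ M" for x t
    proof (rule ccontr)
      assume "\<not> (\<exists>w\<in>set small. N (x - w) \<le> t * r)"
      then have far: "\<forall>w\<in>set ws. N w \<le> r \<longrightarrow> t * r < N (x - w)" by (auto simp: small_def)
      \<comment> \<open>A root in the small disk contributes more than \<open>t * r\<close>, and a
        root outside contributes \<open>N w\<close> because \<open>x\<close> lies in the
        disk.\<close>
      then have "(\<Prod>w\<leftarrow>ws. max r (N w)) * t ^ length small \<le> (\<Prod>w\<leftarrow>ws. N (x - w))"
        unfolding small_def
      proof (induction ws)
        case (Cons w ws)
        then have IH: "(\<Prod>w\<leftarrow>ws. max r (N w)) * t ^ length (filter (\<lambda>w. N w \<le> r) ws)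
            \<le> (\<Prod>w\<leftarrow>ws. N (x - w))" by simp
        have nn: "0 \<le> (\<Prod>w\<leftarrow>ws. N (x - w))" by (induction ws) auto
        show ?case
        proof (cases "N w \<le> r")
          case True
          have "(t * r) * ((\<Prod>w\<leftarrow>ws. max r (N w)) * t ^ length (filter (\<lambda>w. N w \<le> r) ws))
              \<le> N (x - w) * (\<Prod>w\<leftarrow>ws. N (x - w))"
            using IH Cons.prems True t r prod_pos[of r ws] by (intro mult_mono) auto
          then show ?thesis using True by (simp add: max_def mult_ac)
        next
          case False
          have "N (x - w) = N w"
            using False x N_diff_eq[of x w] N_minus_commute[of x w] by simp
          then have "N w * ((\<Prod>w\<leftarrow>ws. max r (N w)) * t ^ length (filter (\<lambda>w. N w \<le> r) ws))
              \<le> N (x - w) * (\<Prod>w\<leftarrow>ws. N (x - w))"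
            using IH by (simp add: mult_left_mono)
          then show ?thesis using False by (simp add: max_def mult_ac)
        qed
      qed simp
      then have "G * t ^ length small \<le> N (poly P x)"
        unfolding G_def polyP using mult_left_mono[of _ _ "N c"] by (simp add: mult.assoc)
      moreover have "A * t ^ M \<le> G * t ^ length small"
        using \<open>A \<le> G\<close> len t lower by (intro mult_mono power_decreasing) auto
      ultimately show False using Px by linarith
    qed
  qed simp
qed

section \<open>Roots of truncated series\<close>

definition fps_trunc_poly :: "'c fps \<Rightarrow> nat \<Rightarrow> 'c poly" where
  "fps_trunc_poly g n = (\<Sum>k<n. monom (fps_nth g k) k)"

lemma coeff_fps_trunc_poly: "coeff (fps_trunc_poly g n) i = (if i < n then fps_nth g i else 0)"
  by (simp add: fps_trunc_poly_def coeff_sum)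

lemma poly_fps_trunc_poly: "poly (fps_trunc_poly g n) x = (\<Sum>k<n. fps_nth g k * x ^ k)"
  by (simp add: fps_trunc_poly_def poly_sum poly_monom)

text \<open>The bounds of \<open>roots_near\<close> depend on \<open>g\<close> only through its
  \<open>k\<close>-th coefficient, so \<open>M\<close> and \<open>q\<close> serve all truncations
  from \<open>m\<close> on. The exponent \<open>n - 1\<close> fits a root of the previous
  truncation, at which the new one reduces to its term of degree \<open>n - 1\<close>.\<close>

lemma fps_trunc_poly_roots:
  assumes g: "integral_fps g"
    and splits: "\<And>n. \<exists>c ws. fps_trunc_poly g n = smult c (\<Prod>w\<leftarrow>ws. [:- w, 1:])"
    and r: "0 < r" "r < 1" and k: "fps_nth g k \<noteq> 0"
  obtains W M q m where "0 < q" "q < 1" "k < m"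
    "\<And>n. m \<le> n \<Longrightarrow> finite (W n) \<and> card (W n) \<le> M"
    "\<And>n w. m \<le> n \<Longrightarrow> w \<in> W n \<Longrightarrow> N w \<le> r \<and> poly (fps_trunc_poly g n) w = 0"
    "\<And>n x. m \<le> n \<Longrightarrow> N x \<le> r \<Longrightarrow> N (poly (fps_trunc_poly g n) x) < N (fps_nth g k) * r ^ k \<Longrightarrow> W n \<noteq> {}"
    "\<And>n x. m \<le> n \<Longrightarrow> N x \<le> r \<Longrightarrow> N (poly (fps_trunc_poly g n) x) \<le> r ^ (n - 1) \<Longrightarrow> \<exists>w\<in>W n. N (x - w) \<le> q ^ n"
proof -
  define r' where "r' = (1 + r) / 2"
  have r': "r < r'" "r' < 1" using r by (auto simp: r'_def)
  define A where "A = N (fps_nth g k) * r ^ k"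
  have A: "0 < A" using k r by (simp add: A_def)
  obtain M0 where "1 / A < (r' / r) ^ M0"
    using real_arch_pow[of "r' / r" "1 / A"] r r' by auto
  define M where "M = Suc M0"
  have "(r' / r) ^ M0 \<le> (r' / r) ^ M" using r r' by (intro power_increasing) (auto simp: M_def)
  with \<open>1 / A < (r' / r) ^ M0\<close> have "1 / A < (r' / r) ^ M" by linarith
  then have M: "1 < A * (r' / r) ^ M"
    using A by (simp add: pos_divide_less_eq mult.commute)
  \<comment> \<open>Chosen so that \<open>q ^ M\<close> is the square root of \<open>r\<close>,
    hence larger than \<open>r\<close>: then \<open>(q ^ n) ^ M\<close> eventually outweighs the
    error \<open>r ^ (n - 1)\<close>. \<open>M\<close> is a successor to make the exponent
    meaningful.\<close>
  define q where "q = r powr (1 / (2 * real M))"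
  have q: "0 < q" "q < 1" using r powr_less_mono'[of r 0 "1 / (2 * real M)"] by (auto simp: q_def M_def)
  have "q ^ M = r powr (1 / 2)"
    using powr_realpow[OF q(1), of M] by (simp add: q_def powr_powr M_def del: of_nat_Suc)
  moreover have "r powr 1 < r powr (1 / 2)" using r by (intro powr_less_mono') auto
  ultimately have qM: "r < q ^ M" using r by simp
  then have "(\<lambda>n. (r / q ^ M) ^ n) \<longlonglongrightarrow> 0" using r q by (intro LIMSEQ_power_zero) simp
  then have "\<forall>\<^sub>F n in sequentially. (r / q ^ M) ^ n < A * r"
    using A r by (intro order_tendstoD) auto
  then obtain m0 where m0: "\<And>n. m0 \<le> n \<Longrightarrow> (r / q ^ M) ^ n < A * r"
    unfolding eventually_sequentially by blast
  define m where "m = Suc (max m0 k)"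
  have small: "r ^ (n - 1) < A * (q ^ n) ^ M" if "m \<le> n" for n
  proof -
    have "r ^ n < (A * r) * (q ^ M) ^ n"
      using m0[of n] that q by (simp add: m_def power_divide pos_divide_less_eq)
    moreover have "r ^ n = r * r ^ (n - 1)" using that by (cases n) (auto simp: m_def)
    ultimately have "r * r ^ (n - 1) < r * (A * (q ^ M) ^ n)" by (simp add: mult_ac)
    then show ?thesis using r by (simp add: power_mult[symmetric] mult.commute)
  qed
  have "\<exists>W. finite W \<and> card W \<le> M \<and> (\<forall>w\<in>W. N w \<le> r \<and> poly (fps_trunc_poly g n) w = 0) \<and>
      (\<forall>x t. N x \<le> r \<longrightarrow> 0 < t \<longrightarrow> t \<le> 1 \<longrightarrow> N (poly (fps_trunc_poly g n) x) < A * t ^ M \<longrightarrow>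
        (\<exists>w\<in>W. N (x - w) \<le> t * r))" if n: "m \<le> n" for n
  proof -
    obtain c ws where cw: "fps_trunc_poly g n = smult c (\<Prod>w\<leftarrow>ws. [:- w, 1:])" using splits by blast
    have up: "N (coeff (fps_trunc_poly g n) i) * r' ^ i \<le> 1" for i
      using integral_fpsD[OF g, of i] r' r
      by (auto simp: coeff_fps_trunc_poly intro!: mult_le_one power_le_one)
    have lo: "A \<le> N (coeff (fps_trunc_poly g n) k) * r ^ k"
      using n by (auto simp: coeff_fps_trunc_poly A_def m_def)
    show ?thesis
      using roots_near[OF cw r(1) r'(1) up lo A M] by metis
  qed
  then obtain W where W: "\<And>n. m \<le> n \<Longrightarrow> finite (W n) \<and> card (W n) \<le> M \<and>
      (\<forall>w\<in>W n. N w \<le> r \<and> poly (fps_trunc_poly g n) w = 0) \<and>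
      (\<forall>x t. N x \<le> r \<longrightarrow> 0 < t \<longrightarrow> t \<le> 1 \<longrightarrow> N (poly (fps_trunc_poly g n) x) < A * t ^ M \<longrightarrow>
        (\<exists>w\<in>W n. N (x - w) \<le> t * r))" by metis
  show ?thesis
  proof (rule that[of q m W M])
    show "k < m" by (simp add: m_def)
    \<comment> \<open>The case \<open>t = 1\<close> of the statement about nearby roots.\<close>
    show "W n \<noteq> {}" if "m \<le> n" "N x \<le> r"
      "N (poly (fps_trunc_poly g n) x) < N (fps_nth g k) * r ^ k" for n x
      using W[OF that(1)] that(2,3) unfolding A_def[symmetric]
      by (metis empty_iff less_numeral_extra(1) mult.right_neutral order_refl power_one)
    show "\<exists>w\<in>W n. N (x - w) \<le> q ^ n" if mn: "m \<le> n" and x: "N x \<le> r" and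
      "N (poly (fps_trunc_poly g n) x) \<le> r ^ (n - 1)" for n x
    proof -
      have "N (poly (fps_trunc_poly g n) x) < A * (q ^ n) ^ M" using small[OF mn] that by linarith
      then obtain w where "w \<in> W n" "N (x - w) \<le> q ^ n * r"
        using W[OF mn] x q by (metis less_imp_le power_le_one zero_less_power)
      moreover have "q ^ n * r \<le> q ^ n * 1" using q r by (intro mult_left_mono) auto
      ultimately show ?thesis by (intro bexI[of _ w]) linarith+
    qed
  qed (use q W in blast)+
qed

text \<open>Each zero in the closed disk is within \<open>q ^ n\<close> of one of at most
  \<open>M\<close> roots of a truncation. Among \<open>M + 1\<close> distinct zeros two would share
  such a root and be closer than their minimal distance \<open>\<delta>\<close>.\<close>

lemma zeros_repeat:
  assumes g: "integral_fps g" "g \<noteq> 0"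
    and splits: "\<And>n. \<exists>c ws. fps_trunc_poly g n = smult c (\<Prod>w\<leftarrow>ws. [:- w, 1:])"
    and r: "0 < r" "r < 1"
    and x: "\<And>i::nat. N (x i) \<le> r" "\<And>i. disk_value g (x i) 0"
  shows "\<exists>i j. i < j \<and> x i = x j"
proof (rule ccontr)
  assume "\<not> ?thesis"
  then have inj: "x i \<noteq> x j" if "i \<noteq> j" for i j using that by (metis linorder_neqE_nat)
  obtain k where k: "fps_nth g k \<noteq> 0" using g(2) by (auto simp: fps_eq_iff)
  obtain W M q m where q: "0 < q" "q < 1" "k < m"
    and W: "\<And>n. m \<le> n \<Longrightarrow> finite (W n) \<and> card (W n) \<le> M"
    and root: "\<And>n w. m \<le> n \<Longrightarrow> w \<in> W n \<Longrightarrow> N w \<le> r \<and> poly (fps_trunc_poly g n) w = 0"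
    and ne: "\<And>n x. m \<le> n \<Longrightarrow> N x \<le> r \<Longrightarrow> N (poly (fps_trunc_poly g n) x) < N (fps_nth g k) * r ^ k \<Longrightarrow> W n \<noteq> {}"
    and near: "\<And>n x. m \<le> n \<Longrightarrow> N x \<le> r \<Longrightarrow> N (poly (fps_trunc_poly g n) x) \<le> r ^ (n - 1) \<Longrightarrow> \<exists>w\<in>W n. N (x - w) \<le> q ^ n"
    by (rule fps_trunc_poly_roots[OF g(1) splits r k]) (rule that; blast)
  define D where "D = (\<lambda>(i, j). N (x i - x j)) ` ({..M} \<times> {..M} \<inter> {(i, j). i \<noteq> j})"
  have finD: "finite D" by (auto simp: D_def)
  have posD: "0 < d" if "d \<in> D" for d using that inj by (auto simp: D_def)
  obtain \<delta> where d: "0 < \<delta>" "\<And>d. d \<in> D \<Longrightarrow> \<delta> \<le> d"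
  proof (cases "D = {}")
    case False
    then show ?thesis using that[of "Min D"] finD posD by simp
  qed (use that[of 1] in auto)
  have "(\<lambda>n. q ^ n) \<longlonglongrightarrow> 0" using q by (intro LIMSEQ_power_zero) simp
  then have "\<forall>\<^sub>F n in sequentially. q ^ n < \<delta>" using d by (intro order_tendstoD) auto
  then obtain n where n: "m \<le> n" "q ^ n < \<delta>"
    unfolding eventually_sequentially by (metis nat_le_linear)
  have "\<exists>w\<in>W n. N (x i - w) \<le> q ^ n" for i
  proof (rule near[OF n(1) x(1)])
    have "N (0 - poly (fps_trunc_poly g n) (x i)) \<le> N (x i) ^ n"
      using x(2)[of i] unfolding disk_value_def poly_fps_trunc_poly by blast
    also have "\<dots> \<le> r ^ n" using x(1) by (intro power_mono) auto
    also have "\<dots> \<le> r ^ (n - 1)" using r by (intro power_decreasing) auto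
    finally show "N (poly (fps_trunc_poly g n) (x i)) \<le> r ^ (n - 1)" by simp
  qed
  then obtain w where w: "\<And>i. w i \<in> W n" "\<And>i. N (x i - w i) \<le> q ^ n" by metis
  have "\<not> inj_on w {..M}"
    using W[OF n(1)] w(1) card_inj_on_le[of w "{..M}" "W n"] by fastforce
  then obtain i j where ij: "i \<le> M" "j \<le> M" "i \<noteq> j" "w i = w j" by (auto simp: inj_on_def)
  have "N (x i - x j) \<le> q ^ n"
    using N_diff_le[OF w(2)[of i] w(2)[of j]] ij by simp
  moreover have "N (x i - x j) \<in> D" unfolding D_def using ij by (intro image_eqI[of _ _ "(i, j)"]) auto
  ultimately show False using d(2) n(2) by fastforce
qed

lemma poly_trunc_Lipschitz:
  assumes g: "integral_fps g" and "N x \<le> 1" "N y \<le> 1"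
  shows "N (poly (fps_trunc_poly g n) x - poly (fps_trunc_poly g n) y) \<le> N (x - y)"
proof -
  have pow: "N (x ^ k - y ^ k) \<le> N (x - y)" for k
  proof (induction k)
    case (Suc k)
    have "x ^ Suc k - y ^ Suc k = x ^ k * (x - y) + (x ^ k - y ^ k) * y" by (simp add: algebra_simps)
    moreover have "N (x ^ k * (x - y)) \<le> N (x - y)"
      using assms by (simp add: N_mult N_power mult_left_le_one_le power_le_one)
    moreover have "N ((x ^ k - y ^ k) * y) \<le> N (x - y)"
      using Suc assms mult_mono[of "N (x ^ k - y ^ k)" "N (x - y)" "N y" 1] by (simp add: N_mult)
    ultimately show ?case using N_add_le by metis
  qed simp
  have "poly (fps_trunc_poly g n) x - poly (fps_trunc_poly g n) y = (\<Sum>k<n. fps_nth g k * (x ^ k - y ^ k))"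
    by (simp add: poly_fps_trunc_poly algebra_simps sum_subtractf)
  also have "N \<dots> \<le> N (x - y)"
    using integral_fpsD[OF g] pow mult_mono[of "N (fps_nth g _)" 1 "N (x ^ _ - y ^ _)" "N (x - y)"]
    by (intro N_sum_le) (auto simp: N_mult)
  finally show ?thesis .
qed

end

section \<open>Existence of a zero\<close>

context complete_nonarch
begin

text \<open>The hypothesis on \<open>k\<close> gives the Newton polygon a side of negative slope.
  The zero is the limit of roots of successive truncations, each of which is nearly a root of the
  next truncation.\<close>

lemma zero_exists:
  assumes g: "integral_fps g"
    and splits: "\<And>n. \<exists>c ws. fps_trunc_poly g n = smult c (\<Prod>w\<leftarrow>ws. [:- w, 1:])"
    and k: "N (fps_nth g 0) < N (fps_nth g k)"
  shows "\<exists>z. N z < 1 \<and> disk_value g z 0"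
proof -
  have gk: "fps_nth g k \<noteq> 0" using k N_nonneg[of "fps_nth g 0"] by (metis N_0 linorder_not_less)
  \<comment> \<open>The strict inequality at radius \<open>1\<close> persists for radii slightly
    below \<open>1\<close>.\<close>
  have "\<exists>r. 0 < r \<and> r < 1 \<and> N (fps_nth g 0) < N (fps_nth g k) * r ^ k"
  proof -
    have "((\<lambda>r. N (fps_nth g k) * r ^ k) \<longlongrightarrow> N (fps_nth g k) * 1 ^ k) (at_left 1)"
      by (intro tendsto_intros)
    then have "\<forall>\<^sub>F r in at_left 1. N (fps_nth g 0) < N (fps_nth g k) * r ^ k"
      using k by (intro order_tendstoD) auto
    moreover have "\<forall>\<^sub>F r in at_left (1::real). 0 < r \<and> r < 1"
      using eventually_at_left_real[of 0 "1::real"] by (auto elim: eventually_mono)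
    ultimately have "\<forall>\<^sub>F r in at_left (1::real). N (fps_nth g 0) < N (fps_nth g k) * r ^ k \<and> 0 < r \<and> r < 1"
      by (rule eventually_conj)
    then show ?thesis using eventually_happens'[OF trivial_limit_at_left_real] by blast
  qed
  then obtain r where r: "0 < r" "r < 1" and rk: "N (fps_nth g 0) < N (fps_nth g k) * r ^ k" by blast
  obtain W M q m where q: "0 < q" "q < 1" "k < m"
    and W: "\<And>n. m \<le> n \<Longrightarrow> finite (W n) \<and> card (W n) \<le> M"
    and root: "\<And>n w. m \<le> n \<Longrightarrow> w \<in> W n \<Longrightarrow> N w \<le> r \<and> poly (fps_trunc_poly g n) w = 0"
    and ne: "\<And>n x. m \<le> n \<Longrightarrow> N x \<le> r \<Longrightarrow> N (poly (fps_trunc_poly g n) x) < N (fps_nth g k) * r ^ k \<Longrightarrow> W n \<noteq> {}"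
    and near: "\<And>n x. m \<le> n \<Longrightarrow> N x \<le> r \<Longrightarrow> N (poly (fps_trunc_poly g n) x) \<le> r ^ (n - 1) \<Longrightarrow> \<exists>w\<in>W n. N (x - w) \<le> q ^ n"
    by (rule fps_trunc_poly_roots[OF g splits r gk]) (rule that; blast)
  have "\<exists>s. \<forall>n. s n \<in> W (m + n) \<and> N (s (Suc n) - s n) \<le> q ^ n"
  proof (rule dependent_nat_choice)
    have "poly (fps_trunc_poly g m) 0 = fps_nth g 0"
      using \<open>k < m\<close> by (simp add: poly_0_coeff_0 coeff_fps_trunc_poly)
    then have "W m \<noteq> {}" using ne[of m 0] rk r by simp
    then show "\<exists>x. x \<in> W (m + 0)" by auto
  next
    fix x n assume x: "x \<in> W (m + n)"
    have Nx: "N x \<le> r" and 0: "poly (fps_trunc_poly g (m + n)) x = 0" using root[OF _ x] by auto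
    have "N (poly (fps_trunc_poly g (m + Suc n)) x) = N (fps_nth g (m + n) * x ^ (m + n))"
      using 0 by (simp add: poly_fps_trunc_poly)
    also have "\<dots> \<le> 1 * r ^ (m + n)"
      unfolding N_mult N_power using integral_fpsD[OF g] Nx by (intro mult_mono power_mono) auto
    finally obtain w where w: "w \<in> W (m + Suc n)" "N (x - w) \<le> q ^ (m + Suc n)"
      using near[of "m + Suc n" x] Nx by auto
    have "q ^ (m + Suc n) \<le> q ^ n" using q by (intro power_decreasing) auto
    then have "N (w - x) \<le> q ^ n" using w(2) by (simp add: N_minus_commute)
    with w(1) show "\<exists>y. y \<in> W (m + Suc n) \<and> N (y - x) \<le> q ^ n" by blast
  qed
  then obtain s where s: "\<And>n. s n \<in> W (m + n)" "\<And>n. N (s (Suc n) - s n) \<le> q ^ n" by blast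
  have Ns: "N (s n) \<le> r" and Ps: "poly (fps_trunc_poly g (m + n)) (s n) = 0" for n
    using root[OF _ s(1)] by auto
  obtain z where z: "\<And>n. N (z - s n) \<le> q ^ n"
    using geometric_Cauchy_limit[of q s] q s(2) by auto
  obtain n1 where "q ^ n1 < r" using q r real_arch_pow_inv by blast
  have Nz: "N z \<le> r"
    using N_add_le[of "z - s n1" r "s n1"] z[of n1] Ns[of n1] \<open>q ^ n1 < r\<close> by simp
  obtain v where v: "disk_value g z v" using disk_value_exists[OF g] Nz r by fastforce
  have "v = 0"
  proof (rule ccontr)
    assume "v \<noteq> 0"
    \<comment> \<open>One rate for both errors: the tail of \<open>g\<close> at \<open>z\<close>,
      governed by \<open>r\<close>, and the distance from \<open>z\<close> to the approximate root,
      governed by \<open>q\<close>.\<close>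
    define e where "e = max q r"
    have e: "0 < e" "e < 1" using q r by (auto simp: e_def)
    obtain n where n: "e ^ n < N v" using real_arch_pow_inv[of "N v" e] e \<open>v \<noteq> 0\<close> by auto
    have "N (v - poly (fps_trunc_poly g (m + n)) z) \<le> N z ^ (m + n)"
      using v unfolding disk_value_def poly_fps_trunc_poly by blast
    also have "\<dots> \<le> e ^ (m + n)" using Nz by (intro power_mono) (auto simp: e_def)
    also have "\<dots> \<le> e ^ n" using e by (intro power_decreasing) auto
    finally have 1: "N (v - poly (fps_trunc_poly g (m + n)) z) \<le> e ^ n" .
    have "N (poly (fps_trunc_poly g (m + n)) z - poly (fps_trunc_poly g (m + n)) (s n)) \<le> N (z - s n)"
      using Nz Ns[of n] r by (intro poly_trunc_Lipschitz g) auto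
    also have "\<dots> \<le> q ^ n" by (rule z)
    also have "\<dots> \<le> e ^ n" using q by (intro power_mono) (auto simp: e_def)
    finally have "N (poly (fps_trunc_poly g (m + n)) z) \<le> e ^ n" by (simp add: Ps)
    from N_add_le[OF 1 this] n show False by simp
  qed
  then show ?thesis using v Nz r by (intro exI[of _ z]) auto
qed

end

section \<open>The value group of a finite extension of the p-adic numbers\<close>

locale padic_valued = nonarch_valued N for N :: "'c::field_char_0 \<Rightarrow> real" +
  fixes p :: nat
  assumes p: "prime p" and N_p: "N (of_nat p) = 1 / real p"
begin

lemma p_gt_1: "1 < p"
  using p prime_gt_1_nat by blast

text \<open>Bezout writes \<open>1\<close> as a combination of \<open>p\<close> and
  \<open>n\<close>, in which the multiple of \<open>p\<close> is too small to reach absolute value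
  \<open>1\<close>.\<close>

lemma N_of_nat_coprime:
  assumes "\<not> p dvd n"
  shows "N (of_nat n) = 1"
proof (rule antisym[OF N_of_nat_le_1])
  have "coprime (int p) (int n)" using p assms by (simp add: prime_imp_coprime)
  then obtain a b where ab: "a * int p + b * int n = 1"
    using bezout_int[of "int p" "int n"] by (metis coprime_imp_gcd_eq_1)
  have "1 = N (of_int (a * int p + b * int n))" by (simp only: ab) simp
  also have "\<dots> = N (of_int a * of_nat p + of_int b * of_nat n)" by simp
  also have "\<dots> \<le> max (N (of_int a * of_nat p)) (N (of_int b * of_nat n))" by (rule N_add_le_max)
  finally have "1 \<le> max (N (of_int a) * (1 / p)) (N (of_int b) * N (of_nat n))" by (simp add: N_mult N_p)
  moreover have "N (of_int a) * (1 / p) < 1"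
    using N_of_int_le_1[of a] p_gt_1 by (simp add: divide_simps)
  moreover have "N (of_int b) * N (of_nat n) \<le> N (of_nat n)"
    using N_of_int_le_1[of b] by (simp add: mult_left_le_one_le)
  ultimately show "1 \<le> N (of_nat n)" by linarith
qed

lemma N_of_nat_power: "n > 0 \<Longrightarrow> \<exists>k. N (of_nat n) = (1 / real p) ^ k"
proof (induction n rule: less_induct)
  case (less n)
  show ?case
  proof (cases "p dvd n")
    case True
    then obtain m where m: "n = p * m" by blast
    then have "m < n" "m > 0" using less.prems p_gt_1 by auto
    with less.IH obtain k where "N (of_nat m) = (1 / real p) ^ k" by blast
    then show ?thesis using m by (intro exI[of _ "Suc k"]) (simp add: N_mult N_p)
  next
    case False
    then show ?thesis using N_of_nat_coprime by (intro exI[of _ 0]) simp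
  qed
qed

lemma N_Rats:
  assumes "x \<in> \<rat>" "x \<noteq> 0"
  shows "\<exists>k::int. N x = real p powi k"
proof -
  from assms(1) obtain a b where ab: "b > 0" "x = of_int a / of_int b" by (elim Rats_cases') auto
  have "a \<noteq> 0" using ab assms(2) by auto
  have "\<exists>k. N (of_int i) = (1 / real p) ^ k" if "i \<noteq> 0" for i :: int
    using that N_of_nat_power by (cases i) (auto simp del: of_nat_Suc)
  then obtain k l where "N (of_int a) = (1 / real p) ^ k" "N (of_int b) = (1 / real p) ^ l"
    using \<open>a \<noteq> 0\<close> \<open>b > 0\<close> by (metis less_irrefl)
  then have "N x = real p powi (int l - int k)"
    using p_gt_1 ab by (simp add: N_divide power_int_diff power_divide)
  then show ?thesis by blast
qed

text \<open>A rational number closer to \<open>x\<close> than \<open>N x\<close> has the same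
  absolute value, so the closure adds no new values.\<close>

lemma N_Qp:
  assumes "x \<in> Qp N" "x \<noteq> 0"
  shows "\<exists>k::int. N x = real p powi k"
proof -
  interpret M: Metric_space UNIV "\<lambda>x y. N (x - y)" by (rule Metric_N)
  have "0 < N x" using assms by simp
  moreover have "\<forall>r>0. \<exists>y\<in>\<rat>. N (x - y) < r"
    using assms(1) unfolding Qp_def abs_topology_def M.metric_closure_of by auto
  ultimately obtain y where y: "y \<in> \<rat>" "N (x - y) < N x" by blast
  then have "N y = N x" using N_diff_eq[OF y(2)] by simp
  then show ?thesis using N_Rats[OF y(1)] assms by (metis N_eq_0_iff)
qed

text \<open>Representatives of distinct cosets are linearly independent over \<open>Qp N\<close>, as
  the terms of a relation have distinct absolute values. Finiteness matters because
  \<open>card\<close> of an infinite set is \<open>0\<close>, which would empty the bound on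
  \<open>ramification_index\<close> of content.\<close>

lemma value_cosets_finite:
  assumes "finite_extension (Qp N) K"
  shows "finite ((\<lambda>x. (\<lambda>y. N x * N y) ` (Qp N - {0})) ` (K - {0}))" (is "finite (?\<kappa> ` _)")
proof -
  from assms obtain B where E: "is_subfield (Qp N)" and B: "finite B"
    and "\<forall>x\<in>K. \<exists>c. (\<forall>b\<in>B. c b \<in> Qp N) \<and> x = (\<Sum>b\<in>B. c b * b)"
    unfolding finite_extension_def by auto
  then have span: "K \<subseteq> span_over (Qp N) B" unfolding span_over_def by auto
  have sub: "?\<kappa> i \<subseteq> ?\<kappa> j"
    if "N (c * i) = N (d * j)" "c \<in> Qp N" "d \<in> Qp N" "c \<noteq> 0" "d \<noteq> 0" for c d i j
  proof
    fix v assume "v \<in> ?\<kappa> i"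
    then obtain y where y: "y \<in> Qp N" "y \<noteq> 0" "v = N i * N y" by auto
    have "N i = N j * N (d / c)" using that by (simp add: N_mult N_divide field_simps)
    then have "v = N j * N (d / c * y)" unfolding N_mult[of "d / c"] using y by simp
    moreover have "d / c * y \<in> Qp N - {0}" using that y subfield_closed(5,6)[OF E] by auto
    ultimately show "v \<in> ?\<kappa> j" by blast
  qed
  have "card G \<le> card B" if G: "G \<subseteq> ?\<kappa> ` (K - {0})" "finite G" for G
  proof (rule ccontr)
    assume "\<not> card G \<le> card B"
    obtain I where I: "I \<subseteq> K - {0}" "inj_on ?\<kappa> I" "G = ?\<kappa> ` I"
      using G(1) by (auto simp: subset_image_inj)
    have "finite I" using I G finite_imageD by blast
    have "card B < card I" using \<open>\<not> card G \<le> card B\<close> I by (simp add: card_image)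
    moreover have "i \<in> span_over (Qp N) B" if "i \<in> I" for i using that I span by auto
    ultimately obtain c where c: "\<forall>i\<in>I. c i \<in> Qp N" "\<exists>i\<in>I. c i \<noteq> 0" "(\<Sum>i\<in>I. c i * i) = 0"
      using linear_dependence[OF E B \<open>finite I\<close>, of "\<lambda>i. i"] by blast
    define J where "J = {i\<in>I. c i \<noteq> 0}"
    have "(\<Sum>i\<in>J. c i * i) = (\<Sum>i\<in>I. c i * i)"
      unfolding J_def using \<open>finite I\<close> by (intro sum.mono_neutral_left) auto
    moreover have "(\<Sum>i\<in>J. c i * i) \<noteq> 0"
    proof (rule sum_nonzero_of_inj_N)
      show "inj_on (\<lambda>i. N (c i * i)) J"
      proof (rule inj_onI)
        fix i j assume ij: "i \<in> J" "j \<in> J" "N (c i * i) = N (c j * j)"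
        then have "?\<kappa> i = ?\<kappa> j"
          using c(1) by (intro subset_antisym sub[of "c i" _ "c j"] sub[of "c j" _ "c i"]) (auto simp: J_def)
        then show "i = j" using I(2) ij by (auto simp: J_def inj_on_def)
      qed
    qed (use \<open>finite I\<close> c(2) I in \<open>auto simp: J_def\<close>)
    ultimately show False using c(3) by simp
  qed
  then show ?thesis using finite_if_finite_subsets_card_bdd by blast
qed

text \<open>Otherwise \<open>N x ^ (j - i)\<close> lies strictly between \<open>1 / p\<close> and
  \<open>1\<close> for \<open>i < j \<le> p - 1\<close>, hence is no integral power of
  \<open>p\<close>, and \<open>1, x, ..., x ^ (p - 1)\<close> occupy \<open>p\<close> different
  cosets of the value group.\<close>

lemma max_ideal_gap:
  assumes K: "finite_extension (Qp N) K" and e: "ramification_index N (Qp N) K \<le> p - 1"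
    and x: "x \<in> K" "N x < 1"
  shows "N x ^ (p - 1) \<le> 1 / real p"
proof (rule ccontr)
  let ?\<kappa> = "\<lambda>x. (\<lambda>y. N x * N y) ` (Qp N - {0})"
  assume "\<not> ?thesis"
  then have gt: "1 / real p < N x ^ (p - 1)" by simp
  then have "x \<noteq> 0" using p_gt_1 by (auto simp: zero_power)
  have E: "is_subfield (Qp N)" "is_subfield K" using K by (auto simp: finite_extension_def)
  have no: "\<not> ?\<kappa> (x ^ i) = ?\<kappa> (x ^ j)" if ij: "i < j" "j \<le> p - 1" for i j
  proof
    assume eq: "?\<kappa> (x ^ i) = ?\<kappa> (x ^ j)"
    have "N (x ^ i) * N 1 \<in> ?\<kappa> (x ^ i)" using subfield_closed(2)[OF E(1)] by (intro imageI) simp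
    then obtain y where y: "y \<in> Qp N" "y \<noteq> 0" "N (x ^ i) = N (x ^ j) * N y" using eq by auto
    obtain k where k: "N y = real p powi k" using N_Qp[OF y(1,2)] by blast
    have "N x ^ j = N x ^ i * N x ^ (j - i)" using ij by (simp flip: power_add)
    then have 1: "1 = N x ^ (j - i) * N y" using y(3) \<open>x \<noteq> 0\<close> by (simp add: N_power)
    have lt: "N x ^ (j - i) < 1" using x ij by (simp add: power_Suc_less_one power_less_one_iff)
    have "N x ^ (p - 1) \<le> N x ^ (j - i)" using x ij by (intro power_decreasing) auto
    then have lower: "1 / real p < N x ^ (j - i)" using gt by linarith
    show False
    proof (cases "k \<le> 0")
      case True
      then have "N y \<le> 1" using k p_gt_1 power_int_le_one[of "real p" k]
        by (metis less_imp_le nat_less_real_le of_nat_1 of_nat_less_iff power_int_0_right power_int_increasing)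
      then have "N x ^ (j - i) * N y \<le> N x ^ (j - i) * 1" by (intro mult_left_mono) auto
      then show False using 1 lt by simp
    next
      case False
      then have "real p powi 1 \<le> real p powi k" using p_gt_1 by (intro power_int_increasing) auto
      then have "real p \<le> N y" using k by simp
      then have "N x ^ (j - i) * real p \<le> 1" using 1 mult_left_mono[of "real p" "N y" "N x ^ (j - i)"] by simp
      then show False using lower p_gt_1 by (simp add: field_simps)
    qed
  qed
  have "inj_on (\<lambda>i. ?\<kappa> (x ^ i)) {..p - 1}"
    using no by (intro linorder_inj_onI) auto
  then have "card ((\<lambda>i. ?\<kappa> (x ^ i)) ` {..p - 1}) = p" using p_gt_1 by (simp add: card_image)
  moreover have "card ((\<lambda>i. ?\<kappa> (x ^ i)) ` {..p - 1}) \<le> card (?\<kappa> ` (K - {0}))"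
    using value_cosets_finite[OF K] x \<open>x \<noteq> 0\<close> subfield_closed(8)[OF E(2)]
    by (intro card_mono) auto
  ultimately show False using e p_gt_1 by (simp add: ramification_index_def)
qed

section \<open>The absolute value of factorials\<close>

definition varpi :: real where "varpi = (1 / real p) powr (1 / real (p - 1))"

lemma varpi_power: "varpi ^ (p - 1) = 1 / real p"
  using p_gt_1 by (simp add: varpi_def powr_powr flip: powr_realpow)

lemma varpi_bounds: "0 < varpi" "varpi < 1"
  using p_gt_1 powr_less_mono'[of "1 / real p" 0 "1 / real (p - 1)"] by (auto simp: varpi_def)

lemma max_ideal_le_varpi:
  assumes "finite_extension (Qp N) K" "ramification_index N (Qp N) K \<le> p - 1" "x \<in> K" "N x < 1"
  shows "N x \<le> varpi"
proof (rule power_le_imp_le_base)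
  show "N x ^ Suc (p - 2) \<le> varpi ^ Suc (p - 2)"
    using max_ideal_gap[OF assms] varpi_power p_gt_1 by (simp add: Suc_diff_Suc numeral_2_eq_2)
qed (use varpi_bounds in simp)

text \<open>The multiples of \<open>p\<close> up to \<open>p * q + r\<close> are
  \<open>p, 2 p, ..., q p\<close>, whose product is \<open>p ^ q * q!\<close>; all other factors
  have absolute value \<open>1\<close>.\<close>

lemma N_fact_block: "r < p \<Longrightarrow> N (fact (p * q + r)) = (1 / real p) ^ q * N (fact q)"
proof (induction q arbitrary: r)
  case 0
  then show ?case
  proof (induction r)
    case (Suc r)
    then have "\<not> p dvd Suc r" by (auto dest: dvd_imp_le)
    then show ?case using Suc by (simp add: N_mult N_of_nat_coprime del: of_nat_Suc)
  qed simp
next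
  case (Suc q)
  from Suc.prems show ?case
  proof (induction r)
    case 0
    have "p * Suc q = Suc (p * q + (p - 1))" using p_gt_1 by simp
    then have eq: "fact (p * Suc q) = (of_nat p * of_nat (Suc q) :: 'c) * fact (p * q + (p - 1))"
      by (metis fact_Suc of_nat_mult)
    have "N (fact (p * q + (p - 1))) = (1 / real p) ^ q * N (fact q)"
      using Suc.IH[of "p - 1"] p_gt_1 by simp
    then show ?case
      unfolding add_0_right eq N_mult N_p fact_Suc by simp
  next
    case (Suc r)
    then have "\<not> p dvd Suc r" by (auto dest: dvd_imp_le)
    then have "\<not> p dvd p * Suc q + Suc r" by (metis dvd_add_right_iff dvd_triv_left)
    moreover have "fact (p * Suc q + Suc r) = (of_nat (p * Suc q + Suc r) :: 'c) * fact (p * Suc q + r)"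
      by (simp only: add_Suc_right fact_Suc)
    ultimately show ?case using Suc by (simp add: N_mult N_of_nat_coprime del: of_nat_Suc of_nat_add mult_Suc_right)
  qed
qed

text \<open>With \<open>q = j div p\<close>, the valuation of \<open>j!\<close> is \<open>q\<close>
  plus that of \<open>q!\<close>, and \<open>q (p - 1) + (q - 1) = p q - 1 \<le> j - 1\<close> for
  \<open>q > 0\<close>. Raising to the power \<open>p - 1\<close> keeps the exponents
  integral.\<close>

lemma N_fact_power_ge: "j > 0 \<Longrightarrow> (1 / real p) ^ (j - 1) \<le> N (fact j) ^ (p - 1)"
proof (induction j rule: less_induct)
  case (less j)
  define q where "q = j div p"
  have eq: "N (fact j) = (1 / real p) ^ q * N (fact q)"
    using N_fact_block[of "j mod p" q] p_gt_1 by (simp add: q_def)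
  show ?case
  proof (cases "q = 0")
    case True
    then show ?thesis using eq p_gt_1 by (simp add: power_le_one)
  next
    case False
    have "q < j" using less.prems p_gt_1 by (simp add: q_def)
    then have IH: "(1 / real p) ^ (q - 1) \<le> N (fact q) ^ (p - 1)" using less.IH False by simp
    have "p * q \<le> j" by (simp add: q_def)
    moreover have "p * q - 1 = q * (p - 1) + (q - 1)"
      using False p_gt_1 by (cases p; cases q) (auto simp: algebra_simps)
    ultimately have "(1 / real p) ^ (j - 1) \<le> (1 / real p) ^ (q * (p - 1) + (q - 1))"
      using p_gt_1 by (intro power_decreasing) auto
    also have "\<dots> = ((1 / real p) ^ q) ^ (p - 1) * (1 / real p) ^ (q - 1)"
      by (simp only: power_add power_mult)
    also have "\<dots> \<le> ((1 / real p) ^ q) ^ (p - 1) * N (fact q) ^ (p - 1)"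
      using IH by (intro mult_left_mono) auto
    finally show ?thesis by (simp add: eq power_mult_distrib)
  qed
qed

lemma N_fact_ge: "j > 0 \<Longrightarrow> varpi ^ (j - 1) \<le> N (fact j)"
proof (rule power_le_imp_le_base)
  assume "j > 0"
  have "(varpi ^ (j - 1)) ^ (p - 1) = (varpi ^ (p - 1)) ^ (j - 1)"
    by (simp only: power_mult[symmetric] mult.commute)
  then show "(varpi ^ (j - 1)) ^ Suc (p - 2) \<le> N (fact j) ^ Suc (p - 2)"
    using N_fact_power_ge[OF \<open>j > 0\<close>] varpi_power p_gt_1 by (simp add: Suc_diff_Suc numeral_2_eq_2)
qed simp

end

section \<open>Critical points of a stable series\<close>

lemma fps_iterate_0: "fps_iterate f 0 = fps_X"
  by (simp add: fps_iterate_def)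

lemma fps_iterate_Suc: "fps_iterate f (Suc n) = f oo fps_iterate f n"
  by (simp add: fps_iterate_def)

lemma fps_iterate_nth_0: "fps_nth f 0 = 0 \<Longrightarrow> fps_nth (fps_iterate f n) 0 = 0"
  by (cases n) (simp_all add: fps_iterate_0 fps_iterate_Suc)

lemma fps_iterate_Suc': "fps_nth f 0 = 0 \<Longrightarrow> fps_iterate f (Suc n) = fps_iterate f n oo f"
proof (induction n)
  case 0
  then show ?case by (simp add: fps_iterate_0 fps_iterate_Suc fps_eq_iff fps_X_fps_compose)
next
  case (Suc n)
  then have "fps_iterate f (Suc (Suc n)) = f oo (fps_iterate f n oo f)"
    by (simp add: fps_iterate_Suc[of f "Suc n"])
  also have "\<dots> = fps_iterate f (Suc n) oo f"
    using Suc.prems by (simp add: fps_iterate_Suc fps_compose_assoc fps_iterate_nth_0)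
  finally show ?case .
qed

context nonarch_valued
begin

lemma integral_fps_iterate: "integral_fps f \<Longrightarrow> integral_fps (fps_iterate f n)"
proof (induction n)
  case 0
  show ?case by (simp add: fps_iterate_0 integral_fps_iff fps_X_def)
qed (auto simp: fps_iterate_Suc intro: integral_fps_compose)

lemma disk_value_fps_X:
  assumes "N z \<le> 1"
  shows "disk_value fps_X z z"
proof -
  have "(\<Sum>k<n. fps_nth fps_X k * z ^ k) = (if 1 < n then z else 0)" for n
    by (induction n) (auto simp: fps_X_def not_less le_Suc_eq)
  moreover have "N (z - (if 1 < n then z else 0)) \<le> N z ^ n" for n
    using assms by (cases "n \<le> 1") (auto simp: le_Suc_eq)
  ultimately show ?thesis by (simp add: disk_value_def)
qed

end

context complete_nonarch
begin

definition fps_value :: "'a fps \<Rightarrow> 'a \<Rightarrow> 'a" where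
  "fps_value g z = (SOME y. disk_value g z y)"

lemma disk_value_fps_value: "integral_fps g \<Longrightarrow> N z < 1 \<Longrightarrow> disk_value g z (fps_value g z)"
  unfolding fps_value_def by (rule someI_ex) (rule disk_value_exists)

text \<open>
  A commuting unit \<open>u\<close> permutes the finitely many critical points of \<open>f\<close> of given size, so one of
  them is periodic under \<open>u\<close>.  Its images under the iterates of \<open>f\<close> are periodic too and tend to
  \<open>0\<close>, but \<open>0\<close> is an isolated periodic point; so some iterate of \<open>f\<close> has a multiple root.
\<close>

lemma no_critical_points:
  assumes f: "integral_fps f" "fps_nth f 0 = 0" "fps_nth f 1 \<noteq> 0" "N (fps_nth f 1) < 1"
    and u: "integral_fps u" "fps_nth u 0 = 0" "N (fps_nth u 1) = 1" "\<And>m. m > 0 \<Longrightarrow> fps_nth u 1 ^ m \<noteq> 1"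
    and comm: "f oo u = u oo f"
    and splits: "\<And>n. \<exists>c ws. fps_trunc_poly (fps_deriv f) n = smult c (\<Prod>w\<leftarrow>ws. [:- w, 1:])"
    and simple: "\<And>n. n \<ge> 1 \<Longrightarrow> simple_roots_in_disk N (fps_iterate f n)"
  shows "N (fps_nth (fps_deriv f) k) \<le> N (fps_nth f 1)"
proof (rule ccontr)
  assume "\<not> ?thesis"
  \<comment> \<open>The constant term of \<open>f'\<close> is \<open>f'(0)\<close>, so a larger
    coefficient forces a critical point in the disk.\<close>
  then have "N (fps_nth (fps_deriv f) 0) < N (fps_nth (fps_deriv f) k)" by simp
  then obtain z where z: "N z < 1" "disk_value (fps_deriv f) z 0"
    using zero_exists[OF integral_fps_deriv[OF f(1)] splits] by blast
  define U where "U = fps_value u"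
  define F where "F = fps_value f"
  have U: "disk_value u x (U x)" and F: "disk_value f x (F x)" if "N x < 1" for x
    using that u f by (auto simp: U_def F_def disk_value_fps_value)
  have NU: "N (U x) \<le> N x" and NF: "N (F x) \<le> N x" if "N x < 1" for x
    using disk_value_first_order[OF U[OF that]] disk_value_first_order[OF F[OF that]] u f by auto
  have UF: "U (F x) = F (U x)" if x: "N x < 1" for x
  proof -
    have "disk_value (f oo u) x (F (U x))"
      using x NU[OF x] by (intro disk_value_compose[OF _ _ _ U F] f u) auto
    moreover have "disk_value (u oo f) x (U (F x))"
      using x NF[OF x] by (intro disk_value_compose[OF _ _ _ F U] f u) auto
    ultimately show ?thesis using disk_value_unique[OF x] comm by metis
  qed
  \<comment> \<open>Chain rule on both sides of the commutation relation; the value \<open>b\<close>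
    of \<open>u'\<close> is nonzero because it differs from the unit \<open>u'(0)\<close> by less
    than \<open>1\<close>.\<close>
  have crit: "disk_value (fps_deriv f) (U x) 0" if x: "N x < 1" "disk_value (fps_deriv f) x 0" for x
  proof -
    have Ux: "N (U x) < 1" and Fx: "N (F x) < 1" using NU NF x by fastforce+
    have "fps_deriv (f oo u) = fps_deriv (u oo f)" using comm by simp
    then have eq: "(fps_deriv f oo u) * fps_deriv u = (fps_deriv u oo f) * fps_deriv f"
      using u f by (simp add: fps_compose_deriv)
    obtain a where a: "disk_value (fps_deriv f) (U x) a"
      using disk_value_exists[OF integral_fps_deriv[OF f(1)] Ux] by blast
    obtain b where b: "disk_value (fps_deriv u) x b"
      using disk_value_exists[OF integral_fps_deriv[OF u(1)] x(1)] by blast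
    obtain d where d: "disk_value (fps_deriv u) (F x) d"
      using disk_value_exists[OF integral_fps_deriv[OF u(1)] Fx] by blast
    have "disk_value ((fps_deriv f oo u) * fps_deriv u) x (a * b)"
      using x a b U[OF x(1)]
      by (intro disk_value_mult disk_value_compose integral_fps_compose integral_fps_deriv f u) auto
    moreover have "disk_value ((fps_deriv u oo f) * fps_deriv f) x (d * 0)"
      using x d F[OF x(1)]
      by (intro disk_value_mult disk_value_compose integral_fps_compose integral_fps_deriv f u) auto
    ultimately have "a * b = 0" using disk_value_unique[OF x(1)] eq by fastforce
    moreover have "N (b - fps_nth u 1) < 1"
      using disk_value_first_order[OF b] x(1) by simp
    then have "b \<noteq> 0" using u(3) by auto
    ultimately show ?thesis using a by simp
  qed
  have orbit: "N ((U ^^ i) x) \<le> N x" if "N x < 1" for x i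
  proof (induction i)
    case (Suc i)
    then show ?case using NU[of "(U ^^ i) x"] that by simp
  qed simp
  have orbit_crit: "disk_value (fps_deriv f) ((U ^^ i) z) 0" for i
  proof (induction i)
    case (Suc i)
    then show ?case using crit[of "(U ^^ i) z"] orbit[OF z(1), of i] z(1) by simp
  qed (use z in simp)
  \<comment> \<open>The lower bound \<open>1 / 2\<close> makes the radius visibly positive, as
    \<open>zeros_repeat\<close> asks.\<close>
  define r where "r = max (N z) (1 / 2)"
  have "\<exists>i j. i < j \<and> (U ^^ i) z = (U ^^ j) z"
  proof (rule zeros_repeat[OF integral_fps_deriv[OF f(1)] _ splits, of r])
    show "fps_deriv f \<noteq> 0" using f(3) by (metis fps_deriv_nth fps_zero_nth add_0 mult_1 of_nat_1)
    show "N ((U ^^ i) z) \<le> r" for i using orbit[OF z(1), of i] by (simp add: r_def)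
  qed (use z orbit_crit in \<open>auto simp: r_def\<close>)
  then obtain i j where ij: "i < j" "(U ^^ i) z = (U ^^ j) z" by blast
  define x where "x = (U ^^ i) z"
  define m where "m = j - i"
  have m: "m > 0" using ij by (simp add: m_def)
  have x: "N x < 1" "disk_value (fps_deriv f) x 0"
    using orbit[OF z(1), of i] z(1) orbit_crit by (auto simp: x_def)
  have "(U ^^ j) z = (U ^^ (m + i)) z" using ij(1) by (simp add: m_def)
  then have "(U ^^ j) z = (U ^^ m) ((U ^^ i) z)" by (simp add: funpow_add)
  then have per: "(U ^^ m) x = x" using ij by (simp add: x_def)
  have Fit: "N ((F ^^ n) x) < 1" for n
  proof (induction n)
    case (Suc n)
    then show ?case using NF[of "(F ^^ n) x"] by simp
  qed (use x in simp)
  have UmF: "(U ^^ l) (F y) = F ((U ^^ l) y)" if "N y < 1" for l y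
  proof (induction l)
    case (Suc l)
    then show ?case using UF[of "(U ^^ l) y"] orbit[OF that, of l] that by simp
  qed simp
  have perF: "(U ^^ m) ((F ^^ n) x) = (F ^^ n) x" for n
  proof (induction n)
    case (Suc n)
    then show ?case using UmF[OF Fit[of n]] by simp
  qed (use per in simp)
  \<comment> \<open>Contraction rate of \<open>F\<close> on the disk of radius \<open>N x\<close>:
    the linear term brings the factor \<open>f'(0)\<close>, and the second-order remainder a factor
    \<open>N y \<le> N x\<close>.\<close>
  define q where "q = max (N (fps_nth f 1)) (N x)"
  have q: "0 \<le> q" "q < 1" using x f by (auto simp: q_def le_max_iff_disj)
  have contract: "N (F y) \<le> q * N y" if y: "N y \<le> N x" for y
  proof -
    have "N (F y - fps_nth f 1 * y) \<le> q * N y"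
    proof -
      have "N (F y - fps_nth f 1 * y) \<le> N y * N y"
        using disk_value_second_order[OF F, of y] y x f by (simp add: power2_eq_square)
      also have "\<dots> \<le> q * N y" using y by (intro mult_right_mono) (auto simp: q_def)
      finally show ?thesis .
    qed
    moreover have "N (fps_nth f 1 * y) \<le> q * N y"
      unfolding N_mult by (intro mult_right_mono) (auto simp: q_def)
    ultimately show ?thesis using N_add_le[of "F y - fps_nth f 1 * y" "q * N y" "fps_nth f 1 * y"] by simp
  qed
  have Fn: "N ((F ^^ n) x) \<le> q ^ n * N x" for n
  proof (induction n)
    case (Suc n)
    have "q ^ n * N x \<le> 1 * N x" using q by (intro mult_right_mono power_le_one) auto
    then have "N (F ((F ^^ n) x)) \<le> q * N ((F ^^ n) x)" using Suc by (intro contract) simp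
    also have "\<dots> \<le> q * (q ^ n * N x)" using Suc q by (intro mult_left_mono) auto
    finally show ?case by (simp add: mult_ac)
  qed simp
  have lin: "N ((U ^^ l) y - fps_nth u 1 ^ l * y) \<le> N y ^ 2" if y: "N y < 1" for l y
  proof (induction l)
    case (Suc l)
    define v where "v = (U ^^ l) y"
    have v: "N v \<le> N y" using orbit[OF y, of l] by (simp add: v_def)
    have "N (U v - fps_nth u 1 * v) \<le> N v ^ 2"
      using disk_value_second_order[OF U, of v] v y u by simp
    also have "\<dots> \<le> N y ^ 2" using v by (intro power_mono) auto
    finally have "N (U v - fps_nth u 1 * v) \<le> N y ^ 2" .
    moreover have "N (fps_nth u 1 * (v - fps_nth u 1 ^ l * y)) \<le> N y ^ 2"
      using Suc u(3) by (simp add: N_mult v_def)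
    ultimately have "N ((U v - fps_nth u 1 * v) + fps_nth u 1 * (v - fps_nth u 1 ^ l * y)) \<le> N y ^ 2"
      by (rule N_add_le)
    then show ?case by (simp add: v_def algebra_simps)
  qed simp
  \<comment> \<open>By \<open>lin\<close>, a point \<open>y\<close> fixed by \<open>U ^^ m\<close>
    satisfies \<open>d * N y \<le> N y ^ 2\<close>, so no nonzero one has absolute value below
    \<open>d\<close>.\<close>
  define d where "d = N (1 - fps_nth u 1 ^ m)"
  have d: "0 < d" using u(4)[OF m] by (simp add: d_def)
  obtain n where n: "q ^ n < d" using real_arch_pow_inv[OF d q(2)] by blast
  define y where "y = (F ^^ n) x"
  have "q ^ n * N x \<le> q ^ n * 1" using x q by (intro mult_left_mono) auto
  then have "N y < d" using Fn[of n] n by (simp add: y_def)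
  have y1: "N y < 1" using Fit by (simp add: y_def)
  have "y = 0"
  proof (rule ccontr)
    assume "y \<noteq> 0"
    have "N (y - fps_nth u 1 ^ m * y) \<le> N y ^ 2"
      using lin[OF y1, of m] perF[of n] by (simp add: y_def)
    then have "d * N y \<le> N y * N y"
      by (simp add: d_def power2_eq_square algebra_simps flip: N_mult)
    then show False using \<open>N y < d\<close> \<open>y \<noteq> 0\<close> by simp
  qed
  have it: "disk_value (fps_iterate f l) x ((F ^^ l) x)" for l
  proof (induction l)
    case 0
    then show ?case using x by (simp add: fps_iterate_0 disk_value_fps_X)
  next
    case (Suc l)
    then show ?case unfolding fps_iterate_Suc
      using F[OF Fit[of l]] by (auto intro!: disk_value_compose f integral_fps_iterate fps_iterate_nth_0)
  qed
  have "F 0 = 0" using disk_value_unique[of 0 f "F 0" "fps_nth f 0"] F[of 0] disk_value_0[OF f(1)] f(2) by simp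
  \<comment> \<open>One iteration beyond \<open>y = 0\<close> supplies the inner factor
    \<open>f'\<close>, which vanishes at \<open>x\<close>, in the chain rule, also when
    \<open>n = 0\<close>.\<close>
  then have "disk_value (fps_iterate f (Suc n)) x 0" using it[of "Suc n"] \<open>y = 0\<close> by (simp add: y_def)
  moreover have "disk_value (fps_deriv (fps_iterate f (Suc n))) x 0"
  proof -
    have Fx: "N (F x) < 1" using NF[OF x(1)] x by simp
    obtain a where a: "disk_value (fps_deriv (fps_iterate f n)) (F x) a"
      using disk_value_exists[OF integral_fps_deriv[OF integral_fps_iterate[OF f(1)]] Fx] by blast
    have "disk_value ((fps_deriv (fps_iterate f n) oo f) * fps_deriv f) x (a * 0)"
      using a F[OF x(1)] x
      by (intro disk_value_mult disk_value_compose integral_fps_compose integral_fps_deriv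
          integral_fps_iterate f) auto
    then show ?thesis unfolding fps_iterate_Suc'[OF f(2)] using f(2) by (simp add: fps_compose_deriv)
  qed
  ultimately have "\<not> simple_roots_in_disk N (fps_iterate f (Suc n))"
    using has_value_at_disk_value x(1) unfolding simple_roots_in_disk_def max_ideal_def by auto
  then show False using simple[of "Suc n"] by simp
qed

end

section \<open>The logarithm\<close>

lemma fps_mult_compose_nth:
  fixes g :: "'c::field fps"
  assumes "fps_nth g 0 = 0" "i \<le> m"
  shows "fps_nth (A * (B oo g)) i = fps_nth (A * (\<Sum>j\<le>m. fps_const (fps_nth B j) * g ^ j)) i"
proof -
  have "fps_nth (B oo g) b = fps_nth (\<Sum>j\<le>m. fps_const (fps_nth B j) * g ^ j) b" if "b \<le> m" for b
    unfolding fps_compose_nth fps_sum_nth fps_mult_left_const_nth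
    using that startsby_zero_power_prefix[OF assms(1)] by (intro sum.mono_neutral_left) auto
  then show ?thesis using assms(2) unfolding fps_mult_nth by (intro sum.cong) auto
qed

context nonarch_valued
begin

text \<open>Differentiation gives \<open>w * (l oo f) = l\<close> with
  \<open>w = f' / f'(0)\<close>, an integral series with constant term \<open>1\<close>. In degree
  \<open>n > 0\<close> the coefficient \<open>l_n\<close> reappears with the factor
  \<open>a ^ n\<close>, and \<open>1 - a ^ n\<close> is a unit; so \<open>l_n\<close> is determined
  integrally by the earlier coefficients.\<close>

lemma log_deriv_integral:
  assumes f: "integral_fps f" "fps_nth f 0 = 0" "fps_nth f 1 \<noteq> 0" "N (fps_nth f 1) < 1"
    and dom: "\<And>k. N (fps_nth (fps_deriv f) k) \<le> N (fps_nth f 1)"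
    and L: "fps_nth L 1 = 1" "L oo f = fps_const (fps_nth f 1) * L"
  shows "integral_fps (fps_deriv L)"
proof -
  define a where "a = fps_nth f 1"
  define w where "w = fps_const (1 / a) * fps_deriv f"
  define l where "l = fps_deriv L"
  have a: "a \<noteq> 0" "N a < 1" using f by (auto simp: a_def)
  have w: "integral_fps w"
    using dom a by (simp add: integral_fps_iff w_def N_mult N_divide a_def)
  have w0: "fps_nth w 0 = 1" using a by (simp add: w_def a_def)
  have "(l oo f) * fps_deriv f = fps_const a * l"
    using arg_cong[OF L(2), of fps_deriv] f(2) by (simp add: fps_compose_deriv l_def a_def)
  then have "fps_const (1 / a) * ((l oo f) * fps_deriv f) = fps_const (1 / a) * (fps_const a * l)" by simp
  also have "\<dots> = l" using a by (simp flip: mult.assoc)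
  finally have lw: "w * (l oo f) = l" by (simp add: w_def mult_ac)
  have "N (fps_nth l n) \<le> 1" for n
  proof (induction n rule: less_induct)
    case (less n)
    show ?case
    proof (cases "n = 0")
      case True
      then show ?thesis using L(1) by (simp add: l_def)
    next
      case False
      have "fps_nth l n = fps_nth (w * (\<Sum>j\<le>n. fps_const (fps_nth l j) * f ^ j)) n"
        using fps_mult_compose_nth[OF f(2) order_refl, of w l n] lw by simp
      also have "\<dots> = (\<Sum>j\<le>n. fps_nth l j * fps_nth (w * f ^ j) n)"
      proof -
        have "w * (\<Sum>j\<le>n. fps_const (fps_nth l j) * f ^ j) = (\<Sum>j\<le>n. fps_const (fps_nth l j) * (w * f ^ j))"
          by (simp add: sum_distrib_left mult_ac)
        then show ?thesis by (simp add: fps_sum_nth)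
      qed
      also have "\<dots> = (\<Sum>j<n. fps_nth l j * fps_nth (w * f ^ j) n) + fps_nth l n * fps_nth (w * f ^ n) n"
        by (simp flip: lessThan_Suc_atMost)
      also have "fps_nth (w * f ^ n) n = a ^ n"
      proof -
        have "fps_nth (w * f ^ n) n = (\<Sum>i\<in>{0..n}. fps_nth w i * fps_nth (f ^ n) (n - i))"
          by (simp add: fps_mult_nth)
        also have "\<dots> = (\<Sum>i\<in>{0}. fps_nth w i * fps_nth (f ^ n) (n - i))"
          using startsby_zero_power_prefix[OF f(2), of n] by (intro sum.mono_neutral_right) auto
        finally show ?thesis using w0 startsby_zero_power_nth_same[OF f(2)] by (simp add: a_def)
      qed
      finally have eq: "fps_nth l n * (1 - a ^ n) = (\<Sum>j<n. fps_nth l j * fps_nth (w * f ^ j) n)"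
        by (simp add: algebra_simps)
      have "N (a ^ n) < N 1" using a False by (simp add: N_power power_less_one_iff)
      then have "N (1 - a ^ n) = 1" using N_diff_eq[of "a ^ n" 1] by simp
      then have "N (fps_nth l n) = N (\<Sum>j<n. fps_nth l j * fps_nth (w * f ^ j) n)"
        using arg_cong[OF eq, of N] by (simp add: N_mult)
      also have "\<dots> \<le> 1"
        using less integral_fpsD[OF integral_fps_mult[OF w integral_fps_power[OF f(1)]]]
        by (intro N_sum_le) (auto simp: N_mult intro!: mult_le_one)
      finally show ?thesis .
    qed
  qed
  then show ?thesis by (simp add: integral_fps_iff l_def)
qed

end

text \<open>A first nonzero coefficient, in some degree \<open>n \<ge> 2\<close>, would force
  \<open>a = a ^ n\<close>.\<close>

lemma linearization_unique:
  fixes a :: "'c::field"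
  assumes f: "fps_nth f 0 = 0" "fps_nth f 1 = a" "a \<noteq> 0" "\<And>m. m > 0 \<Longrightarrow> a ^ m \<noteq> 1"
    and E: "fps_nth E 0 = 0" "fps_nth E 1 = 0" "E oo f = fps_const a * E"
  shows "E = 0"
proof -
  have "fps_nth E n = 0" for n
  proof (induction n rule: less_induct)
    case (less n)
    show ?case
    proof (cases "n < 2")
      case True
      then show ?thesis using E by (auto simp: less_2_cases_iff)
    next
      case False
      have "a * fps_nth E n = fps_nth (E oo f) n" by (simp add: E(3))
      also have "\<dots> = (\<Sum>k\<in>{n}. fps_nth E k * fps_nth (f ^ k) n)"
        unfolding fps_compose_nth using less by (intro sum.mono_neutral_right) auto
      also have "\<dots> = fps_nth E n * a ^ n"
        using startsby_zero_power_nth_same[OF f(1)] f(2) by simp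
      also have "a ^ n = a * a ^ (n - 1)" using False by (cases n) auto
      finally have "a * (fps_nth E n * (1 - a ^ (n - 1))) = 0" by (simp add: algebra_simps)
      then show ?thesis using f(3) f(4)[of "n - 1"] False by auto
    qed
  qed
  then show ?thesis by (simp add: fps_eq_iff)
qed

text \<open>As \<open>u\<close> commutes with \<open>f\<close>, the series \<open>L oo u\<close>
  satisfies the same linear functional equation as \<open>L\<close>, so only the linear coefficients
  have to be compared.\<close>

lemma log_commuting:
  fixes L :: "'c::field fps"
  assumes f: "fps_nth f 0 = 0" "fps_nth f 1 \<noteq> 0" "\<And>m. m > 0 \<Longrightarrow> fps_nth f 1 ^ m \<noteq> 1"
    and L: "fps_nth L 0 = 0" "fps_nth L 1 = 1" "L oo f = fps_const (fps_nth f 1) * L"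
    and u: "fps_nth u 0 = 0" "f oo u = u oo f"
  shows "L oo u = fps_const (fps_nth u 1) * L"
proof -
  define E where "E = (L oo u) - fps_const (fps_nth u 1) * L"
  have "E = 0"
  proof (rule linearization_unique[OF f(1) refl f(2,3)])
    show "fps_nth E 0 = 0" using L by (simp add: E_def)
    show "fps_nth E 1 = 0" using L by (simp add: E_def fps_compose_nth)
    have "(L oo u) oo f = (L oo f) oo u"
      using u f by (metis fps_compose_assoc)
    also have "\<dots> = fps_const (fps_nth f 1) * (L oo u)"
      using u by (simp add: L fps_compose_mult_distrib)
    finally show "E oo f = fps_const (fps_nth f 1) * E"
      unfolding E_def fps_compose_sub_distrib fps_compose_mult_distrib[OF f(1)] fps_const_compose L(3)
      by (simp add: right_diff_distrib mult.left_commute)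
  qed
  then show ?thesis by (simp add: E_def)
qed

lemma log_iterate:
  fixes L :: "'c::field fps"
  assumes "fps_nth f 0 = 0" "L oo f = fps_const a * L"
  shows "L oo fps_iterate f n = fps_const (a ^ n) * L"
proof (induction n)
  case (Suc n)
  have "L oo fps_iterate f (Suc n) = (L oo fps_iterate f n) oo f"
    unfolding fps_iterate_Suc'[OF assms(1)] using assms by (simp add: fps_compose_assoc fps_iterate_nth_0)
  then show ?case using assms by (simp add: Suc fps_compose_mult_distrib mult_ac flip: fps_const_mult)
qed (simp add: fps_iterate_0)

section \<open>The formal sum law\<close>

lemma fps_inv_compose:
  fixes L :: "'c::field_char_0 fps"
  assumes "fps_nth L 0 = 0" "fps_nth L 1 = 1"
  shows "fps_inv L oo L = fps_X"
  using fps_inv[of L] assms by simp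

lemma fps_inv_nth_0: "fps_nth (fps_inv L) 0 = 0"
  by (simp add: fps_inv_def)

lemma series_in_Y_mult: "series_in_Y g * series_in_Y h = series_in_Y (g * h)"
proof (rule fps_ext)
  fix n
  have "(\<Sum>i=0..n. fps_const (fps_nth g i) * fps_const (fps_nth h (n - i))) = fps_const (\<Sum>i=0..n. fps_nth g i * fps_nth h (n - i))"
    by (simp add: fps_eq_iff fps_sum_nth)
  then show "fps_nth (series_in_Y g * series_in_Y h) n = fps_nth (series_in_Y (g * h)) n"
    by (simp add: fps_mult_nth series_in_Y_def)
qed

lemma series_in_Y_power: "series_in_Y g ^ k = series_in_Y (g ^ k)"
proof (induction k)
  case 0
  show ?case by (simp add: fps_eq_iff series_in_Y_def)
qed (simp add: series_in_Y_mult)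

text \<open>One cut-off \<open>m\<close> for a whole range of coefficients, so that identities for
  the powers of L(X) + L(Y) can be combined linearly.\<close>

lemma formal_sum_law_nth:
  fixes L :: "'c::field_char_0 fps"
  assumes "fps_nth L 0 = 0" "i + j \<le> m"
  shows "fps_nth (fps_nth (formal_sum_law L) j) i =
    (\<Sum>k\<le>m. fps_nth (fps_inv L) k * fps_nth (fps_nth ((series_in_X L + series_in_Y L) ^ k) j) i)"
proof -
  have "fps_nth (fps_nth (series_in_X L + series_in_Y L) 0) 0 = 0"
    using assms by (simp add: series_in_X_def series_in_Y_def)
  then have "fps_nth (fps_nth ((series_in_X L + series_in_Y L) ^ k) j) i = 0" if "i + j < k" for k
    using fps_fps_power_nth_eq_0 that by blast
  then show ?thesis
    unfolding formal_sum_law_def fps_subst2_def fps_nth_Abs_fps using assms(2)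
    by (intro sum.mono_neutral_left) (auto simp: not_le)
qed

lemma formal_sum_law_0:
  fixes L :: "'c::field_char_0 fps"
  assumes "fps_nth L 0 = 0" "fps_nth L 1 = 1"
  shows "fps_nth (formal_sum_law L) 0 = fps_X"
proof (rule fps_ext)
  fix i
  have "fps_nth (series_in_X L + series_in_Y L) 0 = L"
    using assms by (simp add: series_in_X_def series_in_Y_def)
  then have "fps_nth (fps_nth (formal_sum_law L) 0) i = (\<Sum>k\<le>i. fps_nth (fps_inv L) k * fps_nth (L ^ k) i)"
    using formal_sum_law_nth[OF assms(1), of i 0 i] by (simp add: fps_power_zeroth)
  also have "\<dots> = fps_nth (fps_inv L oo L) i"
    by (simp add: fps_compose_nth atLeast0AtMost)
  finally show "fps_nth (fps_nth (formal_sum_law L) 0) i = fps_nth fps_X i"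
    by (simp add: fps_inv_compose[OF assms])
qed

text \<open>The partial derivative in \<open>X\<close>; on \<open>'c fps fps\<close>,
  \<open>fps_deriv\<close> is the one in \<open>Y\<close>.\<close>

definition fps_deriv_X :: "'c::field_char_0 fps fps \<Rightarrow> 'c fps fps" where
  "fps_deriv_X A = Abs_fps (\<lambda>j. fps_deriv (fps_nth A j))"

lemma fps_deriv_X_mult: "fps_deriv_X (A * B) = A * fps_deriv_X B + fps_deriv_X A * B"
  by (rule fps_ext) (simp add: fps_deriv_X_def fps_mult_nth fps_deriv_sum sum.distrib)

text \<open>L'(X) d/dY and L'(Y) d/dX are derivations, and both send L(X) + L(Y) to L'(X)
  L'(Y).\<close>

lemma formal_sum_power_pde:
  fixes L :: "'c::field_char_0 fps"
  defines "T \<equiv> series_in_X L + series_in_Y L"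
  shows "series_in_X (fps_deriv L) * fps_deriv (T ^ k) = series_in_Y (fps_deriv L) * fps_deriv_X (T ^ k)"
proof -
  have dX: "fps_deriv_X T = series_in_X (fps_deriv L)"
    by (rule fps_ext) (simp add: T_def fps_deriv_X_def series_in_X_def series_in_Y_def)
  have "of_nat n * fps_const c = fps_const (of_nat n * c)" for n and c :: 'c
    by (simp add: fps_of_nat[symmetric])
  then have dY: "fps_deriv T = series_in_Y (fps_deriv L)"
    by (intro fps_ext[of "fps_deriv T"])
      (simp add: T_def series_in_X_def series_in_Y_def del: of_nat_Suc of_nat_add)
  show ?thesis
  proof (induction k)
    case 0
    have "fps_deriv_X 1 = (0 :: 'c fps fps)"
      by (rule fps_ext) (simp add: fps_deriv_X_def)
    then show ?case by simp
  next
    case (Suc k)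
    have "series_in_X (fps_deriv L) * fps_deriv (T ^ Suc k)
        = T * (series_in_X (fps_deriv L) * fps_deriv (T ^ k)) + series_in_X (fps_deriv L) * series_in_Y (fps_deriv L) * T ^ k"
      by (simp add: dY algebra_simps del: fps_deriv_power)
    also have "\<dots> = series_in_Y (fps_deriv L) * fps_deriv_X (T ^ Suc k)"
      unfolding Suc by (simp add: fps_deriv_X_mult dX algebra_simps)
    finally show ?case .
  qed
qed

text \<open>Coefficientwise form of \<open>L'(X) \<partial>S/\<partial>Y = L'(Y) \<partial>S/\<partial>X\<close>.\<close>

lemma formal_sum_law_pde:
  fixes L :: "'c::field_char_0 fps"
  assumes L0: "fps_nth L 0 = 0"
  shows "fps_deriv L * (of_nat (Suc j) * fps_nth (formal_sum_law L) (Suc j))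
    = (\<Sum>i\<le>j. fps_const (fps_nth (fps_deriv L) (j - i)) * fps_deriv (fps_nth (formal_sum_law L) i))"
proof (rule fps_ext)
  fix b
  let ?l = "fps_deriv L"
  define T where "T = series_in_X L + series_in_Y L"
  \<comment> \<open>Covers \<open>Y\<close>-degree \<open>Suc j\<close> with \<open>X\<close>-degree
    \<open>b\<close>, and also \<open>Y\<close>-degree \<open>j\<close> with \<open>X\<close>-degree
    \<open>Suc b\<close>, which the \<open>X\<close>-derivative reaches.\<close>
  define m where "m = Suc (j + b)"
  define R where "R i = (\<Sum>k\<le>m. fps_const (fps_nth (fps_inv L) k) * fps_nth (T ^ k) i)" for i
  have SR: "fps_nth (fps_nth (formal_sum_law L) i) a = fps_nth (R i) a" if "a + i \<le> m" for a i
    using formal_sum_law_nth[OF L0 that] by (simp add: R_def T_def fps_sum_nth)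
  have pde: "?l * (of_nat (Suc j) * fps_nth (T ^ k) (Suc j))
      = (\<Sum>i\<le>j. fps_const (fps_nth ?l (j - i)) * fps_deriv (fps_nth (T ^ k) i))" for k
  proof -
    have "?l * (of_nat (Suc j) * fps_nth (T ^ k) (Suc j)) = fps_nth (series_in_X ?l * fps_deriv (T ^ k)) j"
      by (simp add: series_in_X_def)
    also have "\<dots> = fps_nth (fps_deriv_X (T ^ k) * series_in_Y ?l) j"
      using formal_sum_power_pde[of L k] by (simp add: T_def mult.commute)
    finally show ?thesis
      by (simp add: fps_mult_nth fps_deriv_X_def series_in_Y_def atLeast0AtMost mult.commute)
  qed
  have "fps_nth (?l * (of_nat (Suc j) * fps_nth (formal_sum_law L) (Suc j))) b
      = fps_nth (?l * (of_nat (Suc j) * R (Suc j))) b"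
    unfolding fps_mult_nth[of ?l]
    by (intro sum.cong) (auto simp: SR m_def simp flip: fps_of_nat simp del: of_nat_Suc)
  also have "?l * (of_nat (Suc j) * R (Suc j))
      = (\<Sum>k\<le>m. fps_const (fps_nth (fps_inv L) k) * (?l * (of_nat (Suc j) * fps_nth (T ^ k) (Suc j))))"
    by (simp add: R_def sum_distrib_left mult_ac del: of_nat_Suc)
  also have "\<dots> = (\<Sum>i\<le>j. \<Sum>k\<le>m. fps_const (fps_nth (fps_inv L) k) * (fps_const (fps_nth ?l (j - i)) * fps_deriv (fps_nth (T ^ k) i)))"
    unfolding pde sum_distrib_left by (rule sum.swap)
  also have "\<dots> = (\<Sum>i\<le>j. fps_const (fps_nth ?l (j - i)) * fps_deriv (R i))"
    by (simp only: R_def fps_deriv_sum fps_deriv_mult_const_left sum_distrib_left mult.left_commute)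
  also have "fps_nth \<dots> b = fps_nth (\<Sum>i\<le>j. fps_const (fps_nth ?l (j - i)) * fps_deriv (fps_nth (formal_sum_law L) i)) b"
    by (auto simp: fps_sum_nth SR m_def intro!: sum.cong)
  finally show "fps_nth (?l * (of_nat (Suc j) * fps_nth (formal_sum_law L) (Suc j))) b = \<dots>" .
qed

text \<open>The binomial theorem separates the variables in (L(X) + L(Y))^k, where replacing
  \<open>Y\<close> by \<open>g\<close> is ordinary composition. Only \<open>j \<le> i\<close> counts
  since \<open>g ^ j\<close> begins in degree \<open>j\<close>.\<close>

lemma formal_sum_law_subst:
  fixes L :: "'c::field_char_0 fps"
  assumes L0: "fps_nth L 0 = 0" and g0: "fps_nth g 0 = 0"
  shows "fps_nth (fps_inv L oo (L + (L oo g))) i = (\<Sum>j\<le>i. fps_nth (fps_nth (formal_sum_law L) j * g ^ j) i)"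
proof -
  define T where "T = series_in_X L + series_in_Y L"
  define H where "H = L + (L oo g)"
  define c where "c = fps_inv L"
  have H0: "fps_nth H 0 = 0" using L0 by (simp add: H_def)
  have Tk: "fps_nth (\<Sum>j\<le>i. fps_nth (T ^ k) j * g ^ j) i = fps_nth (H ^ k) i" for k
  proof -
    have "T ^ k = (\<Sum>r\<le>k. of_nat (k choose r) * series_in_X L ^ r * series_in_Y L ^ (k - r))"
      unfolding T_def by (rule binomial_ring)
    also have "\<dots> = (\<Sum>r\<le>k. fps_const (of_nat (k choose r) * L ^ r) * series_in_Y (L ^ (k - r)))"
      by (simp add: series_in_X_def series_in_Y_power fps_const_power fps_of_nat[symmetric] fps_const_mult[symmetric] del: fps_const_mult)
    finally have "fps_nth (T ^ k) j = (\<Sum>r\<le>k. (of_nat (k choose r) * L ^ r) * fps_const (fps_nth (L ^ (k - r)) j))" for j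
      by (simp add: fps_sum_nth series_in_Y_def)
    then have "(\<Sum>j\<le>i. fps_nth (T ^ k) j * g ^ j)
        = (\<Sum>j\<le>i. \<Sum>r\<le>k. (of_nat (k choose r) * L ^ r) * (fps_const (fps_nth (L ^ (k - r)) j) * g ^ j))"
      by (simp add: sum_distrib_right mult.assoc)
    also have "\<dots> = (\<Sum>r\<le>k. (of_nat (k choose r) * L ^ r) * (\<Sum>j\<le>i. fps_const (fps_nth (L ^ (k - r)) j) * g ^ j))"
      by (subst sum.swap) (simp add: sum_distrib_left)
    finally have "fps_nth (\<Sum>j\<le>i. fps_nth (T ^ k) j * g ^ j) i
        = (\<Sum>r\<le>k. fps_nth ((of_nat (k choose r) * L ^ r) * (L ^ (k - r) oo g)) i)"
      by (simp only: fps_sum_nth[of _ "{..k}"] fps_mult_compose_nth[OF g0 order_refl])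
    also have "\<dots> = fps_nth (\<Sum>r\<le>k. of_nat (k choose r) * L ^ r * (L oo g) ^ (k - r)) i"
      by (simp add: fps_sum_nth fps_compose_power[OF g0])
    also have "\<dots> = fps_nth (H ^ k) i" unfolding H_def by (simp only: binomial_ring)
    finally show ?thesis .
  qed
  \<comment> \<open>The cut-off \<open>i + i\<close> serves all \<open>j \<le> i\<close> and all
    \<open>X\<close>-degrees up to \<open>i\<close>.\<close>
  have "fps_nth (fps_nth (formal_sum_law L) j * g ^ j) i = (\<Sum>k\<le>i + i. fps_nth c k * fps_nth (fps_nth (T ^ k) j * g ^ j) i)"
    if "j \<le> i" for j
  proof -
    have "fps_nth (fps_nth (formal_sum_law L) j * g ^ j) i
        = (\<Sum>b=0..i. (\<Sum>k\<le>i + i. fps_nth c k * fps_nth (fps_nth (T ^ k) j) b) * fps_nth (g ^ j) (i - b))"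
      unfolding fps_mult_nth c_def T_def using that
      by (intro sum.cong refl arg_cong2[where f = "(*)"] formal_sum_law_nth L0) auto
    also have "\<dots> = (\<Sum>k\<le>i + i. \<Sum>b=0..i. fps_nth c k * fps_nth (fps_nth (T ^ k) j) b * fps_nth (g ^ j) (i - b))"
      unfolding sum_distrib_right by (rule sum.swap)
    finally show ?thesis by (simp add: fps_mult_nth sum_distrib_left mult.assoc)
  qed
  then have "(\<Sum>j\<le>i. fps_nth (fps_nth (formal_sum_law L) j * g ^ j) i)
      = (\<Sum>j\<le>i. \<Sum>k\<le>i + i. fps_nth c k * fps_nth (fps_nth (T ^ k) j * g ^ j) i)" by simp
  also have "\<dots> = (\<Sum>k\<le>i + i. fps_nth c k * fps_nth (\<Sum>j\<le>i. fps_nth (T ^ k) j * g ^ j) i)"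
    by (subst sum.swap) (simp add: fps_sum_nth sum_distrib_left)
  also have "\<dots> = (\<Sum>k\<le>i + i. fps_nth c k * fps_nth (H ^ k) i)" by (simp only: Tk)
  also have "\<dots> = fps_nth (c oo H) i"
    unfolding fps_compose_nth using startsby_zero_power_prefix[OF H0]
    by (intro sum.mono_neutral_right) auto
  finally show ?thesis by (simp add: H_def c_def)
qed

section \<open>Integrality of \<open>j! s_j\<close>\<close>

context nonarch_valued
begin

lemma integral_fps_cancel_unit:
  assumes g: "integral_fps g" "N (fps_nth g 0) = 1" and gh: "integral_fps (g * h)"
  shows "integral_fps h"
proof -
  have "N (fps_nth h n) \<le> 1" for n
  proof (induction n rule: less_induct)
    case (less n)
    have "fps_nth (g * h) n = fps_nth g 0 * fps_nth h n + (\<Sum>i=1..n. fps_nth g i * fps_nth h (n - i))"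
      unfolding fps_mult_nth by (simp add: sum.atLeast_Suc_atMost)
    then have "fps_nth g 0 * fps_nth h n = fps_nth (g * h) n - (\<Sum>i=1..n. fps_nth g i * fps_nth h (n - i))"
      by (simp add: algebra_simps)
    then have "N (fps_nth h n) = N (fps_nth (g * h) n - (\<Sum>i=1..n. fps_nth g i * fps_nth h (n - i)))"
      using g(2) by (metis N_mult mult_1)
    also have "\<dots> \<le> 1"
    proof (rule N_diff_le[OF integral_fpsD[OF gh] N_sum_le])
      show "N (fps_nth g i * fps_nth h (n - i)) \<le> 1" if "i \<in> {1..n}" for i
        using that less[of "n - i"] integral_fpsD[OF g(1), of i] by (simp add: N_mult mult_le_one)
    qed simp
    finally show ?case .
  qed
  then show ?thesis by (simp add: integral_fps_iff)
qed

text \<open>Multiplied by \<open>m!\<close>, the differential equation expresses L' (m + 1)! s_(m+1)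
  through the derivatives of i! s_i, with the integers m! / i! among the factors; L' has constant
  term \<open>1\<close> and cancels.\<close>

lemma formal_sum_law_fact_integral:
  assumes L: "fps_nth L 0 = 0" "fps_nth L 1 = 1" "integral_fps (fps_deriv L)"
  shows "integral_fps (fps_const (fact j) * fps_nth (formal_sum_law L) j)"
proof (induction j rule: less_induct)
  case (less j)
  let ?S = "fps_nth (formal_sum_law L)"
  let ?l = "fps_deriv L"
  show ?case
  proof (cases j)
    case 0
    then show ?thesis by (simp add: formal_sum_law_0[OF L(1,2)] integral_fps_iff fps_X_def)
  next
    case (Suc m)
    have fact_quot: "N (fact m / fact i) \<le> 1" if "i \<le> m" for i
    proof -
      obtain q :: nat where "fact m = (fact i :: nat) * q" using fact_dvd[OF \<open>i \<le> m\<close>, where 'a = nat] by (auto simp: dvd_def)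
      then have "(fact m :: 'c) = fact i * of_nat q" by (metis of_nat_fact of_nat_mult)
      then show ?thesis by (simp add: N_of_nat_le_1)
    qed
    have "?l * (fps_const (fact j) * ?S j) = fps_const (fact m) * (?l * (of_nat (Suc m) * ?S (Suc m)))"
      by (simp add: Suc fps_of_nat[symmetric] fps_const_mult[symmetric] mult_ac del: of_nat_Suc fps_const_mult)
    also have "\<dots> = (\<Sum>i\<le>m. fps_const (fps_nth ?l (m - i) * (fact m / fact i)) * fps_deriv (fps_const (fact i) * ?S i))"
      unfolding formal_sum_law_pde[OF L(1)] sum_distrib_left
      by (intro sum.cong refl) (simp add: fps_eq_iff)
    also have "integral_fps \<dots>"
    proof (rule fps_bound_sum)
      fix i assume "i \<in> {..m}"
      then have "N (fps_nth ?l (m - i) * (fact m / fact i)) \<le> 1"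
        unfolding N_mult by (intro mult_le_one integral_fpsD[OF L(3)] fact_quot N_nonneg) simp
      moreover have "integral_fps (fps_const (fact i) * ?S i)"
        using \<open>i \<in> {..m}\<close> Suc by (intro less) simp
      ultimately show "integral_fps (fps_const (fps_nth ?l (m - i) * (fact m / fact i)) * fps_deriv (fps_const (fact i) * ?S i))"
        by (intro integral_fps_mult[OF integral_fps_fps_const integral_fps_deriv])
    qed auto
    finally have "integral_fps (?l * (fps_const (fact j) * ?S j))" .
    from integral_fps_cancel_unit[OF L(3) _ this] show ?thesis using L(2) by simp
  qed
qed

section \<open>Division by series with a unit coefficient\<close>

text \<open>
  If \<open>h g\<close> is integral then so is \<open>h\<close>, as soon as \<open>h\<close> is bounded on the disk \<open>|z| < 1/r\<close>, which
  contains the zeros of \<open>g\<close>.  (Some growth condition is needed: \<open>1/(X - p)\<close> is not integral.)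
\<close>

lemma integral_fps_quotient_step:
  assumes g: "integral_fps g" "fps_nth g 0 = 0" "N (fps_nth g D) = 1" "\<And>i. i < D \<Longrightarrow> N (fps_nth g i) \<le> v"
    and r: "1 < r" "v * r ^ D = 1" and C: "0 \<le> C" and hg: "integral_fps (h * g)"
    and h: "\<And>i. N (fps_nth h i) \<le> max 1 (C * r ^ i)"
  shows "N (fps_nth h i) \<le> max 1 (C / r * r ^ i)"
proof (induction i rule: less_induct)
  case (less i)
  have D: "D > 0" using g(2,3) by (cases D) auto
  have "v = 1 / r ^ D" using r by (simp add: field_simps)
  then have v: "0 < v" and v1: "v \<le> 1" using r by (auto simp: one_le_power)
  \<comment> \<open>Degree \<open>i + D\<close> isolates the coefficient \<open>h_i\<close>, which
    meets the unit coefficient \<open>g_D\<close>.\<close>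
  have "fps_nth (h * g) (i + D) = fps_nth h i * fps_nth g D + (\<Sum>b\<in>{0..i + D} - {i}. fps_nth h b * fps_nth g (i + D - b))"
    unfolding fps_mult_nth by (subst sum.remove[of _ i]) auto
  then have "fps_nth h i * fps_nth g D = fps_nth (h * g) (i + D) - (\<Sum>b\<in>{0..i + D} - {i}. fps_nth h b * fps_nth g (i + D - b))"
    by (simp add: algebra_simps)
  then have "N (fps_nth h i) = N (fps_nth (h * g) (i + D) - (\<Sum>b\<in>{0..i + D} - {i}. fps_nth h b * fps_nth g (i + D - b)))"
    using g(3) by (metis N_mult mult_1_right)
  also have "\<dots> \<le> max 1 (C / r * r ^ i)"
  proof (rule N_diff_le[OF _ N_sum_le])
    show "N (fps_nth (h * g) (i + D)) \<le> max 1 (C / r * r ^ i)"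
      using integral_fpsD[OF hg, of "i + D"] by simp
    fix b assume b: "b \<in> {0..i + D} - {i}"
    show "N (fps_nth h b * fps_nth g (i + D - b)) \<le> max 1 (C / r * r ^ i)"
    proof (cases "b < i")
      case True
      have "N (fps_nth h b) * N (fps_nth g (i + D - b)) \<le> N (fps_nth h b) * 1"
        using integral_fpsD[OF g(1)] by (intro mult_left_mono) auto
      also have "\<dots> \<le> max 1 (C / r * r ^ b)" using less[OF True] by simp
      also have "C / r * r ^ b \<le> C / r * r ^ i"
        using True r C by (intro mult_left_mono power_increasing) auto
      finally show ?thesis unfolding N_mult by (smt (verit))
    next
      case False
      show ?thesis
      proof (cases "b = i + D")
        case False
        \<comment> \<open>Since \<open>g\<close> has no constant term, the last index is
          \<open>i + D - 1\<close>, and \<open>v * r ^ D = 1\<close> then leaves the gain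
          \<open>1 / r\<close>.\<close>
        then have lt: "i + D - b < D" and bl: "b \<le> i + D - 1" using b \<open>\<not> b < i\<close> by auto
        have "N (fps_nth h b) * N (fps_nth g (i + D - b)) \<le> max 1 (C * r ^ b) * v"
          using h[of b] g(4)[OF lt] by (intro mult_mono) auto
        also have "\<dots> = max v (C * r ^ b * v)" using v by (simp add: max_mult_distrib_right)
        also have "C * r ^ b * v \<le> C * r ^ (i + D - 1) * v"
          using bl r C v by (intro mult_left_mono mult_right_mono power_increasing) auto
        also have "C * r ^ (i + D - 1) * v = C / r * r ^ i"
        proof -
          have "r * r ^ (i + D - 1) = r ^ i * r ^ D"
            using D by (simp flip: power_Suc power_add)
          then have "r * (C * r ^ (i + D - 1) * v) = C * r ^ i * (v * r ^ D)" by (simp add: mult_ac)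
          then show ?thesis using r by (simp add: field_simps)
        qed
        finally show ?thesis using v1 unfolding N_mult by linarith
      qed (simp add: g(2))
    qed
  qed auto
  finally show ?case .
qed

text \<open>Each pass of the preceding step divides \<open>C\<close> by \<open>r\<close>, and for
  fixed \<open>i\<close> the bound \<open>C / r ^ n * r ^ i\<close> eventually drops below
  \<open>1\<close>.\<close>

lemma integral_fps_quotient:
  assumes g: "integral_fps g" "fps_nth g 0 = 0" "N (fps_nth g D) = 1" "\<And>i. i < D \<Longrightarrow> N (fps_nth g i) \<le> v"
    and r: "1 < r" "v * r ^ D = 1" and C: "0 \<le> C" and hg: "integral_fps (h * g)"
    and h: "fps_bound C r h"
  shows "integral_fps h"
proof -
  have iter: "N (fps_nth h i) \<le> max 1 (C / r ^ n * r ^ i)" for n i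
  proof (induction n arbitrary: i)
    case 0
    then show ?case using h by (simp add: fps_bound_def le_max_iff_disj)
  next
    case (Suc n)
    have "0 \<le> C / r ^ n" using C r by simp
    from integral_fps_quotient_step[OF g r this hg Suc, of i] show ?case by (simp add: mult_ac)
  qed
  have "N (fps_nth h i) \<le> 1" for i
  proof (rule ccontr)
    assume "\<not> ?thesis"
    then have gt: "1 < N (fps_nth h i)" by simp
    obtain n where n: "C * r ^ i < r ^ n" using real_arch_pow[OF r(1)] by blast
    then have "C / r ^ n * r ^ i < 1" using r by (simp add: field_simps)
    then show False using iter[of i n] gt by simp
  qed
  then show ?thesis by (simp add: integral_fps_iff)
qed

end

section \<open>Weierstrass degree, and the coefficientwise limit of the iterates\<close>

context nonarch_valued
begin

lemma N_sum_less: "(\<And>i. i \<in> A \<Longrightarrow> N (g i) < B) \<Longrightarrow> 0 < B \<Longrightarrow> N (\<Sum>i\<in>A. g i) < B"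
proof (induction A rule: infinite_finite_induct)
  case (insert x A)
  then have "N (g x) < B" "N (\<Sum>i\<in>A. g i) < B" by auto
  then show ?case using N_add_le_max[of "g x" "\<Sum>i\<in>A. g i"] insert.hyps by simp
qed auto

text \<open>The order at \<open>0\<close> of the reduction modulo the maximal ideal. Orders multiply
  under composition, which gives \<open>d ^ n\<close> for the iterates.\<close>

definition weierstrass_degree :: "'c fps \<Rightarrow> nat \<Rightarrow> bool" where
  "weierstrass_degree g D \<longleftrightarrow> integral_fps g \<and> N (fps_nth g D) = 1 \<and> (\<forall>i<D. N (fps_nth g i) < 1)"

lemma weierstrass_degree_mult:
  assumes g: "weierstrass_degree g D" and h: "weierstrass_degree h E"
  shows "weierstrass_degree (g * h) (D + E)"
proof -
  have int: "N (fps_nth g i) \<le> 1" "N (fps_nth h i) \<le> 1" for i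
    using g h integral_fpsD by (auto simp: weierstrass_degree_def)
  have small: "N (fps_nth g i * fps_nth h j) < 1" if "i < D \<or> j < E" for i j
  proof (cases "i < D")
    case True
    then have "N (fps_nth g i) < 1" using g by (simp add: weierstrass_degree_def)
    then show ?thesis using int(2)[of j] mult_le_one[of "N (fps_nth g i)"]
      by (metis N_mult N_nonneg le_less_trans mult_left_le)
  next
    case False
    then have "N (fps_nth h j) < 1" using h that by (simp add: weierstrass_degree_def)
    then show ?thesis using int(1)[of i]
      by (metis N_mult N_nonneg le_less_trans mult.commute mult_left_le)
  qed
  have "fps_nth (g * h) (D + E) = fps_nth g D * fps_nth h E + (\<Sum>i\<in>{0..D + E} - {D}. fps_nth g i * fps_nth h (D + E - i))"
    unfolding fps_mult_nth by (subst sum.remove[of _ D]) auto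
  moreover have "N (\<Sum>i\<in>{0..D + E} - {D}. fps_nth g i * fps_nth h (D + E - i)) < 1"
    by (intro N_sum_less small) auto
  moreover have "N (fps_nth g D * fps_nth h E) = 1" using g h by (simp add: weierstrass_degree_def N_mult)
  ultimately have "N (fps_nth (g * h) (D + E)) = 1" by (simp add: N_add_eq)
  moreover have "N (fps_nth (g * h) n) < 1" if "n < D + E" for n
    unfolding fps_mult_nth using that by (intro N_sum_less small) auto
  ultimately show ?thesis using g h by (auto simp: weierstrass_degree_def intro: integral_fps_mult)
qed

lemma weierstrass_degree_power:
  assumes "weierstrass_degree g D"
  shows "weierstrass_degree (g ^ k) (k * D)"
proof (induction k)
  case 0
  show ?case by (simp add: weierstrass_degree_def fps_bound_one)
qed (use assms in \<open>auto intro: weierstrass_degree_mult\<close>)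

lemma weierstrass_degree_compose:
  assumes f: "weierstrass_degree f d" and g: "weierstrass_degree g D" and g0: "fps_nth g 0 = 0"
  shows "weierstrass_degree (f oo g) (d * D)"
proof -
  have D: "D > 0" using g g0 by (cases D) (auto simp: weierstrass_degree_def)
  have int: "N (fps_nth f k) \<le> 1" "N (fps_nth (g ^ k) i) \<le> 1" for k i
    using f g integral_fpsD integral_fps_power by (auto simp: weierstrass_degree_def)
  have small: "N (fps_nth f k * fps_nth (g ^ k) i) < 1" if "k < d \<or> i < k * D" for k i
  proof (cases "k < d")
    case True
    then have "N (fps_nth f k) < 1" using f by (simp add: weierstrass_degree_def)
    then show ?thesis using int(2)[of k i] by (metis N_mult N_nonneg le_less_trans mult_left_le)
  next
    case False
    then have "N (fps_nth (g ^ k) i) < 1"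
      using weierstrass_degree_power[OF g, of k] that by (simp add: weierstrass_degree_def)
    then show ?thesis using int(1)[of k]
      by (metis N_mult N_nonneg le_less_trans mult.commute mult_left_le)
  qed
  have "d \<le> d * D" using D by simp
  then have "fps_nth (f oo g) (d * D) = fps_nth f d * fps_nth (g ^ d) (d * D)
      + (\<Sum>k\<in>{0..d * D} - {d}. fps_nth f k * fps_nth (g ^ k) (d * D))"
    unfolding fps_compose_nth by (subst sum.remove[of _ d]) auto
  moreover have "N (\<Sum>k\<in>{0..d * D} - {d}. fps_nth f k * fps_nth (g ^ k) (d * D)) < 1"
    using D by (intro N_sum_less small) auto
  moreover have "N (fps_nth f d * fps_nth (g ^ d) (d * D)) = 1"
    using f weierstrass_degree_power[OF g, of d] by (simp add: weierstrass_degree_def N_mult)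
  ultimately have "N (fps_nth (f oo g) (d * D)) = 1" by (simp add: N_add_eq)
  moreover have "N (fps_nth (f oo g) n) < 1" if n: "n < d * D" for n
    unfolding fps_compose_nth
  proof (intro N_sum_less small)
    fix k
    show "k < d \<or> n < k * D"
      using n mult_le_mono1[of d k D] by linarith
  qed simp
  ultimately show ?thesis
    using f g by (auto simp: weierstrass_degree_def intro: integral_fps_compose)
qed

lemma weierstrass_degree_iterate:
  assumes "weierstrass_degree f d" "fps_nth f 0 = 0"
  shows "weierstrass_degree (fps_iterate f n) (d ^ n)"
proof (induction n)
  case 0
  show ?case by (simp add: fps_iterate_0 weierstrass_degree_def integral_fps_iff fps_X_def)
next
  case (Suc n)
  then show ?case
    unfolding fps_iterate_Suc power_Suc
    using assms by (intro weierstrass_degree_compose fps_iterate_nth_0)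
qed

text \<open>Written as \<open>fps_inv L oo (fps_const (a ^ n) * L)\<close>, the iterate has
  coefficients that are polynomials in \<open>a ^ n\<close> without constant term, and
  \<open>B\<close> bounds their coefficients independently of \<open>n\<close>.\<close>

lemma fps_iterate_tendsto_0:
  assumes f: "fps_nth f 0 = 0" "N (fps_nth f 1) < 1"
    and L: "fps_nth L 0 = 0" "fps_nth L 1 = 1" "L oo f = fps_const (fps_nth f 1) * L"
    and e: "0 < e"
  shows "\<forall>\<^sub>F n in sequentially. N (fps_nth (fps_iterate f n) i) \<le> e"
proof -
  define a where "a = fps_nth f 1"
  define c where "c = fps_inv L"
  define B where "B = (\<Sum>k=0..i. N (fps_nth c k * fps_nth (L ^ k) i))"
  have B: "N (fps_nth c k * fps_nth (L ^ k) i) \<le> B" if "k \<le> i" for k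
    unfolding B_def using that by (intro member_le_sum) auto
  have "B \<ge> 0" by (simp add: B_def sum_nonneg)
  have bound: "N (fps_nth (fps_iterate f n) i) \<le> B * N a ^ n" for n
  proof -
    let ?g = "fps_iterate f n"
    have g0: "fps_nth ?g 0 = 0" by (rule fps_iterate_nth_0[OF f(1)])
    have "?g = fps_X oo ?g" using g0 by (simp add: fps_X_fps_compose fps_eq_iff)
    also have "\<dots> = c oo (L oo ?g)"
      unfolding c_def fps_inv_compose[OF L(1,2), symmetric] using g0 L by (simp add: fps_compose_assoc)
    also have "\<dots> = c oo (fps_const (a ^ n) * L)"
      using log_iterate[OF f(1) L(3)] by (simp add: a_def)
    finally have "fps_nth ?g i = (\<Sum>k=0..i. fps_nth c k * fps_nth ((fps_const (a ^ n) * L) ^ k) i)"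
      by (metis fps_compose_nth)
    also have "N \<dots> \<le> B * N a ^ n"
    proof (rule N_sum_le)
      fix k assume k: "k \<in> {0..i}"
      show "N (fps_nth c k * fps_nth ((fps_const (a ^ n) * L) ^ k) i) \<le> B * N a ^ n"
      proof (cases k)
        case 0
        then show ?thesis using \<open>B \<ge> 0\<close> by (simp add: c_def fps_inv_nth_0)
      next
        case (Suc k')
        have "fps_nth c k * fps_nth ((fps_const (a ^ n) * L) ^ k) i = fps_nth c k * fps_nth (L ^ k) i * (a ^ n) ^ k"
          by (simp add: power_mult_distrib fps_const_power)
        moreover have "N ((a ^ n) ^ k) \<le> N a ^ n"
          using f(2) unfolding N_power power_mult[symmetric]
          by (intro power_decreasing) (auto simp: a_def Suc)
        moreover have "N (fps_nth c k * fps_nth (L ^ k) i) \<le> B" using B k by simp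
        ultimately show ?thesis
          using \<open>B \<ge> 0\<close> mult_mono[of "N (fps_nth c k * fps_nth (L ^ k) i)" B "N ((a ^ n) ^ k)" "N a ^ n"]
          by (simp only: N_mult[of _ "(a ^ n) ^ k"] N_nonneg)
      qed
    qed (use \<open>B \<ge> 0\<close> in simp)
    finally show ?thesis .
  qed
  have "(\<lambda>n. B * N a ^ n) \<longlonglongrightarrow> B * 0"
    using f(2) by (intro tendsto_intros LIMSEQ_power_zero) (simp add: a_def)
  then have "\<forall>\<^sub>F n in sequentially. B * N a ^ n < e" using e by (intro order_tendstoD) auto
  then show ?thesis by eventually_elim (use bound in \<open>meson less_imp_le order_trans\<close>)
qed

end

section \<open>Integrality of the \<open>s_j\<close>\<close>

context padic_valued
begin

lemma formal_sum_law_bound: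
  assumes "fps_nth L 0 = 0" "fps_nth L 1 = 1" "integral_fps (fps_deriv L)" "j > 0"
  shows "N (fps_nth (fps_nth (formal_sum_law L) j) i) \<le> (1 / varpi) ^ (j - 1)"
proof -
  let ?s = "N (fps_nth (fps_nth (formal_sum_law L) j) i)"
  have "N (fact j) * ?s \<le> 1"
    using integral_fpsD[OF formal_sum_law_fact_integral[OF assms(1-3)], of j i] by (simp add: N_mult)
  moreover have "varpi ^ (j - 1) * ?s \<le> N (fact j) * ?s"
    using N_fact_ge[OF assms(4)] by (intro mult_right_mono) auto
  ultimately show ?thesis
    using varpi_bounds by (simp add: power_divide pos_le_divide_eq mult.commute)
qed

text \<open>
  Substituting \<open>Y = f\<^sup>n(X)\<close> into \<open>S\<close> gives the unit with multiplier \<open>1 + f'(0)\<^sup>n\<close>.  Given that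
  \<open>s\<^sub>0, \<dots>, s\<^sub>j\<close> are integral, dividing by \<open>(f\<^sup>n)\<^sup>j\<^sup>+\<^sup>1\<close> shows that
  \<open>s\<^sub>j\<^sub>+\<^sub>1 + s\<^sub>j\<^sub>+\<^sub>2 f\<^sup>n + \<dots>\<close> is integral, and this tends to \<open>s\<^sub>j\<^sub>+\<^sub>1\<close>.
\<close>

lemma formal_sum_law_integral:
  assumes L: "fps_nth L 0 = 0" "fps_nth L 1 = 1" "integral_fps (fps_deriv L)"
    and G: "\<And>n. fps_nth (G n) 0 = 0" "\<And>n. weierstrass_degree (G n) (D n)"
      "\<And>n i. i < D n \<Longrightarrow> N (fps_nth (G n) i) \<le> varpi"
    and lim: "\<And>i e. 0 < e \<Longrightarrow> \<forall>\<^sub>F n in sequentially. N (fps_nth (G n) i) \<le> e"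
    and unit: "\<forall>\<^sub>F n in sequentially. integral_fps (fps_inv L oo (L + (L oo G n)))"
  shows "integral_fps (fps_nth (formal_sum_law L) j)"
proof (induction j rule: less_induct)
  case (less j)
  let ?S = "fps_nth (formal_sum_law L)"
  show ?case
  proof (cases j)
    case 0
    then show ?thesis by (simp add: formal_sum_law_0[OF L(1,2)] integral_fps_iff fps_X_def)
  next
    case (Suc j')
    \<comment> \<open>In degree \<open>i\<close> the quotient \<open>h\<close> below is
      \<open>s_j\<close> plus this sum, so integrality passes from \<open>h\<close> to
      \<open>s_j\<close> whenever the sum is integral in that degree.\<close>
    have tail: "N (fps_nth (\<Sum>k=1..i. ?S (j + k) * G n ^ k) i) \<le> 1 \<Longrightarrow>
        integral_fps (fps_inv L oo (L + (L oo G n))) \<Longrightarrow> N (fps_nth (?S j) i) \<le> 1" for n i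
    proof -
      assume small: "N (fps_nth (\<Sum>k=1..i. ?S (j + k) * G n ^ k) i) \<le> 1"
      assume int_u: "integral_fps (fps_inv L oo (L + (L oo G n)))"
      define g where "g = G n"
      define d where "d = D n"
      have g: "integral_fps g" "fps_nth g 0 = 0" "N (fps_nth g d) = 1" "\<And>i. i < d \<Longrightarrow> N (fps_nth g i) \<le> varpi"
        using G[of n] G(2)[of n] G(3)[of _ n] by (auto simp: weierstrass_degree_def g_def d_def)
      have "d > 0" using g(2,3) by (cases d) auto
      \<comment> \<open>With \<open>varpi * r ^ d = 1\<close>, the coefficients of \<open>g\<close>
        below \<open>d\<close>, of size \<open>varpi\<close>, and those from \<open>d\<close> on, of
        size \<open>1\<close>, obey the same bound \<open>varpi * r ^ i\<close>.\<close>
      define r where "r = (1 / varpi) powr (1 / real d)"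
      have rd: "r ^ d = 1 / varpi"
        using \<open>d > 0\<close> varpi_bounds by (simp add: r_def powr_powr flip: powr_realpow)
      have r: "1 < r" "varpi * r ^ d = 1"
        using \<open>d > 0\<close> varpi_bounds by (auto simp: rd) (simp add: r_def gr_one_powr)
      have vanish: "fps_nth (A * g ^ m) i = 0" if "i < m" for A i m
        unfolding fps_mult_nth using that startsby_zero_power_prefix[OF g(2), of m] by (intro sum.neutral) auto
      \<comment> \<open>The tail of S(X, g) divided formally by \<open>g ^ j\<close>; the sum stops
        at \<open>i\<close> because \<open>g ^ k\<close> begins in degree \<open>k\<close>.\<close>
      define h where "h = Abs_fps (\<lambda>i. \<Sum>k\<le>i. fps_nth (?S (j + k) * g ^ k) i)"
      have h_trunc: "fps_nth h b = fps_nth (\<Sum>k\<le>i. ?S (j + k) * g ^ k) b" if "b \<le> i" for b i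
        unfolding h_def fps_sum_nth fps_nth_Abs_fps using that vanish by (intro sum.mono_neutral_left) auto
      have "h * g ^ j = (fps_inv L oo (L + (L oo g))) - (\<Sum>m<j. ?S m * g ^ m)"
      proof (rule fps_ext)
        fix i
        have "fps_nth (h * g ^ j) i = fps_nth ((\<Sum>k\<le>i. ?S (j + k) * g ^ k) * g ^ j) i"
          unfolding fps_mult_nth[of _ "g ^ j"] by (intro sum.cong) (auto simp: h_trunc[where i = i])
        also have "\<dots> = (\<Sum>k\<le>i. fps_nth (?S (j + k) * g ^ (j + k)) i)"
          by (simp only: sum_distrib_right fps_sum_nth power_add mult.assoc mult.commute[of "g ^ j"])
        also have "\<dots> = (\<Sum>m\<in>{j..j + i}. fps_nth (?S m * g ^ m) i)"
          using sum.shift_bounds_cl_nat_ivl[of "\<lambda>m. fps_nth (?S m * g ^ m) i" 0 j i]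
          by (simp add: atLeast0AtMost add.commute)
        also have "\<dots> = (\<Sum>m\<le>j + i. fps_nth (?S m * g ^ m) i) - (\<Sum>m<j. fps_nth (?S m * g ^ m) i)"
        proof -
          have "{..j + i} = {..<j} \<union> {j..j + i}" by auto
          then have "(\<Sum>m\<le>j + i. fps_nth (?S m * g ^ m) i)
              = (\<Sum>m<j. fps_nth (?S m * g ^ m) i) + (\<Sum>m\<in>{j..j + i}. fps_nth (?S m * g ^ m) i)"
            by (simp only:) (rule sum.union_disjoint, auto)
          then show ?thesis by simp
        qed
        also have "(\<Sum>m\<le>j + i. fps_nth (?S m * g ^ m) i) = (\<Sum>m\<le>i. fps_nth (?S m * g ^ m) i)"
          using vanish by (intro sum.mono_neutral_right) auto
        also have "\<dots> = fps_nth (fps_inv L oo (L + (L oo g))) i"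
          by (rule formal_sum_law_subst[OF L(1) g(2), symmetric])
        finally show "fps_nth (h * g ^ j) i = fps_nth ((fps_inv L oo (L + (L oo g))) - (\<Sum>m<j. ?S m * g ^ m)) i"
          by (simp add: fps_sum_nth)
      qed
      moreover have "integral_fps \<dots>"
        using int_u less g(1)
        by (intro fps_bound_diff fps_bound_sum integral_fps_mult integral_fps_power) (auto simp: g_def)
      ultimately have hgj: "integral_fps (h * g ^ j)" by simp
      \<comment> \<open>The bounds \<open>(1 / varpi) ^ (j' + k)\<close> for s_(j+k) and
        \<open>varpi ^ k\<close> for \<open>g ^ k\<close> leave this constant, whatever
        \<open>k\<close> is.\<close>
      define C where "C = (1 / varpi) ^ j'"
      have C: "0 \<le> C" using varpi_bounds by (simp add: C_def)
      have g_bound: "fps_bound varpi r g"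
        unfolding fps_bound_def
      proof
        fix i
        show "N (fps_nth g i) \<le> varpi * r ^ i"
        proof (cases "i < d")
          case True
          have "varpi * 1 \<le> varpi * r ^ i" using r varpi_bounds by (intro mult_left_mono) (auto simp: one_le_power)
          then show ?thesis using g(4)[OF True] by simp
        next
          case False
          then have "varpi * r ^ d \<le> varpi * r ^ i" using r varpi_bounds by (intro mult_left_mono power_increasing) auto
          then show ?thesis using integral_fpsD[OF g(1), of i] r by simp
        qed
      qed
      have term_bound: "fps_bound C r (?S (j + k) * g ^ k)" for k
      proof -
        have "N (fps_nth (?S (j + k)) i) \<le> (1 / varpi) ^ (j' + k)" for i
          using formal_sum_law_bound[OF L, of "j + k" i] Suc by simp
        then have "fps_bound ((1 / varpi) ^ (j' + k)) 1 (?S (j + k))" by (simp add: fps_bound_def)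
        then have "fps_bound ((1 / varpi) ^ (j' + k)) r (?S (j + k))"
          using r varpi_bounds by (elim fps_bound_mono) auto
        moreover have "fps_bound (varpi ^ k) r (g ^ k)"
          using g_bound r varpi_bounds by (intro fps_bound_power) auto
        ultimately have "fps_bound ((1 / varpi) ^ (j' + k) * varpi ^ k) r (?S (j + k) * g ^ k)"
          using r varpi_bounds by (intro fps_bound_mult) auto
        moreover have "(1 / varpi) ^ (j' + k) * varpi ^ k = C"
          using varpi_bounds by (simp add: C_def power_add power_divide)
        ultimately show ?thesis by simp
      qed
      have h_bound: "fps_bound C r h"
        unfolding fps_bound_def h_def fps_nth_Abs_fps
        using term_bound C r by (intro allI N_sum_le) (auto simp: fps_bound_def)
      \<comment> \<open>The factors \<open>g\<close> are removed one at a time, starting from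
        \<open>h * g ^ j\<close>; \<open>h_bound\<close> supplies the growth condition for every
        intermediate product.\<close>
      have "integral_fps (h * g ^ l)" if "l \<le> j" for l
        using that
      proof (induction "j - l" arbitrary: l)
        case 0
        then show ?case using hgj by simp
      next
        case (Suc x)
        then have "integral_fps (h * g ^ Suc l)" by (intro Suc.hyps(1)) auto
        moreover have "fps_bound (C * 1) r (h * g ^ l)"
        proof (rule fps_bound_mult[OF h_bound])
          show "fps_bound 1 r (g ^ l)" using fps_bound_mono[OF integral_fps_power[OF g(1)]] r by simp
        qed (use C r in auto)
        ultimately show ?case
          using integral_fps_quotient[OF g r C, of "h * g ^ l"] by (simp add: mult_ac)
      qed
      from this[of 0] have "N (fps_nth h i) \<le> 1" using integral_fpsD by simp
      moreover have "fps_nth h i = fps_nth (?S j) i + fps_nth (\<Sum>k=1..i. ?S (j + k) * g ^ k) i"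
        unfolding h_def fps_sum_nth fps_nth_Abs_fps by (simp add: sum.atLeast_Suc_atMost flip: atLeast0AtMost)
      ultimately show ?thesis
        using N_diff_le[of "fps_nth h i" 1 "fps_nth (\<Sum>k=1..i. ?S (j + k) * g ^ k) i"] small
        by (simp add: g_def)
    qed
    have "N (fps_nth (?S j) i) \<le> 1" for i
    proof -
      \<comment> \<open>Compensates the largest of the bounds \<open>(1 / varpi) ^ (j' + k)\<close>
        with \<open>k \<le> i\<close>.\<close>
      define e where "e = varpi ^ (j' + i)"
      have e: "0 < e" using varpi_bounds by (simp add: e_def)
      have "\<forall>\<^sub>F n in sequentially. \<forall>b\<in>{..i}. N (fps_nth (G n) b) \<le> e"
        using lim[OF e] by (intro eventually_ball_finite) auto
      then have "\<forall>\<^sub>F n in sequentially. (\<forall>b\<in>{..i}. N (fps_nth (G n) b) \<le> e) \<and>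
          integral_fps (fps_inv L oo (L + (L oo G n)))"
        using unit by (rule eventually_conj)
      then obtain n where n: "\<And>b. b \<le> i \<Longrightarrow> N (fps_nth (G n) b) \<le> e"
        "integral_fps (fps_inv L oo (L + (L oo G n)))"
        using eventually_happens'[OF sequentially_bot] by blast
      have Gint: "integral_fps (G n)" using G(2) by (simp add: weierstrass_degree_def)
      have "N (fps_nth (\<Sum>k=1..i. ?S (j + k) * G n ^ k) i) \<le> 1"
        unfolding fps_sum_nth
      proof (rule N_sum_le)
        fix k assume k: "k \<in> {1..i}"
        have pow: "N (fps_nth (G n ^ k) b) \<le> e" if "b \<le> i" for b
        proof -
          have "G n ^ k = G n * G n ^ (k - 1)" using k by (cases k) auto
          then have "fps_nth (G n ^ k) b = (\<Sum>a=0..b. fps_nth (G n) a * fps_nth (G n ^ (k - 1)) (b - a))"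
            by (simp add: fps_mult_nth)
          also have "N \<dots> \<le> e"
          proof (rule N_sum_le)
            fix a assume "a \<in> {0..b}"
            then have "N (fps_nth (G n) a) * N (fps_nth (G n ^ (k - 1)) (b - a)) \<le> e * 1"
              using n(1)[of a] that integral_fpsD[OF integral_fps_power[OF Gint]] e by (intro mult_mono) auto
            then show "N (fps_nth (G n) a * fps_nth (G n ^ (k - 1)) (b - a)) \<le> e" by (simp add: N_mult)
          qed (use e in simp)
          finally show ?thesis .
        qed
        show "N (fps_nth (?S (j + k) * G n ^ k) i) \<le> 1"
          unfolding fps_mult_nth
        proof (rule N_sum_le)
          fix a assume "a \<in> {0..i}"
          have "N (fps_nth (?S (j + k)) a) \<le> (1 / varpi) ^ (j' + k)"
            using formal_sum_law_bound[OF L, of "j + k" a] Suc by simp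
          also have "\<dots> \<le> (1 / varpi) ^ (j' + i)"
            using k varpi_bounds by (intro power_increasing) auto
          finally have "N (fps_nth (?S (j + k)) a) * N (fps_nth (G n ^ k) (i - a)) \<le> (1 / varpi) ^ (j' + i) * e"
            using pow[of "i - a"] varpi_bounds by (intro mult_mono) auto
          then show "N (fps_nth (?S (j + k)) a * fps_nth (G n ^ k) (i - a)) \<le> 1"
            using varpi_bounds by (simp add: N_mult e_def power_divide)
        qed simp
      qed simp
      then show ?thesis using tail n(2) by blast
    qed
    then show ?thesis by (simp add: integral_fps_iff)
  qed
qed

end

section \<open>Series with coefficients in a subfield\<close>

definition fps_over :: "'c::field set \<Rightarrow> 'c fps \<Rightarrow> bool" where
  "fps_over K g \<longleftrightarrow> (\<forall>n. fps_nth g n \<in> K)"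

lemma fps_over_mult:
  "is_subfield K \<Longrightarrow> fps_over K g \<Longrightarrow> fps_over K h \<Longrightarrow> fps_over K (g * h)"
  unfolding fps_over_def fps_mult_nth by (intro allI subfield_sum) (auto intro: subfield_closed(5))

lemma fps_over_power:
  assumes "is_subfield K" "fps_over K g"
  shows "fps_over K (g ^ k)"
proof (induction k)
  case 0
  show ?case using subfield_closed(1,2)[OF assms(1)] by (simp add: fps_over_def)
qed (use assms in \<open>auto intro: fps_over_mult\<close>)

lemma fps_over_compose:
  "is_subfield K \<Longrightarrow> fps_over K g \<Longrightarrow> fps_over K h \<Longrightarrow> fps_over K (g oo h)"
  using fps_over_power[of K h] unfolding fps_over_def fps_compose_nth
  by (intro allI subfield_sum) (auto intro: subfield_closed(5))

lemma fps_over_iterate: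
  assumes "is_subfield K" "fps_over K f"
  shows "fps_over K (fps_iterate f n)"
proof (induction n)
  case 0
  show ?case using subfield_closed(1,2)[OF assms(1)] by (simp add: fps_iterate_0 fps_over_def fps_X_def)
qed (use assms in \<open>auto simp: fps_iterate_Suc intro: fps_over_compose\<close>)

lemma fps_over_fps_inv:
  fixes L :: "'c::field_char_0 fps"
  assumes K: "is_subfield K" and L: "fps_over K L" "fps_nth L 0 = 0" "fps_nth L 1 = 1"
  shows "fps_over K (fps_inv L)"
proof -
  have "fps_nth (fps_inv L) n \<in> K" for n
  proof (induction n rule: less_induct)
    case (less n)
    have "fps_nth (fps_inv L oo L) n = (\<Sum>k<n. fps_nth (fps_inv L) k * fps_nth (L ^ k) n) + fps_nth (fps_inv L) n"
      using startsby_zero_power_nth_same[OF L(2), of n] L(3)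
      by (simp add: fps_compose_nth atLeast0AtMost flip: lessThan_Suc_atMost)
    then have "fps_nth (fps_inv L) n = fps_nth fps_X n - (\<Sum>k<n. fps_nth (fps_inv L) k * fps_nth (L ^ k) n)"
      using fps_inv_compose[OF L(2,3)] by (simp add: algebra_simps)
    also have "\<dots> \<in> K"
    proof (rule subfield_closed(3)[OF K])
      show "fps_nth fps_X n \<in> K" using subfield_closed(1,2)[OF K] by (simp add: fps_X_def)
      show "(\<Sum>k<n. fps_nth (fps_inv L) k * fps_nth (L ^ k) n) \<in> K"
        using less fps_over_power[OF K L(1)]
        by (intro subfield_sum[OF K] subfield_closed(5)[OF K]) (auto simp: fps_over_def)
    qed
    finally show ?case .
  qed
  then show ?thesis by (simp add: fps_over_def)
qed

lemma formal_sum_law_over: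
  fixes L :: "'c::field_char_0 fps"
  assumes K: "is_subfield K" and L: "fps_over K L" "fps_nth L 0 = 0" "fps_nth L 1 = 1"
  shows "fps_nth (fps_nth (formal_sum_law L) j) i \<in> K"
proof -
  let ?T = "series_in_X L + series_in_Y L"
  have Tj: "fps_over K (fps_nth ?T j)" for j
    using L(1) subfield_closed(1,4)[OF K] by (auto simp: fps_over_def series_in_X_def series_in_Y_def)
  have "fps_over K (fps_nth (?T ^ k) j)" for k j
  proof (induction k arbitrary: j)
    case 0
    show ?case using subfield_closed(1,2)[OF K] by (simp add: fps_over_def)
  next
    case (Suc k)
    have "fps_over K (fps_nth ?T i * fps_nth (?T ^ k) (j - i))" for i
      using fps_over_mult[OF K Tj Suc] .
    then show ?case
      unfolding power_Suc fps_mult_nth[of ?T] fps_over_def fps_sum_nth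
      by (intro allI subfield_sum[OF K]) blast
  qed
  then show ?thesis
    using fps_over_fps_inv[OF assms] unfolding formal_sum_law_def fps_subst2_def fps_nth_Abs_fps
    by (intro subfield_sum[OF K] subfield_closed(5)[OF K]) (auto simp: fps_over_def)
qed

text \<open>Openness is exploited only at the point \<open>1\<close>; with \<open>W\<close> the set
  of commuting multipliers this yields commuting units with prescribed multiplier.\<close>

lemma (in nonarch_valued) units_near_1:
  assumes "open_subgroup_of_units N F (W \<inter> integer_units N F)" and F: "is_subfield F"
  obtains e where "0 < e" "\<And>x. x \<in> F \<Longrightarrow> N x = 1 \<Longrightarrow> N (x - 1) < e \<Longrightarrow> x \<in> W"
proof -
  interpret M: Metric_space UNIV "\<lambda>x y. N (x - y)" by (rule Metric_N)
  have 1: "1 \<in> W \<inter> integer_units N F"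
    and "openin (subtopology M.mtopology (integer_units N F)) (W \<inter> integer_units N F)"
    using assms(1) unfolding open_subgroup_of_units_def abs_topology_def by blast+
  then obtain V where V: "openin M.mtopology V" "W \<inter> integer_units N F = V \<inter> integer_units N F"
    unfolding openin_subtopology by blast
  have "1 \<in> V" using V 1 by blast
  then obtain e where e: "0 < e" "M.mball 1 e \<subseteq> V" using V(1) unfolding M.openin_mtopology by blast
  have "x \<in> W" if x: "x \<in> F" "N x = 1" "N (x - 1) < e" for x
  proof -
    have "x \<in> M.mball 1 e" using x by (simp add: N_minus_commute[of 1])
    then have "x \<in> V" using e by blast
    moreover have "x \<noteq> 0" using x(2) by auto
    then have "x \<in> integer_units N F"
      using x F by (auto simp: integer_units_def ring_of_integers_def is_subfield_def N_inverse
          intro!: bexI[of _ "inverse x"])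
    ultimately show ?thesis using V(2) by blast
  qed
  with e(1) that show ?thesis by blast
qed

theorem theorem2p3:
  fixes p :: nat
    and N :: "'c::field_char_0 \<Rightarrow> real"
    and K F :: "'c set"
    and f L :: "'c fps"
  assumes Cp: "is_Cp p N"
    and K: "finite_extension (Qp N) K"
    and e: "ramification_index N (Qp N) K \<le> p - 1"
    and f: "noninvertible_series N K f" "stable_series f"
    and simple: "\<And>n. n \<ge> 1 \<Longrightarrow> simple_roots_in_disk N (fps_iterate f n)"
    and nonzero_mod: "\<exists>n. fps_nth f n \<notin> max_ideal N K"
    and F: "is_subfield F" "F \<subseteq> K" "fps_nth f 1 \<in> max_ideal N F"
    and U: "open_subgroup_of_units N F (commuting_multipliers N K f \<inter> integer_units N F)"
    and L_K: "\<And>n. fps_nth L n \<in> K"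
    and L_norm: "fps_nth L 0 = 0" "fps_nth L 1 = 1"
    and L_eq: "fps_compose L f = fps_const (fps_nth f 1) * L"
  shows "\<forall>j i. fps_nth (fps_nth (formal_sum_law L) j) i \<in> ring_of_integers N K"
proof -
  interpret complete_nonarch N
    using Cp by unfold_locales (auto simp: is_Cp_def)
  interpret padic_valued N p
    using Cp by unfold_locales (auto simp: is_Cp_def)
  have Qp: "is_subfield (Qp N)" and Ksub: "is_subfield K" using K by (auto simp: finite_extension_def)
  have fK: "fps_over K f" and f_int: "integral_fps f" and f0: "fps_nth f 0 = 0"
    using f by (auto simp: noninvertible_series_def X_int_series_def ring_of_integers_def fps_over_def integral_fps_iff)
  define a where "a = fps_nth f 1"
  have a: "a \<noteq> 0" "N a < 1" "\<And>m. m > 0 \<Longrightarrow> a ^ m \<noteq> 1" "a \<in> F"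
    using f(2) F(3) unfolding a_def stable_series_def max_ideal_def by blast+
  obtain \<epsilon> where \<epsilon>: "0 < \<epsilon>"
    "\<And>x. x \<in> F \<Longrightarrow> N x = 1 \<Longrightarrow> N (x - 1) < \<epsilon> \<Longrightarrow> x \<in> commuting_multipliers N K f"
    using units_near_1[OF U F(1)] by blast
  have unit: "\<exists>u. integral_fps u \<and> fps_nth u 0 = 0 \<and> fps_nth u 1 = 1 + x \<and> f oo u = u oo f"
    if x: "x \<in> F" "N x < 1" "N x < \<epsilon>" for x
  proof -
    have "N (1 + x) = 1" using N_add_eq[of x 1] x by simp
    then have "1 + x \<in> commuting_multipliers N K f"
      using x subfield_closed(2,4)[OF F(1)] by (intro \<epsilon>) auto
    then show ?thesis
      by (auto simp: commuting_multipliers_def commuting_units_def invertible_series_def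
          X_int_series_def ring_of_integers_def integral_fps_iff)
  qed

  \<comment> \<open>Elements of \<open>K\<close> are algebraic over \<open>Qp N\<close>, and
    \<open>is_Cp\<close> makes \<open>Qp_bar N\<close> algebraically closed.\<close>
  have splits: "\<exists>c ws. P = smult c (\<Prod>w\<leftarrow>ws. [:- w, 1:])" if P: "\<forall>i. coeff P i \<in> K" for P
  proof (rule poly_splits[of "Qp_bar N"])
    show "\<exists>x\<in>Qp_bar N. poly Q x = 0" if "(\<forall>i. coeff Q i \<in> Qp_bar N) \<and> degree Q > 0" for Q
      using Cp that by (simp add: is_Cp_def)
    show "\<forall>i. coeff P i \<in> Qp_bar N"
      using P algebraic_over_finite_extension[OF K] by (simp add: Qp_bar_def)
  qed (auto simp: Qp_bar_def intro: algebraic_over_zero algebraic_over_add algebraic_over_mult Qp)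

  have dom: "N (fps_nth (fps_deriv f) k) \<le> N (fps_nth f 1)" for k
  proof -
    \<comment> \<open>The multiplier \<open>1 + p ^ n\<close> lies in \<open>F\<close>, as every
      subfield contains the natural numbers, and an integer above \<open>1\<close> is no root of
      unity in characteristic \<open>0\<close>.\<close>
    have "(\<lambda>n. (1 / real p) ^ n) \<longlonglongrightarrow> 0" using p_gt_1 by (intro LIMSEQ_power_zero) simp
    then have "\<forall>\<^sub>F n in sequentially. (1 / real p) ^ n < min 1 \<epsilon>" using \<epsilon> by (intro order_tendstoD) auto
    then obtain n where "(1 / real p) ^ n < min 1 \<epsilon>"
      using eventually_happens'[OF sequentially_bot] by blast
    then have "N (of_nat (p ^ n)) < 1" "N (of_nat (p ^ n)) < \<epsilon>" by (auto simp: N_power N_p)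
    then obtain u where u: "integral_fps u" "fps_nth u 0 = 0" "fps_nth u 1 = 1 + of_nat (p ^ n)" "f oo u = u oo f"
      using unit[OF subfield_closed(9)[OF F(1)]] by blast
    have "fps_nth u 1 ^ m \<noteq> 1" if "m > 0" for m
    proof
      assume "fps_nth u 1 ^ m = 1"
      then have "of_nat ((1 + p ^ n) ^ m) = (of_nat 1 :: 'c)" using u(3) by simp
      then have "(1 + p ^ n) ^ m = 1" by (simp only: of_nat_eq_iff)
      then show False using that p_gt_1 by (simp add: power_eq_1_iff)
    qed
    moreover have "N (fps_nth u 1) = 1"
      using N_add_eq[of "of_nat (p ^ n)" 1] \<open>N (of_nat (p ^ n)) < 1\<close> u(3) by simp
    moreover have "\<exists>c ws. fps_trunc_poly (fps_deriv f) n = smult c (\<Prod>w\<leftarrow>ws. [:- w, 1:])" for n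
      using fK subfield_closed(1,5,9)[OF Ksub]
      by (intro splits) (auto simp: coeff_fps_trunc_poly fps_over_def simp del: of_nat_Suc of_nat_add)
    ultimately show ?thesis
      using no_critical_points[OF f_int f0 _ _ u(1,2) _ _ u(4)] simple a by (auto simp: a_def)
  qed
  have l_int: "integral_fps (fps_deriv L)"
    using log_deriv_integral[OF f_int f0 _ _ dom L_norm(2) L_eq] a by (simp add: a_def)

  obtain d where d: "weierstrass_degree f d"
  proof -
    obtain n where "fps_nth f n \<notin> max_ideal N K" using nonzero_mod by blast
    then have "N (fps_nth f n) = 1"
      using fK integral_fpsD[OF f_int, of n] by (simp add: max_ideal_def fps_over_def)
    then have "N (fps_nth f (LEAST n. N (fps_nth f n) = 1)) = 1" by (rule LeastI)
    moreover have "N (fps_nth f i) < 1" if "i < (LEAST n. N (fps_nth f n) = 1)" for i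
      using not_less_Least[OF that] integral_fpsD[OF f_int, of i] by simp
    ultimately show ?thesis using that f_int by (auto simp: weierstrass_degree_def)
  qed
  have W: "weierstrass_degree (fps_iterate f n) (d ^ n)" for n
    by (rule weierstrass_degree_iterate[OF d f0])
  have "integral_fps (fps_nth (formal_sum_law L) j)" for j
  proof (rule formal_sum_law_integral[OF L_norm l_int fps_iterate_nth_0[OF f0] W])
    \<comment> \<open>Coefficients below the Weierstrass degree lie in the maximal ideal of
      \<open>K\<close>, where the ramification bound improves \<open>< 1\<close> to
      \<open>\<le> varpi\<close>.\<close>
    show "N (fps_nth (fps_iterate f n) i) \<le> varpi" if "i < d ^ n" for n i
      using W[of n] that fps_over_iterate[OF Ksub fK, of n]
      by (intro max_ideal_le_varpi[OF K e]) (auto simp: weierstrass_degree_def fps_over_def)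
    show "\<forall>\<^sub>F n in sequentially. N (fps_nth (fps_iterate f n) i) \<le> e" if "0 < e" for i e
      using fps_iterate_tendsto_0[OF f0 _ L_norm L_eq that] a by (simp add: a_def)
    have "(\<lambda>n. N a ^ n) \<longlonglongrightarrow> 0" using a by (intro LIMSEQ_power_zero) simp
    then have "\<forall>\<^sub>F n in sequentially. N a ^ n < min 1 \<epsilon>" using \<epsilon> by (intro order_tendstoD) auto
    then show "\<forall>\<^sub>F n in sequentially. integral_fps (fps_inv L oo (L + (L oo fps_iterate f n)))"
    proof eventually_elim
      case (elim n)
      then obtain u where u: "integral_fps u" "fps_nth u 0 = 0" "fps_nth u 1 = 1 + a ^ n" "f oo u = u oo f"
        using unit[of "a ^ n"] subfield_closed(8)[OF F(1) a(4)] by (auto simp: N_power)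
      \<comment> \<open>For the multiplier \<open>1 + a ^ n\<close> the linearised unit splits as
        L(X) + L(f^n(X)), which is the argument of the sum law.\<close>
      have "L oo u = fps_const (1 + a ^ n) * L"
        using log_commuting[OF f0 _ _ L_norm L_eq u(2,4)] a u(3) by (simp add: a_def)
      also have "\<dots> = L + (L oo fps_iterate f n)"
        using log_iterate[OF f0 L_eq, of n] by (simp add: a_def algebra_simps flip: fps_const_add)
      finally have "fps_inv L oo (L + (L oo fps_iterate f n)) = (fps_inv L oo L) oo u"
        using fps_compose_assoc[OF u(2) L_norm(1), of "fps_inv L"] by simp
      also have "\<dots> = u"
        using u(2) by (simp add: fps_inv_compose[OF L_norm] fps_X_fps_compose fps_eq_iff)
      finally show ?case using u(1) by simp
    qed
  qed
  then show ?thesis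
    using formal_sum_law_over[OF Ksub _ L_norm] L_K
    by (auto simp: ring_of_integers_def integral_fps_iff fps_over_def)
qed

end
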